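(* The shape derivative, in the direction of a perturbation field $V$ vanishing in a neighbourhood of $\Gamma\setminus\Gamma_W$, of the variational form of the compressible Navier--Stokes equations $$-(\mathcal F^c(\mathbf u)-\mathcal F^v(\mathbf u,\nabla\mathbf u),\nabla\mathbf v)_\Omega+(n\cdot(\mathcal F^c(\mathbf u)-\mathcal F^v(\mathbf u,\nabla\mathbf u)),\mathbf v)_\Gamma=0\quad\forall\,\mathbf v\in\mathcal H$$ is given by the problem: find $\mathbf u'\in\mathcal H$ such that $$ \begin{aligned} 0=&-\bigl(\mathbf u',[\mathcal F^c_{\mathbf u}(\mathbf u)-\mathcal F^v_{\mathbf u}(\mathbf u,\nabla\mathbf u)]^\top\nabla\mathbf v\bigr)_\Omega-\bigl(\langle V,n\rangle[\mathcal F^c(\mathbf u)-\mathcal F^v(\mathbf u,\nabla\mathbf u)],\nabla\mathbf v\bigr)_{\Gamma_W}\\ &-\bigl(\mathbf u',\nabla\cdot[(\mathcal F^v_{\nabla\mathbf u}(\mathbf u,\nabla\mathbf u))^\top\nabla\mathbf v]\bigr)_\Omega+\bigl(\mathbf u',n\cdot[(\mathcal F^v_{\nabla\mathbf u}(\mathbf u,\nabla\mathbf u))^\top\nabla\mathbf v]\bigr)_\Gamma\\ &+\bigl(\mathbf u',[n\cdot(\mathcal F^c_{\mathbf u}(\mathbf u)-\mathcal F^v_{\mathbf u}(\mathbf u,\nabla\mathbf u))]^\top\mathbf v\bigr)_{\Gamma\setminus\Gamma_W}-\bigl(\nabla\mathbf u',(n\cdot\mathcal F^v_{\nabla\mathbf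 u}(\mathbf u,\nabla\mathbf u))^\top\mathbf v\bigr)_{\Gamma\setminus\Gamma_W}\\ &+\bigl(n\cdot(\mathcal F^c(\mathbf u)-\mathcal F^v(\mathbf u,\nabla\mathbf u))',\mathbf v\bigr)_{\Gamma_W}+\int_{\Gamma_W}\langle V,n\rangle\,\nabla\cdot\bigl([\mathcal F^c(\mathbf u)-\mathcal F^v(\mathbf u,\nabla\mathbf u)]\cdot\mathbf v\bigr)\,ds\qquad\forall\,\mathbf v\in\mathcal H. \end{aligned} $$
   Context: Setting ($d=2$). $\Omega\subset D\subset\mathbb R^2$ is the fluid domain with boundary $\Gamma=\Gamma_W\cup\Gamma_\infty$ (wall and far field, $\Gamma\setminus\Gamma_W=\Gamma_\infty$) and unit normal $n$. $\rho,v=(v_1,v_2)^\top,p,E,T,H=E+p/\rho$ are density, velocity, pressure, total energy, temperature and (total) enthalpy, $\mu$ viscosity, $\kappa$ thermal conductivity; perfect gas: $p=\rho RT$, $E=c_vT+\frac12\|v\|^2$. $\tau=\mu(\nabla v+(\nabla v)^\top-\frac23(\nabla\cdot v)I)$. Conserved variables $\mathbf u=(\rho,\rho v_1,\rho v_2,\rho E)^\top$; $\mathcal F^c=(f_1^c,f_2^c)$ with $f_1^c=(\rho v_1,\rho v_1^2+p,\rho v_1v_2,\rho Hv_1)^\top$, $f_2^c=(\rho v_2,\rho v_1v_2,\rho v_2^2+p,\rho Hv_2)^\top$; $\mathcal F^v=(f_1^v,f_2^v)$ with $f_k^v=(0,\tau_{1k},\tau_{2k},\sum_j\tau_{kj}v_j+\kappa\,\partial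 T/\partial x_k)^\top$. $\mathcal H=H^1\times H^2\times H^3\times H^4$ is a product of suitable Hilbert spaces of functions on $\Omega$, and wall boundary conditions are $v=0$ on $\Gamma_W$, $\nabla T\cdot n=0$ on $\Gamma_{adia}$, $T=T_{wall}$ on $\Gamma_{iso}$, where $\Gamma_W=\Gamma_{iso}\cup\Gamma_{adia}$ disjointly. Notation: $\mathcal F^c_{\mathbf u}=\partial\mathcal F^c/\partial\mathbf u$, $\mathcal F^v_{\mathbf u}=\partial\mathcal F^v/\partial\mathbf u$, $\mathcal F^v_{\nabla\mathbf u}=\partial\mathcal F^v/\partial\nabla\mathbf u$, with $4\times4$ blocks $G_{kl}=\partial f_k^v/\partial(\partial\mathbf u/\partial x_l)$. $(\cdot,\cdot)_X$ is the $L^2$ pairing on $X$; $n\cdot\mathcal F=\sum_kn_kf_k$; $(\mathcal F,\nabla\mathbf v)_\Omega=\int_\Omega\sum_kf_k\cdot\partial_k\mathbf v\,dx$ (similarly on boundaries); $\mathcal F\cdot\mathbf v$ is the vector field with components $f_k\cdot\mathbf v$; $(\mathcal F_{\mathbf u})^\top\nabla\mathbf v=\sum_k(\partial_{\mathbf u}f_k)^\top\partial_k\mathbf v$; $(\mathcal F^v_{\nabla\mathbf u})^\top\nabla\mathbf v$ has $l$-th column $\sum_kG_{kl}^\top\partial_k\mathbf v$; $(n\cdot\mathcal F_{\mathbf u})^\top\mathbf v=\sum_kn_k(\partial_{\mathbf u}f_k)^\top\mathbf v$; $(n\cdot\mathcal F^v_{\nabla\mathbf u})^\top\mathbf v$ has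 $l$-th column $\sum_kn_kG_{kl}^\top\mathbf v$. Shape calculus: $\Omega_t=\{x+tV(x):x\in\Omega\}$ with $V\in C_0^k(D;\mathbb R^2)$, $\mathcal H_t$ is the space corresponding to $\mathcal H$ on $\Omega_t$. The shape derivative of the variational form means: the variational equation on $\Omega_t$, with $\mathbf u$ the solution on $\Omega_t$ and test functions in $\mathcal H_t$, is differentiated with respect to $t$ at $t=0$. For $f(t,x)$, $f'=\partial_tf(t,x)|_{t=0}$ is the local shape derivative; $\mathbf u'$ and $(\mathcal F^c-\mathcal F^v)'$ are understood this way. Local shape derivatives $\mathbf v'$ of the test functions are themselves admissible test functions. Standing assumptions: boundary, solution and test functions are regular enough for all expressions to exist, and $V=(V\cdot n)n$ on $\Gamma_W$ (only the normal component of $V$ affects shape derivatives). *)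

theory Defs
  imports "HOL-Analysis.Analysis"
begin

text \<open>Class \<open>C\<^sup>k\<close> on an open set. The spaces to which this is applied are finite-dimensional,
  so continuity of all directional derivatives is continuity of the derivative.\<close>

primrec Ck_on :: "nat \<Rightarrow> ('a::real_normed_vector \<Rightarrow> 'b::real_normed_vector) \<Rightarrow> 'a set \<Rightarrow> bool" where
  "Ck_on 0 f S \<longleftrightarrow> continuous_on S f"
| "Ck_on (Suc k) f S \<longleftrightarrow> (\<forall>x\<in>S. f differentiable at x) \<and>
     (\<forall>h. Ck_on k (\<lambda>x. frechet_derivative f (at x) h) S)"

text \<open>\<open>C\<^sup>k\<close> up to the boundary. A function on \<open>\<Omega>\<close> is represented by a total function; if it is regular,
  the representative is a \<open>C\<^sup>k\<close> extension to a neighbourhood of the closure, and its derivatives on the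
  boundary are those of the extension (they do not depend on the extension).\<close>

definition Ck_closure :: "nat \<Rightarrow> ('a::real_normed_vector \<Rightarrow> 'b::real_normed_vector) \<Rightarrow> 'a set \<Rightarrow> bool" where
  "Ck_closure k f \<Omega> \<longleftrightarrow> (\<exists>N. open N \<and> closure \<Omega> \<subseteq> N \<and> Ck_on k f N)"

text \<open>\<open>C\<^sub>0\<^sup>k(D)\<close>: compact support in \<open>D\<close>.\<close>

definition Ck_compact_support :: "nat \<Rightarrow> ('a::real_normed_vector \<Rightarrow> 'b::real_normed_vector) \<Rightarrow> 'a set \<Rightarrow> bool" where
  "Ck_compact_support k f D \<longleftrightarrow> Ck_on k f UNIV \<and> (\<exists>K. compact K \<and> K \<subseteq> D \<and> (\<forall>x. x \<notin> K \<longrightarrow> f x = 0))"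

definition pd :: "'n::finite \<Rightarrow> (real^'n \<Rightarrow> 'b::real_normed_vector) \<Rightarrow> real^'n \<Rightarrow> 'b" where
  "pd k f x = frechet_derivative f (at x) (axis k 1)"

text \<open>Gradients and fluxes are indexed by the space direction first: \<open>grad f x $ k\<close> is the \<open>k\<close>-th
  partial derivative, and the inner product of \<open>real^4^2\<close> is the sum over \<open>k\<close> of those of \<open>real^4\<close>.\<close>

definition grad :: "(real^2 \<Rightarrow> real^4) \<Rightarrow> real^2 \<Rightarrow> real^4^2" where
  "grad f x = (\<chi> k. pd k f x)"

definition divergence :: "(real^2 \<Rightarrow> 'b::real_normed_vector^2) \<Rightarrow> real^2 \<Rightarrow> 'b" where
  "divergence F x = (\<Sum>k\<in>UNIV. pd k (\<lambda>y. F y $ k) x)"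

definition ndot :: "real^2 \<Rightarrow> 'b::real_normed_vector^2 \<Rightarrow> 'b" where
  "ndot n F = (\<Sum>k\<in>UNIV. n $ k *\<^sub>R F $ k)"

definition closed_C1_curve :: "(real \<Rightarrow> real^2) \<Rightarrow> bool" where
  "closed_C1_curve \<gamma> \<longleftrightarrow> Ck_on 1 \<gamma> UNIV \<and> (\<forall>s. \<gamma> (s + 1) = \<gamma> s) \<and> inj_on \<gamma> {0..<1} \<and>
     (\<forall>s. vector_derivative \<gamma> (at s) \<noteq> 0)"

text \<open>Near \<open>x\<close> the set \<open>\<Omega>\<close> looks like the half plane with outward unit normal \<open>\<nu>\<close>; there is at most one
  such \<open>\<nu>\<close>.\<close>

definition outer_normal_at :: "(real^2) set \<Rightarrow> real^2 \<Rightarrow> real^2 \<Rightarrow> bool" where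
  "outer_normal_at \<Omega> x \<nu> \<longleftrightarrow> norm \<nu> = 1 \<and>
     (\<forall>\<epsilon>>0. \<forall>\<^sub>F y in at x.
        (\<nu> \<bullet> (y - x) < - \<epsilon> * norm (y - x) \<longrightarrow> y \<in> \<Omega>) \<and>
        (\<nu> \<bullet> (y - x) > \<epsilon> * norm (y - x) \<longrightarrow> y \<notin> \<Omega>))"

definition outer_normal :: "(real^2) set \<Rightarrow> real^2 \<Rightarrow> real^2" where
  "outer_normal \<Omega> x = (THE \<nu>. outer_normal_at \<Omega> x \<nu>)"

text \<open>The boundary consists of the disjoint curves in \<open>\<C>\<close>, and \<open>\<Omega>\<close> lies locally on one side of it.\<close>

definition C1_domain :: "(real^2) set \<Rightarrow> (real \<Rightarrow> real^2) set \<Rightarrow> bool" where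
  "C1_domain \<Omega> \<C> \<longleftrightarrow> open \<Omega> \<and> bounded \<Omega> \<and>
     finite \<C> \<and> (\<forall>\<gamma>\<in>\<C>. closed_C1_curve \<gamma>) \<and>
     pairwise (\<lambda>\<gamma> \<delta>. range \<gamma> \<inter> range \<delta> = {}) \<C> \<and>
     frontier \<Omega> = (\<Union>\<gamma>\<in>\<C>. range \<gamma>) \<and>
     (\<forall>x\<in>frontier \<Omega>. \<exists>\<nu>. outer_normal_at \<Omega> x \<nu>)"

text \<open>Arc length integral of \<open>f\<close> over the part of the curves in \<open>\<C>\<close> that lies in \<open>S\<close>.\<close>

definition bd_integral :: "(real \<Rightarrow> real^2) set \<Rightarrow> (real^2) set \<Rightarrow> (real^2 \<Rightarrow> real) \<Rightarrow> real" where
  "bd_integral \<C> S f = (\<Sum>\<gamma>\<in>\<C>. integral {s \<in> {0..1}. \<gamma> s \<in> S}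
      (\<lambda>s. f (\<gamma> s) * norm (vector_derivative \<gamma> (at s))))"

text \<open>Gas constant, specific heat at constant volume, and viscosity and thermal conductivity, which
  may depend on the temperature.\<close>

record gas =
  gas_R :: real
  gas_cv :: real
  gas_mu :: "real \<Rightarrow> real"
  gas_kappa :: "real \<Rightarrow> real"

definition gas_ok :: "gas \<Rightarrow> bool" where
  "gas_ok g \<longleftrightarrow> gas_R g > 0 \<and> gas_cv g > 0 \<and> Ck_on 1 (gas_mu g) {0<..} \<and> Ck_on 1 (gas_kappa g) {0<..}"

text \<open>The state \<open>w\<close> is the vector of conserved variables, density, momentum and density times total
  energy.\<close>

definition density :: "real^4 \<Rightarrow> real" where
  "density w = w $ 1"

definition velocity :: "real^4 \<Rightarrow> real^2" where
  "velocity w = vector [w $ 2 / w $ 1, w $ 3 / w $ 1]"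

definition energy :: "real^4 \<Rightarrow> real" where
  "energy w = w $ 4 / w $ 1"

definition temperature :: "gas \<Rightarrow> real^4 \<Rightarrow> real" where
  "temperature g w = (energy w - (norm (velocity w))\<^sup>2 / 2) / gas_cv g"

definition pressure :: "gas \<Rightarrow> real^4 \<Rightarrow> real" where
  "pressure g w = density w * gas_R g * temperature g w"

definition enthalpy :: "gas \<Rightarrow> real^4 \<Rightarrow> real" where
  "enthalpy g w = energy w + pressure g w / density w"

definition Fc :: "gas \<Rightarrow> real^4 \<Rightarrow> real^4^2" where
  "Fc g w = (let \<rho> = density w; v1 = velocity w $ 1; v2 = velocity w $ 2;
                 p = pressure g w; h = enthalpy g w in
     vector [vector [\<rho> * v1, \<rho> * v1\<^sup>2 + p, \<rho> * v1 * v2, \<rho> * h * v1],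
             vector [\<rho> * v2, \<rho> * v1 * v2, \<rho> * v2\<^sup>2 + p, \<rho> * h * v2]])"

text \<open>For a state \<open>w\<close> with gradient \<open>q\<close>, the chain rule gives the \<open>k\<close>-th partial derivatives of velocity
  and temperature as their derivatives at \<open>w\<close> in the direction \<open>q $ k\<close>.\<close>

definition velocity_pd :: "real^4 \<Rightarrow> real^4^2 \<Rightarrow> 2 \<Rightarrow> real^2" where
  "velocity_pd w q k = frechet_derivative velocity (at w) (q $ k)"

definition temperature_pd :: "gas \<Rightarrow> real^4 \<Rightarrow> real^4^2 \<Rightarrow> 2 \<Rightarrow> real" where
  "temperature_pd g w q k = frechet_derivative (temperature g) (at w) (q $ k)"

definition stress :: "gas \<Rightarrow> real^4 \<Rightarrow> real^4^2 \<Rightarrow> real^2^2" where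
  "stress g w q = (\<chi> i j. gas_mu g (temperature g w) *
     (velocity_pd w q j $ i + velocity_pd w q i $ j -
      (if i = j then 2 / 3 * (\<Sum>l\<in>UNIV. velocity_pd w q l $ l) else 0)))"

definition Fv :: "gas \<Rightarrow> real^4 \<Rightarrow> real^4^2 \<Rightarrow> real^4^2" where
  "Fv g w q = (\<chi> k. vector [0, stress g w q $ 1 $ k, stress g w q $ 2 $ k,
     (\<Sum>j\<in>UNIV. stress g w q $ k $ j * velocity w $ j) +
       gas_kappa g (temperature g w) * temperature_pd g w q k])"

definition flux_field :: "gas \<Rightarrow> (real^2 \<Rightarrow> real^4) \<Rightarrow> real^2 \<Rightarrow> real^4^2" where
  "flux_field g u x = Fc g (u x) - Fv g (u x) (grad u x)"

definition Fc_u :: "gas \<Rightarrow> real^4 \<Rightarrow> 2 \<Rightarrow> real^4^4" where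
  "Fc_u g w k = matrix (frechet_derivative (\<lambda>w. Fc g w $ k) (at w))"

definition Fv_u :: "gas \<Rightarrow> real^4 \<Rightarrow> real^4^2 \<Rightarrow> 2 \<Rightarrow> real^4^4" where
  "Fv_u g w q k = matrix (frechet_derivative (\<lambda>w. Fv g w q $ k) (at w))"

text \<open>The blocks \<open>G\<^sub>k\<^sub>l\<close>: derivative of the \<open>k\<close>-th viscous flux with respect to the \<open>l\<close>-th partial
  derivative of the state.\<close>

definition G :: "gas \<Rightarrow> real^4 \<Rightarrow> real^4^2 \<Rightarrow> 2 \<Rightarrow> 2 \<Rightarrow> real^4^4" where
  "G g w q k l = matrix (\<lambda>h. frechet_derivative (\<lambda>q. Fv g w q $ k) (at q) (axis l h))"

text \<open>\<open>(F\<^sup>c\<^sub>u - F\<^sup>v\<^sub>u)\<^sup>T \<nabla>v\<close>, \<open>(F\<^sup>v\<^sub>\<nabla>\<^sub>u)\<^sup>T \<nabla>v\<close>, and their counterparts on the boundary, as functions of the point.\<close>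

definition flux_u_T_grad :: "gas \<Rightarrow> (real^2 \<Rightarrow> real^4) \<Rightarrow> (real^2 \<Rightarrow> real^4) \<Rightarrow> real^2 \<Rightarrow> real^4" where
  "flux_u_T_grad g u v x =
     (\<Sum>k\<in>UNIV. transpose (Fc_u g (u x) k - Fv_u g (u x) (grad u x) k) *v pd k v x)"

definition G_T_grad :: "gas \<Rightarrow> (real^2 \<Rightarrow> real^4) \<Rightarrow> (real^2 \<Rightarrow> real^4) \<Rightarrow> real^2 \<Rightarrow> real^4^2" where
  "G_T_grad g u v x = (\<chi> l. \<Sum>k\<in>UNIV. transpose (G g (u x) (grad u x) k l) *v pd k v x)"

definition n_flux_u_T :: "gas \<Rightarrow> (real^2 \<Rightarrow> real^4) \<Rightarrow> (real^2 \<Rightarrow> real^4) \<Rightarrow> real^2 \<Rightarrow> real^2 \<Rightarrow> real^4" where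
  "n_flux_u_T g u v n x =
     (\<Sum>k\<in>UNIV. n $ k *\<^sub>R (transpose (Fc_u g (u x) k - Fv_u g (u x) (grad u x) k) *v v x))"

definition n_G_T :: "gas \<Rightarrow> (real^2 \<Rightarrow> real^4) \<Rightarrow> (real^2 \<Rightarrow> real^4) \<Rightarrow> real^2 \<Rightarrow> real^2 \<Rightarrow> real^4^2" where
  "n_G_T g u v n x = (\<chi> l. \<Sum>k\<in>UNIV. n $ k *\<^sub>R (transpose (G g (u x) (grad u x) k l) *v v x))"

text \<open>\<open>X\<close> with inner product \<open>ip\<close> is a Hilbert space of functions on \<open>\<Omega>\<close>. Its elements are total functions
  whose values off \<open>\<Omega>\<close> are irrelevant; functions agreeing almost everywhere are identified.\<close>

definition hilbert_function_space ::
    "(real^2) set \<Rightarrow> (real^2 \<Rightarrow> real) set \<Rightarrow> ((real^2 \<Rightarrow> real) \<Rightarrow> (real^2 \<Rightarrow> real) \<Rightarrow> real) \<Rightarrow> bool" where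
  "hilbert_function_space \<Omega> X ip \<longleftrightarrow>
     (\<lambda>_. 0) \<in> X \<and>
     (\<forall>a. \<forall>f\<in>X. \<forall>h\<in>X. (\<lambda>x. a * f x + h x) \<in> X) \<and>
     (\<forall>f\<in>X. \<forall>h. (\<forall>x\<in>\<Omega>. h x = f x) \<longrightarrow> h \<in> X) \<and>
     (\<forall>a. \<forall>f\<in>X. \<forall>h\<in>X. \<forall>k\<in>X. ip (\<lambda>x. a * f x + h x) k = a * ip f k + ip h k) \<and>
     (\<forall>f\<in>X. \<forall>h\<in>X. ip f h = ip h f) \<and>
     (\<forall>f\<in>X. 0 \<le> ip f f) \<and>
     (\<forall>f\<in>X. ip f f = 0 \<longleftrightarrow> (AE x in lebesgue_on \<Omega>. f x = 0)) \<and>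
     (\<forall>f :: nat \<Rightarrow> real^2 \<Rightarrow> real. range f \<subseteq> X \<longrightarrow>
        (\<forall>\<epsilon>>0. \<exists>N. \<forall>i\<ge>N. \<forall>j\<ge>N. ip (\<lambda>x. f i x - f j x) (\<lambda>x. f i x - f j x) < \<epsilon>) \<longrightarrow>
        (\<exists>h\<in>X. (\<lambda>i. ip (\<lambda>x. f i x - h x) (\<lambda>x. f i x - h x)) \<longlonglongrightarrow> 0))"

definition product_space :: "(4 \<Rightarrow> (real^2 \<Rightarrow> real) set) \<Rightarrow> (real^2 \<Rightarrow> real^4) set" where
  "product_space X = {f. \<forall>i. (\<lambda>x. f x $ i) \<in> X i}"

definition variational_form ::
    "gas \<Rightarrow> (real^2) set \<Rightarrow> (real \<Rightarrow> real^2) set \<Rightarrow> (real^2 \<Rightarrow> real^4) \<Rightarrow> (real^2 \<Rightarrow> real^4) \<Rightarrow> real" where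
  "variational_form g \<Omega> \<C> u v =
     - integral \<Omega> (\<lambda>x. flux_field g u x \<bullet> grad v x) +
     bd_integral \<C> (frontier \<Omega>) (\<lambda>x. ndot (outer_normal \<Omega> x) (flux_field g u x) \<bullet> v x)"

definition wall_conditions ::
    "gas \<Rightarrow> (real^2) set \<Rightarrow> (real^2) set \<Rightarrow> (real^2) set \<Rightarrow> (real^2 \<Rightarrow> real) \<Rightarrow> (real^2 \<Rightarrow> real^4) \<Rightarrow> bool" where
  "wall_conditions g \<Omega> \<Gamma>iso \<Gamma>adia Twall u \<longleftrightarrow>
     (\<forall>x\<in>\<Gamma>iso \<union> \<Gamma>adia. velocity (u x) = 0) \<and>
     (\<forall>x\<in>\<Gamma>adia. (\<Sum>k\<in>UNIV. pd k (\<lambda>y. temperature g (u y)) x * outer_normal \<Omega> x $ k) = 0) \<and>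
     (\<forall>x\<in>\<Gamma>iso. temperature g (u x) = Twall x)"

text \<open>The equation is tested with all members of \<open>H\<close> for which its integrals make sense classically.\<close>

definition ns_solution ::
    "gas \<Rightarrow> (real^2) set \<Rightarrow> (real \<Rightarrow> real^2) set \<Rightarrow> (real^2) set \<Rightarrow> (real^2) set \<Rightarrow> (real^2 \<Rightarrow> real) \<Rightarrow>
     (real^2 \<Rightarrow> real^4) set \<Rightarrow> (real^2 \<Rightarrow> real^4) \<Rightarrow> bool" where
  "ns_solution g \<Omega> \<C> \<Gamma>iso \<Gamma>adia Twall H u \<longleftrightarrow>
     u \<in> H \<and>
     (\<forall>x\<in>closure \<Omega>. density (u x) > 0 \<and> temperature g (u x) > 0) \<and>
     wall_conditions g \<Omega> \<Gamma>iso \<Gamma>adia Twall u \<and>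
     (\<forall>v\<in>H. Ck_closure 1 v \<Omega> \<longrightarrow> variational_form g \<Omega> \<C> u v = 0)"

definition move :: "(real^2 \<Rightarrow> real^2) \<Rightarrow> real \<Rightarrow> real^2 \<Rightarrow> real^2" where
  "move V t x = x + t *\<^sub>R V x"

abbreviation moved_curves :: "(real^2 \<Rightarrow> real^2) \<Rightarrow> real \<Rightarrow> (real \<Rightarrow> real^2) set \<Rightarrow> (real \<Rightarrow> real^2) set" where
  "moved_curves V t \<C> \<equiv> (\<lambda>\<gamma>. move V t \<circ> \<gamma>) ` \<C>"

definition local_derivative :: "(real \<Rightarrow> real^2 \<Rightarrow> 'b::real_normed_vector) \<Rightarrow> real^2 \<Rightarrow> 'b" where
  "local_derivative w x = vector_derivative (\<lambda>t. w t x) (at 0)"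

text \<open>Families \<open>w t\<close> of functions on the perturbed domains: jointly of class \<open>C\<^sup>m\<close> in \<open>(t, x)\<close> near \<open>t = 0\<close>
  up to the boundary, with \<open>w t\<close> in the space \<open>H t\<close> on the perturbed domain.\<close>

definition regular_family :: "nat \<Rightarrow> (real^2) set \<Rightarrow> (real \<Rightarrow> real^2 \<Rightarrow> real^4) \<Rightarrow> bool" where
  "regular_family m \<Omega> w \<longleftrightarrow>
     (\<exists>N. open N \<and> {0} \<times> closure \<Omega> \<subseteq> N \<and> Ck_on m (\<lambda>(t, x). w t x) N)"

definition family_in ::
    "nat \<Rightarrow> (real^2) set \<Rightarrow> (real \<Rightarrow> (real^2 \<Rightarrow> real^4) set) \<Rightarrow> (real \<Rightarrow> real^2 \<Rightarrow> real^4) \<Rightarrow> bool" where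
  "family_in m \<Omega> H w \<longleftrightarrow> regular_family m \<Omega> w \<and> (\<forall>\<^sub>F t in nhds 0. w t \<in> H t)"

text \<open>Right-hand side of the differentiated equation; \<open>du\<close> and \<open>dF\<close> are the local shape derivatives
  of the state and of the total flux.\<close>

definition shape_form ::
    "gas \<Rightarrow> (real^2) set \<Rightarrow> (real \<Rightarrow> real^2) set \<Rightarrow> (real^2) set \<Rightarrow> (real^2 \<Rightarrow> real^2) \<Rightarrow> (real^2 \<Rightarrow> real^4) \<Rightarrow>
     (real^2 \<Rightarrow> real^4) \<Rightarrow> (real^2 \<Rightarrow> real^4^2) \<Rightarrow> (real^2 \<Rightarrow> real^4) \<Rightarrow> real" where
  "shape_form g \<Omega> \<C> \<Gamma>W V u du dF v = (let n = outer_normal \<Omega>; \<Gamma> = frontier \<Omega>; F = flux_field g u in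
     - integral \<Omega> (\<lambda>x. du x \<bullet> flux_u_T_grad g u v x)
     - bd_integral \<C> \<Gamma>W (\<lambda>x. ((V x \<bullet> n x) *\<^sub>R F x) \<bullet> grad v x)
     - integral \<Omega> (\<lambda>x. du x \<bullet> divergence (G_T_grad g u v) x)
     + bd_integral \<C> \<Gamma> (\<lambda>x. du x \<bullet> ndot (n x) (G_T_grad g u v x))
     + bd_integral \<C> (\<Gamma> - \<Gamma>W) (\<lambda>x. du x \<bullet> n_flux_u_T g u v (n x) x)
     - bd_integral \<C> (\<Gamma> - \<Gamma>W) (\<lambda>x. grad du x \<bullet> n_G_T g u v (n x) x)
     + bd_integral \<C> \<Gamma>W (\<lambda>x. ndot (n x) (dF x) \<bullet> v x)
     + bd_integral \<C> \<Gamma>W (\<lambda>x. (V x \<bullet> n x) * divergence (\<lambda>y. \<chi> k. F y $ k \<bullet> v y) x))"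

end

theory Submission
  imports Defs
begin

text \<open>The variational form on the moved domain is a volume integral of \<open>F(u) \<bullet> \<nabla>v\<close> and a boundary integral
  of \<open>n \<bullet> W\<close>, where \<open>W\<close> is the vector field with components \<open>F\<^sub>k \<bullet> v\<close>. Two transport formulas
  differentiate them at \<open>t = 0\<close>. For a function \<open>f(t, x)\<close> and a field \<open>W(t, x)\<close> of class \<open>C\<^sup>1\<close>,
  with a prime for the derivative in \<open>t\<close> at \<open>t = 0\<close>,

  \<^item> the integral of \<open>f\<close> over the moved domain has derivative \<open>\<integral>\<^sub>\<Omega> f' + \<integral>\<^sub>\<Gamma> f V \<bullet> n\<close>
    (\<open>derivative_of_volume_integral\<close>): change variables to \<open>\<Omega>\<close>, differentiate under the integral, and
    apply the divergence theorem to \<open>f V\<close>;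
  \<^item> the flux of \<open>W\<close> through the moved boundary has derivative \<open>\<integral>\<^sub>\<Gamma> n \<bullet> W' + (V \<bullet> n) \<nabla> \<cdot> W\<close>
    (\<open>derivative_of_boundary_flux\<close>): along a parametrized closed curve the difference of the two
    integrands is an exact derivative, which integrates to zero.

  In the sum, the terms with the local derivative \<open>v'\<close> of the test function are the variational equation on
  \<open>\<Omega>\<close> tested with \<open>v'\<close>, and vanish since \<open>v'\<close> is admissible. In the remaining volume term,
  \<open>F' = F\<^sub>u u' - G \<nabla>u'\<close> by the chain rule and the symmetry of second derivatives
  (\<open>flux_local_derivative\<close>); the part with \<open>\<nabla>u'\<close> is integrated by parts, once, by the divergence
  theorem, which produces the divergence term and the term on all of \<open>\<Gamma>\<close>. On the boundary the same
  chain rule expands \<open>n \<bullet> F'\<close> off the wall, where in addition \<open>V\<close> vanishes. This is \<open>shape_derivative\<close>.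

  Since the variational form is zero for all small \<open>t\<close>, its derivative is zero for every family of test
  functions. A given test function \<open>v\<close> is the member at \<open>t = 0\<close> of such a family on \<open>\<Omega>\<close> only, but by
  continuity a \<open>C\<^sup>1\<close> function and its first derivatives on the boundary are determined by the values
  inside (\<open>shape_form_cong_test\<close>).

  The divergence theorem for a bounded plane domain with \<open>C\<^sup>1\<close> boundary is proved along the way. Near
  a boundary point \<open>\<gamma>(s\<^sub>0)\<close> and for a direction \<open>e\<close> that points out of the domain, the map
  \<open>(s, r) \<mapsto> \<gamma>(s) + r e\<close> is a chart in which the domain is \<open>r < 0\<close> (\<open>boundary_chart\<close>) and the
  derivative in direction \<open>e\<close> is the derivative in \<open>r\<close>; so the fundamental theorem of calculus and Fubini
  suffice. Two such directions span the plane, and a partition of unity made of \<open>C\<^sup>1\<close> bumps removes the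
  assumption of small support.\<close>

section \<open>Calculus of \<open>C\<^sup>k\<close> maps\<close>

lemma Ck_on_SucD: "Ck_on (Suc k) f S \<Longrightarrow> Ck_on k f S"
proof (induction k arbitrary: f)
  case 0
  then show ?case
    by (auto intro!: continuous_at_imp_continuous_on differentiable_imp_continuous_within)
next
  case (Suc k)
  then show ?case by (meson Ck_on.simps(2))
qed

lemma Ck_on_le: "Ck_on m f S \<Longrightarrow> k \<le> m \<Longrightarrow> Ck_on k f S"
  by (induction m) (auto simp: le_Suc_eq simp del: Ck_on.simps dest: Ck_on_SucD)

lemma Ck_on_subset: "Ck_on k f S \<Longrightarrow> T \<subseteq> S \<Longrightarrow> Ck_on k f T"
  by (induction k arbitrary: f) (auto intro: continuous_on_subset)

lemma Ck_on_continuous: "Ck_on k f S \<Longrightarrow> continuous_on S f"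
  using Ck_on_le[of k f S 0] by simp

lemma Ck_on_has_derivative:
  "Ck_on (Suc k) f S \<Longrightarrow> x \<in> S \<Longrightarrow> (f has_derivative frechet_derivative f (at x)) (at x)"
  by (simp add: frechet_derivative_works)

lemma Ck_on_frechet_derivative:
  "Ck_on (Suc k) f S \<Longrightarrow> Ck_on k (\<lambda>x. frechet_derivative f (at x) h) S"
  by simp

lemma frechet_derivative_eqI: "(f has_derivative f') (at x) \<Longrightarrow> frechet_derivative f (at x) = f'"
  by (metis frechet_derivative_at)

lemma frechet_derivative_cong_open:
  assumes "open S" "x \<in> S" "\<And>y. y \<in> S \<Longrightarrow> f y = g y"
  shows "frechet_derivative f (at x) = frechet_derivative g (at x)"
proof -
  have "(f has_derivative d) (at x) \<longleftrightarrow> (g has_derivative d) (at x)" for d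
    using has_derivative_transform_within_open[OF _ assms(1,2), of f d UNIV g]
      has_derivative_transform_within_open[OF _ assms(1,2), of g d UNIV f] assms(3) by auto
  then show ?thesis unfolding frechet_derivative_def by simp
qed

lemma Ck_on_cong:
  assumes "open S" "\<And>x. x \<in> S \<Longrightarrow> f x = g x"
  shows "Ck_on k f S \<longleftrightarrow> Ck_on k g S"
  using assms(2)
proof (induction k arbitrary: f g)
  case 0
  then show ?case by (simp cong: continuous_on_cong)
next
  case (Suc k)
  have "f differentiable at x \<longleftrightarrow> g differentiable at x" if "x \<in> S" for x
    using has_derivative_transform_within_open[OF _ assms(1) that, of f _ UNIV g]
      has_derivative_transform_within_open[OF _ assms(1) that, of g _ UNIV f] Suc.prems
    unfolding differentiable_def by metis
  moreover have "Ck_on k (\<lambda>x. frechet_derivative f (at x) h) S \<longleftrightarrow>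
      Ck_on k (\<lambda>x. frechet_derivative g (at x) h) S" for h
    by (rule Suc.IH) (use frechet_derivative_cong_open[OF assms(1)] Suc.prems in metis)
  ultimately show ?case by simp
qed

lemma Ck_on_SucI:
  assumes "open S" "\<And>x. x \<in> S \<Longrightarrow> (f has_derivative f' x) (at x)" "\<And>h. Ck_on k (\<lambda>x. f' x h) S"
  shows "Ck_on (Suc k) f S"
proof -
  have "Ck_on k (\<lambda>x. frechet_derivative f (at x) h) S" for h
    using Ck_on_cong[OF assms(1), of "\<lambda>x. frechet_derivative f (at x) h" "\<lambda>x. f' x h" k] assms
    by (simp add: frechet_derivative_eqI[OF assms(2)])
  then show ?thesis using assms(2) by (auto simp: differentiable_def)
qed

lemma Ck_on_const: "Ck_on k (\<lambda>_. c) S"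
proof (induction k arbitrary: c)
  case (Suc k)
  then show ?case by (simp add: frechet_derivative_const)
qed auto

lemma Ck_on_linear: "bounded_linear L \<Longrightarrow> Ck_on k L S"
  by (cases k) (auto simp: linear_continuous_on bounded_linear_imp_differentiable
      frechet_derivative_eqI[OF bounded_linear_imp_has_derivative] intro: Ck_on_const)

lemma Ck_on_linear_comp:
  assumes "bounded_linear L" "open S" "Ck_on k f S"
  shows "Ck_on k (\<lambda>x. L (f x)) S"
  using assms(3)
proof (induction k arbitrary: f)
  case 0
  then show ?case using assms(1) by (simp add: bounded_linear.continuous_on)
next
  case (Suc k)
  show ?case
  proof (rule Ck_on_SucI[OF assms(2)])
    show "((\<lambda>x. L (f x)) has_derivative (\<lambda>h. L (frechet_derivative f (at x) h))) (at x)" if "x \<in> S" for x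
      by (intro bounded_linear.has_derivative[OF assms(1)] Ck_on_has_derivative[OF Suc.prems] that)
  qed (use Suc in auto)
qed

lemma Ck_on_add:
  assumes "open S" "Ck_on k f S" "Ck_on k g S"
  shows "Ck_on k (\<lambda>x. f x + g x) S"
  using assms(2,3)
proof (induction k arbitrary: f g)
  case 0
  then show ?case by (simp add: continuous_on_add)
next
  case (Suc k)
  show ?case
    by (rule Ck_on_SucI[OF assms(1), where f' = "\<lambda>x h. frechet_derivative f (at x) h + frechet_derivative g (at x) h"])
       (use Suc in \<open>auto intro!: has_derivative_add simp: frechet_derivative_works[symmetric]\<close>)
qed

lemma Ck_on_minus: "open S \<Longrightarrow> Ck_on k f S \<Longrightarrow> Ck_on k (\<lambda>x. - f x) S"
  by (rule Ck_on_linear_comp[OF bounded_linear_minus[OF bounded_linear_ident]])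

lemma Ck_on_diff: "open S \<Longrightarrow> Ck_on k f S \<Longrightarrow> Ck_on k g S \<Longrightarrow> Ck_on k (\<lambda>x. f x - g x) S"
  using Ck_on_add[of S k f "\<lambda>x. - g x"] Ck_on_minus[of S k g] by simp

lemma Ck_on_sum:
  "open S \<Longrightarrow> (\<And>i. i \<in> I \<Longrightarrow> Ck_on k (f i) S) \<Longrightarrow> Ck_on k (\<lambda>x. \<Sum>i\<in>I. f i x) S"
  by (induction I rule: infinite_finite_induct) (auto intro: Ck_on_add Ck_on_const)

lemma Ck_on_bilinear:
  assumes "bounded_bilinear B" "open S" "Ck_on k f S" "Ck_on k g S"
  shows "Ck_on k (\<lambda>x. B (f x) (g x)) S"
  using assms(3,4)
proof (induction k arbitrary: f g)
  case 0
  then show ?case using assms(1) by (simp add: bounded_bilinear.continuous_on)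
next
  case (Suc k)
  show ?case
  proof (rule Ck_on_SucI[OF assms(2)])
    show "((\<lambda>x. B (f x) (g x)) has_derivative
        (\<lambda>h. B (f x) (frechet_derivative g (at x) h) + B (frechet_derivative f (at x) h) (g x))) (at x)" if "x \<in> S" for x
      by (intro bounded_bilinear.FDERIV[OF assms(1)] Ck_on_has_derivative[OF Suc.prems(1)] Ck_on_has_derivative[OF Suc.prems(2)] that)
    show "Ck_on k (\<lambda>x. B (f x) (frechet_derivative g (at x) h) + B (frechet_derivative f (at x) h) (g x)) S" for h
      using Suc.prems by (intro Ck_on_add assms(2) Suc.IH) (auto simp del: Ck_on.simps intro: Ck_on_SucD Ck_on_frechet_derivative)
  qed
qed

lemmas Ck_on_mult = Ck_on_bilinear[OF bounded_bilinear_mult]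
lemmas Ck_on_scaleR = Ck_on_bilinear[OF bounded_bilinear_scaleR]
lemmas Ck_on_inner = Ck_on_bilinear[OF bounded_bilinear_inner]

text \<open>Continuity and differentiability of derivatives are known for one direction at a time. This
  expansion transfers them to directions that vary with the point.\<close>

lemma linear_basis_expansion:
  fixes A :: "'a::euclidean_space \<Rightarrow> 'b::real_vector"
  assumes "linear A"
  shows "A h = (\<Sum>b\<in>Basis. (h \<bullet> b) *\<^sub>R A b)"
proof -
  have "A h = A (\<Sum>b\<in>Basis. (h \<bullet> b) *\<^sub>R b)" by (simp add: euclidean_representation)
  then show ?thesis by (simp add: linear_sum[OF assms] linear_cmul[OF assms])
qed

lemma Ck_on_compose:
  fixes f :: "'a::real_normed_vector \<Rightarrow> 'b::euclidean_space"
  assumes "open S" "open T" "f ` S \<subseteq> T" "Ck_on k f S" "Ck_on k g T"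
  shows "Ck_on k (\<lambda>x. g (f x)) S"
  using assms(4,5)
proof (induction k arbitrary: g)
  case 0
  then show ?case using assms(3) by (auto intro: continuous_on_compose2)
next
  case (Suc k)
  let ?D = "frechet_derivative f" and ?E = "frechet_derivative g"
  have g: "(g has_derivative ?E (at (f x))) (at (f x))" if "x \<in> S" for x
    using Ck_on_has_derivative[OF Suc.prems(2), of "f x"] assms(3) that by auto
  have eq: "?E (at (f x)) (?D (at x) h) = (\<Sum>b\<in>Basis. (?D (at x) h \<bullet> b) *\<^sub>R ?E (at (f x)) b)" if "x \<in> S" for x h
    by (rule linear_basis_expansion[OF has_derivative_linear[OF g[OF that]]])
  show ?case
  proof (rule Ck_on_SucI[OF assms(1), where f' = "\<lambda>x h. \<Sum>b\<in>Basis. (?D (at x) h \<bullet> b) *\<^sub>R ?E (at (f x)) b"])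
    show "((\<lambda>x. g (f x)) has_derivative (\<lambda>h. \<Sum>b\<in>Basis. (?D (at x) h \<bullet> b) *\<^sub>R ?E (at (f x)) b)) (at x)" if "x \<in> S" for x
      using has_derivative_compose[OF Ck_on_has_derivative[OF Suc.prems(1) that] g[OF that]] eq[OF that] by simp
    have "Ck_on k (\<lambda>x. ?E (at (f x)) b) S" for b
      using Suc.IH[of "\<lambda>y. ?E (at y) b"] Suc.prems by (auto simp del: Ck_on.simps intro: Ck_on_SucD Ck_on_frechet_derivative)
    then show "Ck_on k (\<lambda>x. \<Sum>b\<in>Basis. (?D (at x) h \<bullet> b) *\<^sub>R ?E (at (f x)) b) S" for h
      using Suc.prems by (intro Ck_on_sum Ck_on_scaleR assms(1) Ck_on_linear_comp[OF bounded_linear_inner_left]) auto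
  qed
qed

lemma Ck_on_inverse_id: "Ck_on k (inverse :: real \<Rightarrow> real) (- {0})"
proof (induction k)
  case 0
  then show ?case by (auto intro!: continuous_intros)
next
  case (Suc k)
  show ?case
    by (rule Ck_on_SucI[where f' = "\<lambda>x h. - (inverse x * h * inverse x)"])
      (auto intro!: derivative_eq_intros Ck_on_minus Ck_on_mult Suc Ck_on_const)
qed

lemma Ck_on_divide:
  fixes f g :: "'a::real_normed_vector \<Rightarrow> real"
  assumes "open S" "Ck_on k f S" "Ck_on k g S" "\<And>x. x \<in> S \<Longrightarrow> g x \<noteq> 0"
  shows "Ck_on k (\<lambda>x. f x / g x) S"
  unfolding divide_inverse
  by (intro Ck_on_mult assms Ck_on_compose[OF assms(1) _ _ assms(3) Ck_on_inverse_id]) (use assms in auto)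

lemma Ck_on_Pair:
  assumes "open S" "Ck_on k f S" "Ck_on k g S"
  shows "Ck_on k (\<lambda>x. (f x, g x)) S"
proof -
  have "bounded_linear (\<lambda>x::'b. (x, 0::'c))" "bounded_linear (\<lambda>x::'c. (0::'b, x))"
    by (auto intro: bounded_linear_Pair bounded_linear_ident bounded_linear_zero)
  from Ck_on_add[OF assms(1) Ck_on_linear_comp[OF this(1) assms(1,2)] Ck_on_linear_comp[OF this(2) assms(1,3)]]
  show ?thesis by simp
qed

lemma Ck_on_vec_nth: "open S \<Longrightarrow> Ck_on k f S \<Longrightarrow> Ck_on k (\<lambda>x. f x $ i) S"
  by (rule Ck_on_linear_comp[OF bounded_linear_vec_nth])

lemma Ck_on_vec_lambda:
  fixes f :: "'n::finite \<Rightarrow> 'a::real_normed_vector \<Rightarrow> 'b::real_normed_vector"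
  assumes "open S" "\<And>i. Ck_on k (f i) S"
  shows "Ck_on k (\<lambda>x. \<chi> i. f i x) S"
proof -
  have "norm (axis i y :: 'b^'n) \<le> norm y" for i y
  proof -
    have "norm (axis i y :: 'b^'n) \<le> (\<Sum>j\<in>UNIV. norm ((axis i y :: 'b^'n) $ j))"
      unfolding norm_vec_def by (rule L2_set_le_sum) auto
    also have "\<dots> = norm y" by (simp add: axis_def if_distrib[of norm] cong: if_cong)
    finally show ?thesis .
  qed
  then have "bounded_linear (axis i :: 'b \<Rightarrow> 'b^'n)" for i
    by (intro bounded_linear_intro[where K=1]) (simp_all add: axis_def vec_eq_iff)
  then have "Ck_on k (\<lambda>x. \<Sum>i\<in>UNIV. axis i (f i x)) S"
    by (intro Ck_on_sum assms(1) Ck_on_linear_comp[OF _ assms]) blast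
  moreover have "(\<Sum>i\<in>UNIV. axis i (f i x)) = (\<chi> i. f i x)" for x
    by (simp add: vec_eq_iff axis_def)
  ultimately show ?thesis by simp
qed

lemma Ck_on_fst: "Ck_on k fst S" and Ck_on_snd: "Ck_on k snd S"
  by (auto intro!: Ck_on_linear bounded_linear_fst bounded_linear_snd)

lemma Ck_on_ident: "Ck_on k (\<lambda>x. x) S"
  by (rule Ck_on_linear[OF bounded_linear_ident])

text \<open>Integrate \<open>D\<^sub>k f\<close> along a segment in direction \<open>k\<close>, differentiate under the integral in direction
  \<open>h\<close>, and then differentiate in the length of the segment: this gives \<open>D\<^sub>k D\<^sub>h f = D\<^sub>h D\<^sub>k f\<close> for
  values in a Banach space, without going through components.\<close>

lemma second_derivative_symmetric:
  fixes f :: "'a::real_normed_vector \<Rightarrow> 'b::banach"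
  assumes S: "open S" "x \<in> S" and f: "Ck_on 2 f S"
  shows "frechet_derivative (\<lambda>y. frechet_derivative f (at y) h) (at x) k =
         frechet_derivative (\<lambda>y. frechet_derivative f (at y) k) (at x) h"
proof -
  define D where "D h = (\<lambda>y. frechet_derivative f (at y) h)" for h
  define p where "p t s = x + t *\<^sub>R h + s *\<^sub>R k" for t s :: real
  have f': "Ck_on (Suc 1) f S" using f by (simp only: numeral_2_eq_2 One_nat_def)
  have f1: "(f has_derivative (\<lambda>h. D h y)) (at y)" if "y \<in> S" for y
    using Ck_on_has_derivative[OF f' that] by (simp add: D_def)
  have D1: "Ck_on (Suc 0) (D h) S" for h
    using Ck_on_frechet_derivative[OF f'] unfolding D_def One_nat_def .
  define E where "E h k = (\<lambda>y. frechet_derivative (D h) (at y) k)" for h k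
  have D2: "(D h has_derivative (\<lambda>k. E h k y)) (at y)" if "y \<in> S" for y h
    using Ck_on_has_derivative[OF D1 that] by (simp add: E_def)
  have Dc: "continuous_on S (D h)" for h using D1 Ck_on_continuous by blast
  have Ec: "continuous_on S (E h k)" for h k
    using Ck_on_continuous[OF Ck_on_frechet_derivative[OF D1]] unfolding E_def .
  have "open ((\<lambda>(t,s). p t s) -` S)"
    unfolding p_def case_prod_unfold by (intro continuous_open_vimage S continuous_intros)
  moreover have "(0,0) \<in> (\<lambda>(t,s). p t s) -` S" using S by (simp add: p_def)
  ultimately obtain A B where AB: "open A" "open B" "(0,0) \<in> A \<times> B" "A \<times> B \<subseteq> (\<lambda>(t,s). p t s) -` S"
    by (rule open_prod_elim)
  have "open (A \<inter> B)" "0 \<in> A \<inter> B" using AB by auto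
  then obtain r where r: "r > 0" "cball 0 r \<subseteq> A \<inter> B" using open_contains_cball by blast
  have pS: "p t s \<in> S" if "t \<in> {-r..r}" "s \<in> {-r..r}" for t s
    using AB(4) r(2) that by (auto simp: subset_iff abs_le_iff)
  have ft: "((\<lambda>t. f (p t s)) has_vector_derivative D h (p t s)) (at t within T)" if "p t s \<in> S" for t s T
  proof -
    have "((\<lambda>t. p t s) has_derivative (\<lambda>a. a *\<^sub>R h)) (at t within T)"
      unfolding p_def by (auto intro!: derivative_eq_intros)
    from has_derivative_compose[OF this f1[OF that]] show ?thesis
      unfolding has_vector_derivative_def
      using linear_cmul[OF has_derivative_linear[OF f1[OF that]]] by simp
  qed
  have fs: "((\<lambda>s. f (p t s)) has_vector_derivative D k (p t s)) (at s within T)" if "p t s \<in> S" for t s T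
  proof -
    have "((\<lambda>s. p t s) has_derivative (\<lambda>a. a *\<^sub>R k)) (at s within T)"
      unfolding p_def by (auto intro!: derivative_eq_intros)
    from has_derivative_compose[OF this f1[OF that]] show ?thesis
      unfolding has_vector_derivative_def
      using linear_cmul[OF has_derivative_linear[OF f1[OF that]]] by simp
  qed
  have Dt: "((\<lambda>t. D k (p t s)) has_vector_derivative E k h (p t s)) (at t within T)" if "p t s \<in> S" for t s T
  proof -
    have "((\<lambda>t. p t s) has_derivative (\<lambda>a. a *\<^sub>R h)) (at t within T)"
      unfolding p_def by (auto intro!: derivative_eq_intros)
    from has_derivative_compose[OF this D2[OF that]] show ?thesis
      unfolding has_vector_derivative_def
      using linear_cmul[OF has_derivative_linear[OF D2[OF that]]] by simp
  qed
  have Ds: "((\<lambda>s. D h (p t s)) has_vector_derivative E h k (p t s)) (at s within T)" if "p t s \<in> S" for t s T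
  proof -
    have "((\<lambda>s. p t s) has_derivative (\<lambda>a. a *\<^sub>R k)) (at s within T)"
      unfolding p_def by (auto intro!: derivative_eq_intros)
    from has_derivative_compose[OF this D2[OF that]] show ?thesis
      unfolding has_vector_derivative_def
      using linear_cmul[OF has_derivative_linear[OF D2[OF that]]] by simp
  qed
  have pc: "continuous_on T (\<lambda>z. p (fst z) (snd z))" for T
    unfolding p_def by (intro continuous_intros)
  have pc1: "continuous_on T (p t)" for T t
    unfolding p_def by (intro continuous_intros)
  have lim: "at (0::real) within {0..r} \<noteq> bot" "at (0::real) within {-r..r} \<noteq> bot"
    using r by (simp_all add: trivial_limit_within islimpt_Icc)
  \<comment> \<open>the increment of \<open>f\<close> along the segment, differentiated in \<open>t\<close> at \<open>0\<close>, once directly and once under the integral\<close>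
  have int: "D h (p 0 s) - D h (p 0 0) = integral {0..s} (\<lambda>\<sigma>. E k h (p 0 \<sigma>))" if s: "s \<in> {0..r}" for s
  proof -
    have *: "((\<lambda>t. integral (cbox 0 s) (\<lambda>\<sigma>. D k (p t \<sigma>))) has_vector_derivative
        integral (cbox 0 s) (\<lambda>\<sigma>. E k h (p 0 \<sigma>))) (at 0 within {-r..r})"
    proof (rule leibniz_rule_vector_derivative)
      show "((\<lambda>t. D k (p t \<sigma>)) has_vector_derivative E k h (p t \<sigma>)) (at t within {-r..r})"
        if "t \<in> {-r..r}" "\<sigma> \<in> cbox 0 s" for t \<sigma>
        by (rule Dt) (use that s in \<open>auto intro!: pS\<close>)
      show "(\<lambda>\<sigma>. D k (p t \<sigma>)) integrable_on cbox 0 s" if "t \<in> {-r..r}" for t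
        by (intro integrable_continuous continuous_on_compose2[OF Dc]) (use that s in \<open>auto intro!: pS pc1\<close>)
      show "continuous_on ({-r..r} \<times> cbox 0 s) (\<lambda>(t, \<sigma>). E k h (p t \<sigma>))"
        unfolding case_prod_unfold
        by (intro continuous_on_compose2[OF Ec] pc) (use s in \<open>auto intro!: pS\<close>)
    qed (use r in auto)
    have "((\<lambda>t. f (p t s) - f (p t 0)) has_vector_derivative
        integral (cbox 0 s) (\<lambda>\<sigma>. E k h (p 0 \<sigma>))) (at 0 within {-r..r})"
    proof (rule has_vector_derivative_transform[OF _ _ *])
      fix t assume t: "t \<in> {-r..r}"
      have "((\<lambda>\<sigma>. D k (p t \<sigma>)) has_integral f (p t s) - f (p t 0)) {0..s}"
        by (rule fundamental_theorem_of_calculus) (use s t in \<open>auto intro!: fs pS\<close>)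
      then show "f (p t s) - f (p t 0) = integral (cbox 0 s) (\<lambda>\<sigma>. D k (p t \<sigma>))"
        by (simp add: integral_unique)
    qed (use r in auto)
    moreover have "((\<lambda>t. f (p t s) - f (p t 0)) has_vector_derivative D h (p 0 s) - D h (p 0 0)) (at 0 within {-r..r})"
      by (intro has_vector_derivative_diff ft pS) (use s r in auto)
    ultimately show ?thesis
      using vector_derivative_unique_within[OF lim(2)] by (simp add: cbox_interval)
  qed
  have "((\<lambda>s. integral {0..s} (\<lambda>\<sigma>. E k h (p 0 \<sigma>))) has_vector_derivative E k h (p 0 0)) (at 0 within {0..r})"
    by (intro integral_has_vector_derivative continuous_on_compose2[OF Ec pc1])
      (use r in \<open>auto intro!: pS\<close>)
  then have "((\<lambda>s. D h (p 0 s) - D h (p 0 0)) has_vector_derivative E k h (p 0 0)) (at 0 within {0..r})"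
    by (rule has_vector_derivative_transform[rotated 2]) (use r(1) int in simp_all)
  moreover have "((\<lambda>s. D h (p 0 s) - D h (p 0 0)) has_vector_derivative E h k (p 0 0) - 0) (at 0 within {0..r})"
    by (intro has_vector_derivative_diff Ds pS has_vector_derivative_const) (use r in auto)
  ultimately have "E h k (p 0 0) = E k h (p 0 0)"
    using vector_derivative_unique_within[OF lim(1)] by simp
  then show ?thesis by (simp add: E_def D_def p_def)
qed

section \<open>Boundary curves and outer normals\<close>

lemma linear_cart2_expansion:
  fixes A :: "real^2 \<Rightarrow> 'b::real_vector"
  assumes "linear A"
  shows "A h = (h $ 1) *\<^sub>R A (axis 1 1) + (h $ 2) *\<^sub>R A (axis 2 1)"
proof -
  have h: "h = (h $ 1) *\<^sub>R axis 1 1 + (h $ 2) *\<^sub>R axis 2 1"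
    by (simp add: vec_eq_iff forall_2 axis_def)
  show ?thesis by (subst h) (simp only: linear_add[OF assms] linear_cmul[OF assms])
qed

lemma inner2: "x \<bullet> y = x $ 1 * y $ 1 + x $ 2 * y $ 2" for x y :: "real^2"
  by (simp add: inner_vec_def UNIV_2)

text \<open>The clockwise quarter turn. It makes normals out of tangents without division by the length, and
  \<open>perp a \<bullet> b\<close> is minus the determinant with columns \<open>a\<close> and \<open>b\<close>, so it also carries Jacobians.\<close>

definition perp :: "real^2 \<Rightarrow> real^2" where
  "perp w = vector [w $ 2, - w $ 1]"

lemma perp_nth [simp]: "perp w $ 1 = w $ 2" "perp w $ 2 = - w $ 1"
  by (simp_all add: perp_def)

lemma perp_inner: "perp a \<bullet> b = a $ 2 * b $ 1 - a $ 1 * b $ 2"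
  by (simp add: inner2)

lemma perp_inner_self [simp]: "perp a \<bullet> a = 0"
  by (simp add: perp_inner)

lemma norm_perp [simp]: "norm (perp a) = norm a"
  by (simp add: norm_eq_sqrt_inner inner2 power2_eq_square)

lemma linear_perp: "linear perp"
  by (rule linearI) (simp_all add: vec_eq_iff forall_2)

lemma bounded_linear_perp: "bounded_linear perp"
  using linear_perp by (simp add: linear_conv_bounded_linear)

lemma perp_expansion:
  assumes "w \<noteq> 0"
  shows "x = ((x \<bullet> w) / (norm w)\<^sup>2) *\<^sub>R w + ((x \<bullet> perp w) / (norm w)\<^sup>2) *\<^sub>R perp w"
proof -
  have n: "(norm w)\<^sup>2 = w$1 * w$1 + w$2 * w$2"
    by (simp add: power2_norm_eq_inner inner2)
  have "(norm w)\<^sup>2 \<noteq> 0" using assms by simp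
  then have "(norm w)\<^sup>2 *\<^sub>R x = (norm w)\<^sup>2 *\<^sub>R (((x \<bullet> w) / (norm w)\<^sup>2) *\<^sub>R w + ((x \<bullet> perp w) / (norm w)\<^sup>2) *\<^sub>R perp w)"
    by (simp add: scaleR_add_right) (simp add: n vec_eq_iff forall_2 inner2 algebra_simps)
  with \<open>(norm w)\<^sup>2 \<noteq> 0\<close> show ?thesis by (metis scaleR_cancel_left)
qed

lemma unit_orthogonal:
  assumes "\<nu> \<bullet> w = 0" "norm \<nu> = 1" "w \<noteq> 0"
  shows "\<nu> = sgn (\<nu> \<bullet> perp w) *\<^sub>R perp (w /\<^sub>R norm w)" "\<nu> \<bullet> perp w \<noteq> 0"
proof -
  define a where "a = \<nu> \<bullet> perp w"
  have *: "\<nu> = (a / (norm w)\<^sup>2) *\<^sub>R perp w"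
    using perp_expansion[OF assms(3), of \<nu>] assms(1) by (simp add: a_def)
  have "1 = \<bar>a\<bar> / norm w"
    using arg_cong[OF *, of norm] assms by (auto simp add: power2_eq_square divide_simps split: if_splits)
  then have a: "\<bar>a\<bar> = norm w" using assms(3) by simp
  then show "\<nu> \<bullet> perp w \<noteq> 0" using assms(3) by (metis a_def abs_zero norm_eq_zero)
  have "a = sgn a * norm w" using a by (metis abs_sgn mult.commute sgn_mult_abs)
  then have "a / (norm w)\<^sup>2 = sgn a / norm w" using assms(3)
    by (metis (no_types, lifting) divide_divide_eq_left nonzero_mult_div_cancel_right norm_eq_zero power2_eq_square)
  then show "\<nu> = sgn (\<nu> \<bullet> perp w) *\<^sub>R perp (w /\<^sub>R norm w)"
    unfolding a_def[symmetric] linear_cmul[OF linear_perp] using * by (simp add: divide_inverse)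
qed

lemma unit_orthogonal_multiple:
  assumes "\<nu> \<bullet> w = 0" "norm \<nu> = 1" "w \<noteq> 0"
  obtains a where "a \<noteq> 0" "\<nu> = a *\<^sub>R perp w"
proof (rule that)
  show "\<nu> = (sgn (\<nu> \<bullet> perp w) * inverse (norm w)) *\<^sub>R perp w"
    using unit_orthogonal(1)[OF assms] unfolding linear_cmul[OF linear_perp] by simp
  show "sgn (\<nu> \<bullet> perp w) * inverse (norm w) \<noteq> 0"
    using unit_orthogonal(2)[OF assms] assms(3) by (simp add: sgn_zero_iff)
qed

lemma closed_C1_curve_derivative:
  assumes "closed_C1_curve \<gamma>"
  shows "(\<gamma> has_vector_derivative vector_derivative \<gamma> (at s)) (at s within T)"
    "continuous_on S (\<lambda>s. vector_derivative \<gamma> (at s))"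
    "vector_derivative \<gamma> (at s) \<noteq> 0" "continuous_on S \<gamma>"
proof -
  have C: "Ck_on (Suc 0) \<gamma> UNIV" using assms by (simp add: closed_C1_curve_def)
  then have d: "\<gamma> differentiable at s" for s by simp
  then show "(\<gamma> has_vector_derivative vector_derivative \<gamma> (at s)) (at s within T)"
    by (simp add: vector_derivative_works[symmetric] has_vector_derivative_at_within)
  have "vector_derivative \<gamma> (at s) = frechet_derivative \<gamma> (at s) 1" for s
    using d[of s] by (metis frechet_derivative_eqI has_vector_derivative_def scaleR_one vector_derivative_works)
  then show "continuous_on S (\<lambda>s. vector_derivative \<gamma> (at s))"
    using Ck_on_frechet_derivative[OF C] by (auto intro: continuous_on_subset)
  show "vector_derivative \<gamma> (at s) \<noteq> 0" using assms by (simp add: closed_C1_curve_def)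
  show "continuous_on S \<gamma>" using Ck_on_continuous[OF C] by (auto intro: continuous_on_subset)
qed

lemma closed_C1_curve_periodic:
  assumes "closed_C1_curve \<gamma>"
  shows "\<gamma> (s + of_int n) = \<gamma> s"
proof -
  have 1: "\<gamma> (s + 1) = \<gamma> s" for s using assms by (simp add: closed_C1_curve_def)
  have 2: "\<gamma> (s + of_nat k) = \<gamma> s" for s k
    by (induction k) (use 1 in \<open>simp_all add: add.assoc[symmetric] add.commute[of 1]\<close>)
  show ?thesis
  proof (cases "n \<ge> 0")
    case True
    then show ?thesis using 2[of s "nat n"] by simp
  next
    case False
    then show ?thesis using 2[of "s + of_int n" "nat (-n)"] by simp
  qed
qed

lemma closed_C1_curve_eq:
  assumes "closed_C1_curve \<gamma>" "\<gamma> s = \<gamma> s'"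
  obtains n :: int where "s' = s + of_int n"
proof -
  have "\<gamma> (frac s) = \<gamma> (frac s')"
    using closed_C1_curve_periodic[OF assms(1), of s "- \<lfloor>s\<rfloor>"] closed_C1_curve_periodic[OF assms(1), of s' "- \<lfloor>s'\<rfloor>"] assms(2)
    by (simp add: frac_def)
  then have "frac s = frac s'"
    using assms(1) by (auto simp: closed_C1_curve_def frac_lt_1 dest: inj_onD)
  then have "s' = s + of_int (\<lfloor>s'\<rfloor> - \<lfloor>s\<rfloor>)" by (simp add: frac_def)
  then show ?thesis by (rule that)
qed

lemma closed_C1_curve_range:
  assumes "closed_C1_curve \<gamma>"
  shows "range \<gamma> = \<gamma> ` {a..a+1}"
proof
  show "range \<gamma> \<subseteq> \<gamma> ` {a..a+1}"
  proof safe
    fix s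
    have "\<gamma> s = \<gamma> (a + frac (s - a))"
      using closed_C1_curve_periodic[OF assms, of s "- \<lfloor>s - a\<rfloor>"] by (simp add: frac_def)
    then show "\<gamma> s \<in> \<gamma> ` {a..a+1}" by (auto intro!: image_eqI simp: less_imp_le[OF frac_lt_1])
  qed
qed auto

lemma closed_C1_curve_compact_range:
  "closed_C1_curve \<gamma> \<Longrightarrow> compact (range \<gamma>)"
  using closed_C1_curve_range[of \<gamma> 0] closed_C1_curve_derivative(4) by (simp add: compact_continuous_image)

lemma has_vector_derivative_affine_reparam:
  assumes "(c has_vector_derivative w) (at (a + b * s))"
  shows "((\<lambda>h. c (a + b * h)) has_vector_derivative b *\<^sub>R w) (at s)"
proof -
  have "((\<lambda>h. a + b * h) has_vector_derivative b) (at s)"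
    unfolding has_real_derivative_iff_has_vector_derivative[symmetric] by (auto intro!: derivative_eq_intros)
  from vector_diff_chain_at[OF this assms] show ?thesis by (simp add: o_def)
qed

lemma closed_C1_curve_derivative_periodic:
  assumes "closed_C1_curve \<gamma>"
  shows "vector_derivative \<gamma> (at (s + of_int n)) = vector_derivative \<gamma> (at s)"
proof -
  have "((\<lambda>h. \<gamma> (h + of_int n)) has_vector_derivative vector_derivative \<gamma> (at (s + of_int n))) (at s)"
    using has_vector_derivative_affine_reparam[where a = "of_int n" and b = 1 and c = \<gamma> and s = s and w = "vector_derivative \<gamma> (at (s + of_int n))"]
      closed_C1_curve_derivative(1)[OF assms, of "s + of_int n" UNIV] by (simp add: add.commute)
  then show ?thesis
    by (simp add: closed_C1_curve_periodic[OF assms] vector_derivative_at)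
qed

text \<open>A ray in direction \<open>e\<close> lies in the outer cone of opening \<open>\<epsilon>\<close> as soon as \<open>\<epsilon> |e| < \<nu> \<bullet> e\<close>, and its
  reflection then lies in the inner cone.\<close>

lemma outer_normal_ray:
  assumes "outer_normal_at \<Omega> x \<nu>" "\<nu> \<bullet> e > 0"
  shows "\<forall>\<^sub>F r in at_right 0. x - r *\<^sub>R e \<in> \<Omega> \<and> x + r *\<^sub>R e \<notin> \<Omega>"
proof -
  have e: "e \<noteq> 0" using assms(2) by auto
  define \<epsilon> where "\<epsilon> = \<nu> \<bullet> e / (2 * norm e)"
  have \<epsilon>: "\<epsilon> > 0" "\<epsilon> * norm e < \<nu> \<bullet> e" using assms(2) e by (auto simp: \<epsilon>_def)
  have ev: "\<forall>\<^sub>F y in at x. (\<nu> \<bullet> (y - x) < - \<epsilon> * norm (y - x) \<longrightarrow> y \<in> \<Omega>) \<and>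
        (\<nu> \<bullet> (y - x) > \<epsilon> * norm (y - x) \<longrightarrow> y \<notin> \<Omega>)"
    using assms(1) \<epsilon>(1) by (simp add: outer_normal_at_def)
  have lim: "filterlim (\<lambda>r. x + (c * r) *\<^sub>R e) (at x) (at_right 0)" if "c \<noteq> 0" for c :: real
  proof -
    have "((\<lambda>r. x + (c * r) *\<^sub>R e) \<longlongrightarrow> x + (c * 0) *\<^sub>R e) (at_right 0)"
      by (intro tendsto_intros)
    then show ?thesis
      using that e by (auto simp: filterlim_at eventually_at_right_less eventually_at_filter)
  qed
  have "\<forall>\<^sub>F r in at_right 0. (r::real) > 0" by (simp add: eventually_at_right_less)
  moreover have "\<forall>\<^sub>F r in at_right 0. \<nu> \<bullet> (r *\<^sub>R e) > \<epsilon> * norm (r *\<^sub>R e) \<longrightarrow> x + r *\<^sub>R e \<notin> \<Omega>"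
    using eventually_compose_filterlim[OF ev lim[of 1]] by (simp add: eventually_mono)
  moreover have "\<forall>\<^sub>F r in at_right 0. \<nu> \<bullet> - (r *\<^sub>R e) < - (\<epsilon> * norm (r *\<^sub>R e)) \<longrightarrow> x - r *\<^sub>R e \<in> \<Omega>"
    using eventually_compose_filterlim[OF ev lim[of "-1"]] by (simp add: eventually_mono)
  ultimately show ?thesis
  proof eventually_elim
    case (elim r)
    have "r * (\<epsilon> * norm e) < r * (\<nu> \<bullet> e)" using \<epsilon> elim(1) by simp
    then show ?case using elim by (simp add: ac_simps)
  qed
qed

text \<open>Otherwise the ray in direction \<open>\<nu> - \<mu>\<close> would leave the domain for one normal and enter it for
  the other.\<close>

lemma outer_normal_unique:
  assumes "outer_normal_at \<Omega> x \<nu>" "outer_normal_at \<Omega> x \<mu>"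
  shows "\<nu> = \<mu>"
proof (rule ccontr)
  assume "\<nu> \<noteq> \<mu>"
  have n: "\<nu> \<bullet> \<nu> = 1" "\<mu> \<bullet> \<mu> = 1"
    using assms by (auto simp: outer_normal_at_def norm_eq_1)
  have "(\<nu> - \<mu>) \<bullet> (\<nu> - \<mu>) > 0" using \<open>\<nu> \<noteq> \<mu>\<close> by simp
  then have lt: "\<nu> \<bullet> \<mu> < 1"
    using n by (simp add: inner_diff_left inner_diff_right inner_commute)
  have "\<nu> \<bullet> (\<nu> - \<mu>) > 0" "\<mu> \<bullet> (\<mu> - \<nu>) > 0"
    using n lt by (simp_all add: inner_diff_right inner_commute)
  from outer_normal_ray[OF assms(1) this(1)] outer_normal_ray[OF assms(2) this(2)]
  have "\<forall>\<^sub>F r in at_right (0::real). False"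
    by eventually_elim (simp add: algebra_simps)
  then show False by simp
qed

lemma outer_normal_eq: "outer_normal_at \<Omega> x \<nu> \<Longrightarrow> outer_normal \<Omega> x = \<nu>"
  unfolding outer_normal_def using outer_normal_unique by (metis the_equality)

lemma C1_domainD:
  assumes "C1_domain \<Omega> \<C>"
  shows "open \<Omega>" "bounded \<Omega>" "finite \<C>" "frontier \<Omega> = (\<Union>\<gamma>\<in>\<C>. range \<gamma>)"
    "compact (closure \<Omega>)" "x \<in> frontier \<Omega> \<Longrightarrow> outer_normal_at \<Omega> x (outer_normal \<Omega> x)"
    "x \<in> frontier \<Omega> \<Longrightarrow> x \<notin> \<Omega>" "x \<in> frontier \<Omega> \<Longrightarrow> x \<in> closure \<Omega>"
proof -
  show o: "open \<Omega>" and b: "bounded \<Omega>" and "finite \<C>" "frontier \<Omega> = (\<Union>\<gamma>\<in>\<C>. range \<gamma>)"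
    using assms unfolding C1_domain_def by blast+
  show "compact (closure \<Omega>)" using b by (simp add: bounded_closure compact_eq_bounded_closed)
  show "x \<in> frontier \<Omega> \<Longrightarrow> outer_normal_at \<Omega> x (outer_normal \<Omega> x)"
    using assms outer_normal_eq unfolding C1_domain_def by metis
  show "x \<in> frontier \<Omega> \<Longrightarrow> x \<notin> \<Omega>" using o by (simp add: frontier_def interior_open)
  show "x \<in> frontier \<Omega> \<Longrightarrow> x \<in> closure \<Omega>" by (simp add: frontier_def)
qed

lemma C1_domain_curveD:
  assumes "C1_domain \<Omega> \<C>" "\<gamma> \<in> \<C>"
  shows "closed_C1_curve \<gamma>" "\<gamma> s \<in> frontier \<Omega>" "\<gamma> s \<notin> \<Omega>" "\<gamma> s \<in> closure \<Omega>"
    "outer_normal_at \<Omega> (\<gamma> s) (outer_normal \<Omega> (\<gamma> s))"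
    "\<delta> \<in> \<C> \<Longrightarrow> \<gamma> s = \<delta> s' \<Longrightarrow> \<gamma> = \<delta>"
proof -
  show "closed_C1_curve \<gamma>" using assms unfolding C1_domain_def by blast
  show f: "\<gamma> s \<in> frontier \<Omega>" using assms unfolding C1_domain_def by auto
  show "\<gamma> s \<notin> \<Omega>" "\<gamma> s \<in> closure \<Omega>" "outer_normal_at \<Omega> (\<gamma> s) (outer_normal \<Omega> (\<gamma> s))"
    using C1_domainD[OF assms(1)] f by auto
  show "\<gamma> = \<delta>" if "\<delta> \<in> \<C>" "\<gamma> s = \<delta> s'"
  proof (rule ccontr)
    assume "\<gamma> \<noteq> \<delta>"
    then have "range \<gamma> \<inter> range \<delta> = {}" using assms that(1) unfolding C1_domain_def pairwise_def by blast
    then show False using that(2) by auto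
  qed
qed

text \<open>If \<open>\<nu> \<bullet> w\<close> were positive, the curve run backwards from \<open>x\<close> would enter the inner cone, hence
  \<open>\<Omega>\<close>.\<close>

lemma outer_normal_not_obtuse:
  assumes \<nu>: "outer_normal_at \<Omega> x \<nu>"
    and c: "(c has_vector_derivative w) (at 0)" "c 0 = x" "\<And>h. c h \<notin> \<Omega>"
  shows "\<nu> \<bullet> w \<le> 0"
proof (rule ccontr)
  assume "\<not> \<nu> \<bullet> w \<le> 0"
  then have pos: "\<nu> \<bullet> w > 0" by simp
  then have w: "w \<noteq> 0" by auto
  define \<epsilon> where "\<epsilon> = \<nu> \<bullet> w / (2 * norm w)"
  have \<epsilon>: "\<epsilon> > 0" "\<epsilon> * norm w < \<nu> \<bullet> w" using pos w by (auto simp: \<epsilon>_def)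
  have ev: "\<forall>\<^sub>F y in at x. (\<nu> \<bullet> (y - x) < - \<epsilon> * norm (y - x) \<longrightarrow> y \<in> \<Omega>) \<and>
        (\<nu> \<bullet> (y - x) > \<epsilon> * norm (y - x) \<longrightarrow> y \<notin> \<Omega>)"
    using \<nu> \<epsilon>(1) by (simp add: outer_normal_at_def)
  define q where "q h = (c h - x) /\<^sub>R h" for h
  have q: "(q \<longlongrightarrow> w) (at_left 0)"
  proof -
    have "((\<lambda>h. (1 / norm (h - 0)) *\<^sub>R (c h - (c 0 + (h - 0) *\<^sub>R w))) \<longlongrightarrow> 0) (at_left 0)"
      using has_vector_derivative_at_within[OF c(1), of "{..<0}"]
      unfolding has_vector_derivative_def has_derivative_within by blast
    then have "((\<lambda>h. w - (1 / norm (h - 0)) *\<^sub>R (c h - (c 0 + (h - 0) *\<^sub>R w))) \<longlongrightarrow> w - 0) (at_left 0)"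
      by (intro tendsto_intros)
    moreover have "\<forall>\<^sub>F h in at_left (0::real). h < 0" by (auto simp: eventually_at_filter)
    then have "\<forall>\<^sub>F h in at_left 0. w - (1 / norm (h - 0)) *\<^sub>R (c h - (c 0 + (h - 0) *\<^sub>R w)) = q h"
    proof eventually_elim
      case (elim h)
      then have "(1 / norm (h - 0)) = - inverse h" by (simp add: divide_inverse)
      then show ?case using elim by (simp add: q_def c(2) algebra_simps)
    qed
    ultimately show ?thesis by (simp add: tendsto_cong)
  qed
  have "((\<lambda>h. \<nu> \<bullet> q h - \<epsilon> * norm (q h)) \<longlongrightarrow> \<nu> \<bullet> w - \<epsilon> * norm w) (at_left 0)"
    by (intro tendsto_intros q)
  then have "\<forall>\<^sub>F h in at_left 0. \<nu> \<bullet> q h - \<epsilon> * norm (q h) > 0"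
    using \<epsilon>(2) by (intro order_tendstoD(1)) auto
  moreover have "\<forall>\<^sub>F h in at_left 0. q h \<noteq> 0"
    using q w tendsto_imp_eventually_ne by blast
  moreover have "\<forall>\<^sub>F h in at_left 0. h < (0::real)" by (auto simp: eventually_at_filter)
  moreover have "\<forall>\<^sub>F h in at_left 0. c h \<noteq> x \<longrightarrow> (\<nu> \<bullet> (c h - x) < - \<epsilon> * norm (c h - x) \<longrightarrow> c h \<in> \<Omega>)"
  proof -
    have "(c \<longlongrightarrow> x) (at_left 0)"
      using has_vector_derivative_continuous[OF has_vector_derivative_at_within[OF c(1)], of "{..<0}"] c(2)
      by (simp add: continuous_within)
    moreover have "\<forall>\<^sub>F y in nhds x. y \<noteq> x \<longrightarrow> (\<nu> \<bullet> (y - x) < - \<epsilon> * norm (y - x) \<longrightarrow> y \<in> \<Omega>)"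
      using ev unfolding eventually_at_filter by eventually_elim blast
    ultimately show ?thesis by (rule eventually_compose_filterlim[rotated])
  qed
  ultimately have "\<forall>\<^sub>F h in at_left (0::real). False"
  proof eventually_elim
    case (elim h)
    have eq: "c h - x = h *\<^sub>R q h" using elim(3) by (simp add: q_def)
    have "h * (\<nu> \<bullet> q h) < h * (\<epsilon> * norm (q h))"
      using elim(1,3) by (intro mult_strict_left_mono_neg) auto
    then have "\<nu> \<bullet> (c h - x) < - \<epsilon> * norm (c h - x)"
      using elim(3) by (simp add: eq ac_simps)
    moreover have "c h \<noteq> x" using eq elim(2,3) by auto
    ultimately show ?case using elim(4) c(3) by blast
  qed
  then show False by simp
qed

text \<open>The boundary curve never meets the open set \<open>\<Omega>\<close>, and can be run in both directions.\<close>

lemma outer_normal_orthogonal_curve: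
  assumes "C1_domain \<Omega> \<C>" "\<gamma> \<in> \<C>"
  shows "outer_normal \<Omega> (\<gamma> s) \<bullet> vector_derivative \<gamma> (at s) = 0"
proof (rule antisym)
  note \<gamma> = C1_domain_curveD(1)[OF assms] and out = C1_domain_curveD(3)[OF assms]
    and \<nu> = C1_domain_curveD(5)[OF assms, of s]
  have d: "((\<lambda>h. \<gamma> (s + c * h)) has_vector_derivative c *\<^sub>R vector_derivative \<gamma> (at s)) (at 0)" for c
    by (rule has_vector_derivative_affine_reparam) (simp add: closed_C1_curve_derivative(1)[OF \<gamma>])
  show "outer_normal \<Omega> (\<gamma> s) \<bullet> vector_derivative \<gamma> (at s) \<le> 0"
    using outer_normal_not_obtuse[OF \<nu> d[of 1]] out by simp
  show "0 \<le> outer_normal \<Omega> (\<gamma> s) \<bullet> vector_derivative \<gamma> (at s)"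
    using outer_normal_not_obtuse[OF \<nu> d[of "-1"]] out by simp
qed

lemma boundary_curve_normal:
  assumes "C1_domain \<Omega> \<C>" "\<gamma> \<in> \<C>"
  shows "outer_normal \<Omega> (\<gamma> s) \<bullet> vector_derivative \<gamma> (at s) = 0" "norm (outer_normal \<Omega> (\<gamma> s)) = 1"
    "vector_derivative \<gamma> (at s) \<noteq> 0"
  using outer_normal_orthogonal_curve[OF assms] C1_domain_curveD(5)[OF assms, of s]
    closed_C1_curve_derivative(3)[OF C1_domain_curveD(1)[OF assms]]
  by (auto simp: outer_normal_at_def)

text \<open>Coordinates near a point of a curve, given by the parameter of the curve and the displacement in a
  fixed direction \<open>e\<close>. As the second coordinate lines are parallel to \<open>e\<close>, a derivative in
  direction \<open>e\<close> becomes a partial derivative.\<close>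

definition chart :: "(real \<Rightarrow> real^2) \<Rightarrow> real^2 \<Rightarrow> real^2 \<Rightarrow> real^2" where
  "chart \<gamma> e p = \<gamma> (p $ 1) + (p $ 2) *\<^sub>R e"

definition square :: "real \<Rightarrow> real \<Rightarrow> (real^2) set" where
  "square s0 \<delta> = box (vector [s0 - \<delta>, - \<delta>]) (vector [s0 + \<delta>, \<delta>])"

lemma mem_square: "p \<in> square s0 \<delta> \<longleftrightarrow> \<bar>p $ 1 - s0\<bar> < \<delta> \<and> \<bar>p $ 2\<bar> < \<delta>"
  by (auto simp: square_def mem_box_cart forall_2 abs_less_iff)

lemma chart_has_derivative:
  assumes "(\<gamma> has_vector_derivative w) (at (p $ 1))"
  shows "(chart \<gamma> e has_derivative (\<lambda>h. (h $ 1) *\<^sub>R w + (h $ 2) *\<^sub>R e)) (at p within T)"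
proof -
  have "((\<lambda>p. \<gamma> (p $ 1)) has_derivative (\<lambda>h. (h $ 1) *\<^sub>R w)) (at p)"
    using has_derivative_compose[OF bounded_linear_imp_has_derivative[OF bounded_linear_vec_nth] assms[unfolded has_vector_derivative_def]] .
  then have "((\<lambda>p. \<gamma> (p $ 1) + (p $ 2) *\<^sub>R e) has_derivative (\<lambda>h. (h $ 1) *\<^sub>R w + (h $ 2) *\<^sub>R e)) (at p)"
    by (intro has_derivative_add has_derivative_scaleR_left bounded_linear_imp_has_derivative bounded_linear_vec_nth)
  then show ?thesis unfolding chart_def[abs_def] by (rule has_derivative_at_withinI)
qed

lemma chart_continuous:
  assumes "closed_C1_curve \<gamma>"
  shows "continuous_on T (chart \<gamma> e)"
  by (rule has_derivative_continuous_on[OF chart_has_derivative[OF closed_C1_curve_derivative(1)[OF assms]]])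

text \<open>The derivative at \<open>(s0, 0)\<close> has the independent columns \<open>\<gamma>'(s0)\<close> and \<open>e\<close>, and it is continuous
  in the point.\<close>

lemma chart_locally_injective:
  assumes \<gamma>: "closed_C1_curve \<gamma>" and e: "perp (vector_derivative \<gamma> (at s0)) \<bullet> e \<noteq> 0"
  obtains \<rho> where "\<rho> > 0" "inj_on (chart \<gamma> e) (square s0 \<rho>)"
proof -
  define w where "w s = vector_derivative \<gamma> (at s)" for s
  define p0 :: "real^2" where "p0 = vector [s0, 0]"
  have p0: "p0 $ 1 = s0" "p0 $ 2 = 0" by (simp_all add: p0_def)
  define f' where "f' p h = (h $ 1) *\<^sub>R w (p $ 1) + (h $ 2) *\<^sub>R e" for p h :: "real^2"
  have der: "(chart \<gamma> e has_derivative f' p) (at p)" for p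
    unfolding f'_def w_def by (intro chart_has_derivative closed_C1_curve_derivative(1)[OF \<gamma>])
  have lin: "linear (f' p)" for p
    using der has_derivative_linear by blast
  have "inj (f' p0)"
    unfolding linear_injective_0[OF lin]
  proof safe
    fix h assume h: "f' p0 h = 0"
    have "perp (w s0) \<bullet> f' p0 h = (h $ 2) * (perp (w s0) \<bullet> e)" "perp e \<bullet> f' p0 h = - (h $ 1) * (perp (w s0) \<bullet> e)"
      unfolding f'_def p0 by (simp_all add: perp_inner algebra_simps)
    then show "h = 0" using e h by (simp add: w_def vec_eq_iff forall_2)
  qed
  then obtain g' where g': "linear g'" "g' \<circ> f' p0 = id"
    using linear_injective_left_inverse[OF lin] by blast
  have small: "\<exists>d>0. \<forall>p. dist p0 p < d \<longrightarrow> onorm (\<lambda>v. f' p v - f' p0 v) < \<epsilon>" if "\<epsilon> > 0" for \<epsilon>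
  proof -
    have "continuous_on UNIV w" unfolding w_def by (rule closed_C1_curve_derivative(2)[OF \<gamma>])
    then have "isCont w s0" by (simp add: continuous_on_eq_continuous_at)
    then obtain d where d: "d > 0" "\<And>s. dist s s0 < d \<Longrightarrow> dist (w s) (w s0) < \<epsilon> / 2"
      using half_gt_zero[OF \<open>\<epsilon> > 0\<close>] unfolding continuous_at_eps_delta by blast
    have "onorm (\<lambda>v. f' p v - f' p0 v) < \<epsilon>" if "dist p0 p < d" for p
    proof -
      have "dist (p $ 1) s0 < d" using that dist_vec_nth_le[of p 1 p0] p0 by (simp add: dist_commute)
      from d(2)[OF this] have "norm (w (p $ 1) - w s0) < \<epsilon> / 2" by (simp add: dist_norm)
      moreover have "onorm (\<lambda>v. f' p v - f' p0 v) \<le> norm (w (p $ 1) - w s0)"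
      proof (rule onorm_le)
        fix v :: "real^2"
        have "norm (f' p v - f' p0 v) = \<bar>v $ 1\<bar> * norm (w (p $ 1) - w s0)"
          unfolding f'_def p0 by (simp add: scaleR_diff_right[symmetric])
        also have "\<dots> \<le> norm (w (p $ 1) - w s0) * norm v"
          using component_le_norm_cart[of v 1] by (metis mult.commute mult_left_mono norm_ge_zero)
        finally show "norm (f' p v - f' p0 v) \<le> norm (w (p $ 1) - w s0) * norm v" .
      qed
      ultimately show ?thesis using \<open>\<epsilon> > 0\<close> by linarith
    qed
    then show ?thesis using d(1) by blast
  qed
  obtain r where r: "r > 0" "inj_on (chart \<gamma> e) (ball p0 r)"
    using has_derivative_locally_injective[of p0 UNIV g' f' "chart \<gamma> e"] g' der small
    by (auto simp: linear_conv_bounded_linear)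
  have "square s0 (r / 2) \<subseteq> ball p0 r"
  proof
    fix p assume "p \<in> square s0 (r / 2)"
    then have "\<bar>p $ 1 - s0\<bar> < r / 2" "\<bar>p $ 2\<bar> < r / 2" by (auto simp: mem_square)
    then have "norm (p - p0) < r"
      using norm_le_l1_cart[of "p - p0"] p0 by (simp add: UNIV_2)
    then show "p \<in> ball p0 r" by (simp add: dist_norm norm_minus_commute)
  qed
  then show ?thesis using that[of "r / 2"] r inj_on_subset by auto
qed

text \<open>In a small chart the boundary is exactly the axis: other curves and other parts of the same curve are
  compact and miss the point \<open>\<gamma> s0\<close>, and injectivity excludes further points of the nearby part. The
  two halves of the chart are connected and avoid the boundary, so each lies in \<open>\<Omega>\<close> or outside, and
  the rays of direction \<open>e\<close> through \<open>\<gamma> s0\<close> decide which. Then the same rays at nearby points show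
  that \<open>e\<close> points outwards there as well. The bound \<open>1/2\<close> keeps the chart within one period of
  the curve.\<close>

lemma boundary_chart:
  assumes dom: "C1_domain \<Omega> \<C>" "\<gamma> \<in> \<C>" and e: "outer_normal \<Omega> (\<gamma> s0) \<bullet> e > 0"
  obtains \<delta> where "0 < \<delta>" "\<delta> < 1/2" "inj_on (chart \<gamma> e) (square s0 \<delta>)"
    "\<And>p. p \<in> square s0 \<delta> \<Longrightarrow> p $ 2 < 0 \<Longrightarrow> chart \<gamma> e p \<in> \<Omega>"
    "\<And>p. p \<in> square s0 \<delta> \<Longrightarrow> p $ 2 > 0 \<Longrightarrow> chart \<gamma> e p \<notin> \<Omega>"
    "\<And>c s. c \<in> \<C> \<Longrightarrow> c s \<in> chart \<gamma> e ` square s0 \<delta> \<Longrightarrow>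
       c = \<gamma> \<and> (\<exists>n::int. \<bar>s - s0 - of_int n\<bar> < \<delta>)"
    "\<And>s. \<bar>s - s0\<bar> < \<delta> \<Longrightarrow> outer_normal \<Omega> (\<gamma> s) \<bullet> e > 0"
proof -
  note \<gamma> = C1_domain_curveD(1)[OF dom]
  define w where "w s = vector_derivative \<gamma> (at s)" for s
  define \<nu> where "\<nu> s = outer_normal \<Omega> (\<gamma> s)" for s
  have \<nu>: "\<nu> s \<bullet> w s = 0" "norm (\<nu> s) = 1" "w s \<noteq> 0" for s
    unfolding \<nu>_def w_def by (rule boundary_curve_normal[OF dom])+
  have transv: "\<nu> s \<bullet> e \<noteq> 0 \<longleftrightarrow> perp (w s) \<bullet> e \<noteq> 0" for s
  proof -
    obtain a where "a \<noteq> 0" "\<nu> s = a *\<^sub>R perp (w s)" using unit_orthogonal_multiple[OF \<nu>[of s]] .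
    then show ?thesis by simp
  qed
  have e0: "perp (w s0) \<bullet> e \<noteq> 0" using e transv[of s0] by (simp add: \<nu>_def)
  obtain \<rho> where \<rho>: "\<rho> > 0" "inj_on (chart \<gamma> e) (square s0 \<rho>)"
    using chart_locally_injective[OF \<gamma> e0[unfolded w_def]] .
  have "continuous_on UNIV (\<lambda>s. perp (w s) \<bullet> e)"
    unfolding w_def by (intro continuous_intros bounded_linear.continuous_on[OF bounded_linear_perp] closed_C1_curve_derivative(2)[OF \<gamma>])
  then have "isCont (\<lambda>s. perp (w s) \<bullet> e) s0" by (simp add: continuous_on_eq_continuous_at)
  then obtain \<delta>0 where \<delta>0: "\<delta>0 > 0" "\<And>s. dist s s0 < \<delta>0 \<Longrightarrow> perp (w s) \<bullet> e \<noteq> 0"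
    using e0 continuous_at_avoid[of s0 "\<lambda>s. perp (w s) \<bullet> e" 0] by (auto simp: dist_commute)
  define \<delta>1 where "\<delta>1 = min (min \<rho> \<delta>0) (1/2) / 2"
  have \<delta>1: "\<delta>1 > 0" "\<delta>1 < \<rho>" "\<delta>1 < \<delta>0" "\<delta>1 < 1/2" using \<rho> \<delta>0 by (auto simp: \<delta>1_def)
  \<comment> \<open>the part of the boundary away from \<open>\<gamma> s0\<close>\<close>
  define Z where "Z = \<gamma> ` {s0 + \<delta>1..s0 + 1 - \<delta>1} \<union> (\<Union>c\<in>\<C> - {\<gamma>}. range c)"
  have "closed Z"
    unfolding Z_def
    by (intro closed_Un closed_UN compact_imp_closed compact_continuous_image closed_C1_curve_derivative(4)[OF \<gamma>])
       (use C1_domainD(3)[OF dom(1)] closed_C1_curve_compact_range C1_domain_curveD(1)[OF dom(1)] in \<open>auto intro: compact_imp_closed\<close>)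
  have "\<gamma> s0 \<notin> Z"
  proof
    assume "\<gamma> s0 \<in> Z"
    then consider s where "s \<in> {s0 + \<delta>1..s0 + 1 - \<delta>1}" "\<gamma> s0 = \<gamma> s" | c s where "c \<in> \<C>" "c \<noteq> \<gamma>" "\<gamma> s0 = c s"
      by (auto simp: Z_def)
    then show False
    proof cases
      case 1
      then obtain n :: int where n: "s = s0 + of_int n" using closed_C1_curve_eq[OF \<gamma>] by metis
      then have "0 < real_of_int n" "real_of_int n < 1" using 1 \<delta>1 by auto
      then show False by simp
    next
      case 2
      then show False using C1_domain_curveD(6)[OF dom] by blast
    qed
  qed
  define p0 :: "real^2" where "p0 = vector [s0, 0]"
  have p0: "p0 $ 1 = s0" "p0 $ 2 = 0" by (simp_all add: p0_def)
  have "open (chart \<gamma> e -` (- Z))"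
    by (rule open_vimage) (use \<open>closed Z\<close> chart_continuous[OF \<gamma>] in auto)
  moreover have "p0 \<in> chart \<gamma> e -` (- Z)" using \<open>\<gamma> s0 \<notin> Z\<close> by (simp add: chart_def p0)
  ultimately obtain r where r: "r > 0" "ball p0 r \<subseteq> chart \<gamma> e -` (- Z)"
    by (meson open_contains_ball)
  define \<delta> where "\<delta> = min \<delta>1 (r / 2)"
  have \<delta>: "\<delta> > 0" "\<delta> < 1/2" "\<delta> < \<rho>" "\<delta> < \<delta>0" "\<delta> \<le> \<delta>1" using r \<delta>1 by (auto simp: \<delta>_def)
  have inj: "inj_on (chart \<gamma> e) (square s0 \<delta>)"
    using \<rho>(2) by (rule inj_on_subset) (use \<delta> in \<open>auto simp: mem_square\<close>)
  have noZ: "chart \<gamma> e p \<notin> Z" if "p \<in> square s0 \<delta>" for p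
  proof -
    have "\<bar>p $ 1 - s0\<bar> < r / 2" "\<bar>p $ 2\<bar> < r / 2" using that by (auto simp: mem_square \<delta>_def)
    then have "norm (p - p0) < r"
      using norm_le_l1_cart[of "p - p0"] p0 by (simp add: UNIV_2)
    then show ?thesis using r(2) by (auto simp: dist_norm norm_minus_commute subset_iff)
  qed
  have hit: "c = \<gamma> \<and> p $ 2 = 0 \<and> (\<exists>n::int. \<bar>s - s0 - of_int n\<bar> < \<delta>)"
    if c: "c \<in> \<C>" "c s = chart \<gamma> e p" "p \<in> square s0 \<delta>" for c s p
  proof -
    have "c s \<notin> Z" using noZ c by metis
    then have [simp]: "c = \<gamma>" using c(1) by (auto simp: Z_def)
    \<comment> \<open>the representative of the parameter in the period that starts at \<open>s0 - \<delta>1\<close>\<close>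
    define s' where "s' = s0 - \<delta>1 + frac (s - (s0 - \<delta>1))"
    define n where "n = \<lfloor>s - (s0 - \<delta>1)\<rfloor>"
    have s': "s = s' + of_int n" "s' \<ge> s0 - \<delta>1" "s' < s0 - \<delta>1 + 1"
      using frac_ge_0[of "s - (s0 - \<delta>1)"] frac_lt_1[of "s - (s0 - \<delta>1)"]
      unfolding s'_def n_def by (simp add: frac_def, linarith, linarith)
    have eq: "\<gamma> s' = chart \<gamma> e p" using c(2) closed_C1_curve_periodic[OF \<gamma>, of s' n] s'(1) by simp
    then have "\<gamma> s' \<notin> Z" using noZ c(3) by simp
    then have "\<not> (s0 + \<delta>1 \<le> s' \<and> s' \<le> s0 + 1 - \<delta>1)" by (auto simp: Z_def)
    then have "\<bar>s' - s0\<bar> \<le> \<delta>1" using s' by auto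
    define q :: "real^2" where "q = vector [s', 0]"
    have q: "q $ 1 = s'" "q $ 2 = 0" by (simp_all add: q_def)
    have "chart \<gamma> e q = chart \<gamma> e p" using eq q by (simp add: chart_def)
    moreover have "q \<in> square s0 \<rho>" using q \<open>\<bar>s' - s0\<bar> \<le> \<delta>1\<close> \<delta>1 \<rho> by (simp add: mem_square)
    moreover have "p \<in> square s0 \<rho>" using c(3) \<delta> by (auto simp: mem_square)
    ultimately have "q = p" using \<rho>(2) by (auto dest: inj_onD)
    then show ?thesis using c(3) q s'(1) by (auto simp: mem_square intro!: exI[of _ n])
  qed
  have fr: "chart \<gamma> e p \<notin> frontier \<Omega>" if "p \<in> square s0 \<delta>" "p $ 2 \<noteq> 0" for p
    using hit that unfolding C1_domainD(4)[OF dom(1)] by force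
  define A where "A = box (vector [s0 - \<delta>, - \<delta>] :: real^2) (vector [s0 + \<delta>, 0])"
  define B where "B = box (vector [s0 - \<delta>, 0] :: real^2) (vector [s0 + \<delta>, \<delta>])"
  have memA: "p \<in> A \<longleftrightarrow> p \<in> square s0 \<delta> \<and> p $ 2 < 0" for p
    using \<delta>(1) by (auto simp: A_def mem_square mem_box_cart forall_2)
  have memB: "p \<in> B \<longleftrightarrow> p \<in> square s0 \<delta> \<and> p $ 2 > 0" for p
    using \<delta>(1) by (auto simp: B_def mem_square mem_box_cart forall_2)
  have conn: "connected (chart \<gamma> e ` A)" "connected (chart \<gamma> e ` B)"
    unfolding A_def B_def by (intro connected_continuous_image chart_continuous[OF \<gamma>] convex_connected convex_box)+
  have fA: "chart \<gamma> e ` A \<inter> frontier \<Omega> = {}" "chart \<gamma> e ` B \<inter> frontier \<Omega> = {}"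
    using fr by (auto simp: memA memB)
  have ray: "\<forall>\<^sub>F r in at_right 0. \<gamma> s - r *\<^sub>R e' \<in> \<Omega> \<and> \<gamma> s + r *\<^sub>R e' \<notin> \<Omega>" if "\<nu> s \<bullet> e' > 0" for s e'
    using outer_normal_ray[OF C1_domain_curveD(5)[OF dom, of s]] that by (simp add: \<nu>_def)
  have small: "\<forall>\<^sub>F r in at_right (0::real). r < \<delta> \<and> r > 0"
    using \<delta>(1) by (auto simp: eventually_at_right_field intro!: exI[of _ \<delta>])
  have "\<forall>\<^sub>F r in at_right 0. \<gamma> s0 - r *\<^sub>R e \<in> \<Omega> \<and> \<gamma> s0 + r *\<^sub>R e \<notin> \<Omega> \<and> r < \<delta> \<and> r > 0"
    using ray[OF e[folded \<nu>_def]] small by eventually_elim simp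
  then obtain r where r: "\<gamma> s0 - r *\<^sub>R e \<in> \<Omega>" "\<gamma> s0 + r *\<^sub>R e \<notin> \<Omega>" "r < \<delta>" "r > 0"
    using eventually_happens'[of "at_right (0::real)"] by auto
  have mA: "\<gamma> s - r *\<^sub>R e \<in> chart \<gamma> e ` A" if "\<bar>s - s0\<bar> < \<delta>" "r < \<delta>" "r > 0" for s r
    by (rule image_eqI[of _ _ "vector [s, -r]"]) (use that in \<open>auto simp: memA mem_square chart_def\<close>)
  have mB: "\<gamma> s + r *\<^sub>R e \<in> chart \<gamma> e ` B" if "\<bar>s - s0\<bar> < \<delta>" "r < \<delta>" "r > 0" for s r
    by (rule image_eqI[of _ _ "vector [s, r]"]) (use that in \<open>auto simp: memB mem_square chart_def\<close>)
  have inside: "chart \<gamma> e ` A \<subseteq> \<Omega>"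
    using connected_Int_frontier[OF conn(1), of \<Omega>] fA(1) mA[of s0 r] r \<delta>(1) by auto
  have outside: "chart \<gamma> e ` B \<inter> \<Omega> = {}"
    using connected_Int_frontier[OF conn(2), of \<Omega>] fA(2) mB[of s0 r] r \<delta>(1) by auto
  have pos: "\<nu> s \<bullet> e > 0" if s: "\<bar>s - s0\<bar> < \<delta>" for s
  proof (rule ccontr)
    assume "\<not> \<nu> s \<bullet> e > 0"
    moreover have "\<nu> s \<bullet> e \<noteq> 0" using \<delta>0(2)[of s] transv[of s] s \<delta> by (auto simp: dist_real_def)
    ultimately have "\<nu> s \<bullet> (- e) > 0" by simp
    from ray[OF this] small have "\<forall>\<^sub>F r in at_right 0. \<gamma> s + r *\<^sub>R e \<in> \<Omega> \<and> r < \<delta> \<and> r > 0"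
      by eventually_elim simp
    then obtain r where "\<gamma> s + r *\<^sub>R e \<in> \<Omega>" "r < \<delta>" "r > 0"
      using eventually_happens'[of "at_right (0::real)"] by auto
    then show False using outside mB[OF s] by blast
  qed
  show ?thesis
  proof (rule that[OF \<delta>(1,2) inj])
    show "chart \<gamma> e p \<in> \<Omega>" if "p \<in> square s0 \<delta>" "p $ 2 < 0" for p using inside memA that by blast
    show "chart \<gamma> e p \<notin> \<Omega>" if "p \<in> square s0 \<delta>" "p $ 2 > 0" for p using outside memB that by blast
    show "c = \<gamma> \<and> (\<exists>n::int. \<bar>s - s0 - of_int n\<bar> < \<delta>)" if "c \<in> \<C>" "c s \<in> chart \<gamma> e ` square s0 \<delta>" for c s
      using hit that by blast
    show "outer_normal \<Omega> (\<gamma> s) \<bullet> e > 0" if "\<bar>s - s0\<bar> < \<delta>" for s using pos[OF that] by (simp add: \<nu>_def)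
  qed
qed

text \<open>The sign that makes \<open>perp\<close> of the tangent point outwards; reading it off at parameter \<open>0\<close> is
  enough because it is constant along the curve.\<close>

definition orientation :: "(real^2) set \<Rightarrow> (real \<Rightarrow> real^2) \<Rightarrow> real" where
  "orientation \<Omega> \<gamma> = sgn (outer_normal \<Omega> (\<gamma> 0) \<bullet> perp (vector_derivative \<gamma> (at 0)))"

text \<open>With \<open>e\<close> the normal at one point, a boundary chart shows that the normals at nearby points have
  positive product with \<open>e\<close>, while the product of \<open>e\<close> with \<open>perp\<close> of the tangent is continuous and
  nonzero. So the sign is locally constant.\<close>

lemma sgn_normal_constant:
  assumes dom: "C1_domain \<Omega> \<C>" "\<gamma> \<in> \<C>"
  shows "sgn (outer_normal \<Omega> (\<gamma> s) \<bullet> perp (vector_derivative \<gamma> (at s))) = orientation \<Omega> \<gamma>"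
proof -
  note \<gamma> = C1_domain_curveD(1)[OF dom]
  define w where "w s = vector_derivative \<gamma> (at s)" for s
  define \<nu> where "\<nu> s = outer_normal \<Omega> (\<gamma> s)" for s
  have \<nu>: "\<nu> s \<bullet> w s = 0" "norm (\<nu> s) = 1" "w s \<noteq> 0" for s
    unfolding \<nu>_def w_def by (rule boundary_curve_normal[OF dom])+
  define \<sigma> where "\<sigma> s = sgn (\<nu> s \<bullet> perp (w s))" for s
  have \<sigma>: "\<nu> s = \<sigma> s *\<^sub>R (perp (w s) /\<^sub>R norm (w s))" "\<sigma> s \<noteq> 0" for s
    using unit_orthogonal[OF \<nu>[of s]] linear_cmul[OF linear_perp] by (simp_all add: \<sigma>_def sgn_zero_iff)
  have loc: "\<forall>\<^sub>F s' in at s. \<sigma> s' = \<sigma> s" for s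
  proof -
    define e where "e = \<nu> s"
    have e: "\<nu> s \<bullet> e > 0" using \<nu>(2)[of s] by (auto simp: e_def)
    obtain \<delta> where \<delta>: "\<delta> > 0" "\<And>s'. \<bar>s' - s\<bar> < \<delta> \<Longrightarrow> \<nu> s' \<bullet> e > 0"
      by (rule boundary_chart[OF dom e[unfolded \<nu>_def]]) (auto simp: \<nu>_def)
    define f where "f s' = perp (w s') \<bullet> e" for s'
    have fs: "\<sigma> s' * f s' > 0" if "\<bar>s' - s\<bar> < \<delta>" for s'
    proof -
      have "0 < \<sigma> s' * (f s' / norm (w s'))" using \<delta>(2)[OF that] \<sigma>(1)[of s'] by (simp add: f_def divide_inverse_commute)
      then have "0 < (\<sigma> s' * (f s' / norm (w s'))) * norm (w s')" using \<nu>(3)[of s'] by (metis mult_pos_pos zero_less_norm_iff)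
      then show ?thesis using \<nu>(3)[of s'] by simp
    qed
    have sf: "\<sigma> s' = sgn (f s')" if "\<bar>s' - s\<bar> < \<delta>" for s'
      using fs[OF that] by (auto simp: \<sigma>_def sgn_if zero_less_mult_iff split: if_splits)
    have "continuous_on UNIV f"
      unfolding f_def w_def by (intro continuous_intros bounded_linear.continuous_on[OF bounded_linear_perp] closed_C1_curve_derivative(2)[OF \<gamma>])
    then have "(f \<longlongrightarrow> f s) (at s)" by (simp add: continuous_on_eq_continuous_at isCont_def)
    then have "((\<lambda>x. f x * f s) \<longlongrightarrow> f s * f s) (at s)" by (intro tendsto_intros)
    moreover have "f s * f s > 0" using fs[of s] \<delta>(1) by (auto simp: zero_less_mult_iff)
    ultimately have "\<forall>\<^sub>F x in at s. f x * f s > 0" by (rule order_tendstoD(1))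
    moreover have "\<forall>\<^sub>F x in at s. \<bar>x - s\<bar> < \<delta>"
      using \<delta>(1) unfolding eventually_at dist_real_def by blast
    ultimately show ?thesis
    proof eventually_elim
      case (elim x)
      then have "sgn (f x) = sgn (f s)" by (auto simp: zero_less_mult_iff)
      then show ?case using sf[of x] sf[of s] elim \<delta>(1) by simp
    qed
  qed
  have "\<sigma> s = \<sigma> 0"
    by (rule connected_local_const[of UNIV s 0 \<sigma>]) (auto intro: eventually_mono[OF loc])
  then show ?thesis by (simp add: \<sigma>_def \<nu>_def w_def orientation_def)
qed

lemma outer_normal_curve:
  assumes dom: "C1_domain \<Omega> \<C>" "\<gamma> \<in> \<C>"
  shows "norm (vector_derivative \<gamma> (at s)) *\<^sub>R outer_normal \<Omega> (\<gamma> s) = orientation \<Omega> \<gamma> *\<^sub>R perp (vector_derivative \<gamma> (at s))"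
    "\<bar>orientation \<Omega> \<gamma>\<bar> = 1"
proof -
  note \<nu> = boundary_curve_normal[OF dom]
  show "\<bar>orientation \<Omega> \<gamma>\<bar> = 1" using unit_orthogonal(2)[OF \<nu>] by (simp add: orientation_def abs_sgn_eq)
  have "norm (vector_derivative \<gamma> (at s)) *\<^sub>R outer_normal \<Omega> (\<gamma> s) =
    norm (vector_derivative \<gamma> (at s)) *\<^sub>R (orientation \<Omega> \<gamma> *\<^sub>R perp (vector_derivative \<gamma> (at s) /\<^sub>R norm (vector_derivative \<gamma> (at s))))"
    using unit_orthogonal(1)[OF \<nu>, of s] by (simp add: sgn_normal_constant[OF dom])
  then show "norm (vector_derivative \<gamma> (at s)) *\<^sub>R outer_normal \<Omega> (\<gamma> s) = orientation \<Omega> \<gamma> *\<^sub>R perp (vector_derivative \<gamma> (at s))"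
    using \<nu>(3)[of s] linear_cmul[OF linear_perp] by simp
qed

section \<open>The divergence theorem on \<open>C\<^sup>1\<close> domains\<close>

lemma absolutely_integrable_continuous_on_compact:
  fixes f :: "'a::euclidean_space \<Rightarrow> 'b::euclidean_space"
  assumes "compact K" "continuous_on K f" "S \<subseteq> K" "S \<in> sets lebesgue"
  shows "f absolutely_integrable_on S"
proof -
  have "set_integrable lborel K f"
    using borel_integrable_compact[OF assms(1,2)] by (simp add: set_integrable_def)
  then have "f absolutely_integrable_on K"
    using absolutely_integrable_on_def set_integrable_def integrable_completion
    by (metis (no_types, lifting) assms(1) borel_compact borel_measurable_integrable sets_lborel set_integrable_def)
  then show ?thesis using assms(4,3) by (rule set_integrable_subset)
qed

text \<open>Fubini for a product type, carried over to vectors by the obvious linear map, which maps boxes to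
  boxes of the same content.\<close>

lemma integral_cbox_cart2:
  fixes f :: "real^2 \<Rightarrow> real"
  assumes "continuous_on (cbox (vector [a, c]) (vector [b, d])) f"
  shows "integral (cbox (vector [a, c]) (vector [b, d])) f = integral {a..b} (\<lambda>x. integral {c..d} (\<lambda>y. f (vector [x, y])))"
proof -
  define g :: "real \<times> real \<Rightarrow> real^2" where "g p = vector [fst p, snd p]" for p
  define h :: "real^2 \<Rightarrow> real \<times> real" where "h p = (p $ 1, p $ 2)" for p
  have hg: "h (g x) = x" for x by (simp add: g_def h_def)
  have gh: "g (h x) = x" for x by (simp add: g_def h_def vec_eq_iff forall_2)
  have gb: "g ` cbox u v = cbox (g u) (g v)" for u v
  proof
    show "cbox (g u) (g v) \<subseteq> g ` cbox u v"
    proof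
      fix x assume "x \<in> cbox (g u) (g v)"
      then have "h x \<in> cbox u v"
        by (cases u; cases v) (auto simp: g_def h_def mem_box_cart forall_2 cbox_Pair_eq)
      then show "x \<in> g ` cbox u v" using gh by (metis image_eqI)
    qed
  qed (cases u, cases v, auto simp: g_def mem_box_cart forall_2 cbox_Pair_eq)
  have hb: "h ` cbox u v = cbox (h u) (h v)" for u v
    using gb[of "h u" "h v"] gh hg by (metis (no_types, lifting) image_cong image_ident image_image)
  have content: "measure lborel (g ` cbox u v) = 1 * measure lborel (cbox u v)" for u v
  proof -
    obtain u1 u2 v1 v2 where uv: "u = (u1, u2)" "v = (v1, v2)" by (cases u, cases v) auto
    have "measure lborel (cbox (vector [u1, u2] :: real^2) (vector [v1, v2])) = measure lborel (cbox u1 v1) * measure lborel (cbox u2 v2)"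
    proof -
      have ex2: "(\<exists>i::2. P i) \<longleftrightarrow> P 1 \<or> P 2" for P using forall_2[of "\<lambda>i. \<not> P i"] by blast
      show ?thesis
        by (auto simp add: content_cbox_if_cart interval_eq_empty_cart ex2 UNIV_2 content_real_if)
    qed
    then show ?thesis unfolding gb uv by (simp add: g_def content_Pair)
  qed
  have "linear g" by (rule linearI) (simp_all add: g_def vec_eq_iff forall_2)
  then have contg: "continuous (at x) g" for x
    by (simp add: linear_continuous_at linear_conv_bounded_linear)
  have box: "cbox (vector [a, c]) (vector [b, d]) = cbox (g (a, c)) (g (b, d))" by (simp add: g_def)
  have "((\<lambda>x. f (g x)) has_integral (1 / 1) *\<^sub>R integral (cbox (g (a,c)) (g (b,d))) f) (h ` cbox (g (a,c)) (g (b,d)))"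
  proof (rule has_integral_twiddle[OF _ hg gh contg])
    show "\<exists>w z. g ` cbox u v = cbox w z" "\<exists>w z. h ` cbox x y = cbox w z" for u v x y
      using gb hb by blast+
    show "measure lborel (g ` cbox u v) = 1 * measure lborel (cbox u v)" for u v by (rule content)
    show "(f has_integral integral (cbox (g (a, c)) (g (b, d))) f) (cbox (g (a, c)) (g (b, d)))"
      using assms unfolding box by (intro integrable_integral integrable_continuous)
  qed simp
  then have 1: "integral (cbox (a, c) (b, d)) (\<lambda>x. f (g x)) = integral (cbox (g (a,c)) (g (b,d))) f"
    unfolding hb hg by (simp add: integral_unique)
  have "continuous_on (cbox (a, c) (b, d)) (\<lambda>x. f (g x))"
  proof (rule continuous_on_compose2[OF assms])
    show "continuous_on (cbox (a, c) (b, d)) g" using contg continuous_at_imp_continuous_on by blast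
    show "g ` cbox (a, c) (b, d) \<subseteq> cbox (vector [a, c]) (vector [b, d])" unfolding gb box by (rule subset_refl)
  qed
  from integral_prod_continuous[OF this]
  have "integral (cbox (a, c) (b, d)) (\<lambda>x. f (g x)) = integral {a..b} (\<lambda>x. integral {c..d} (\<lambda>y. f (g (x, y))))"
    by (simp only: cbox_interval)
  with 1 show ?thesis unfolding box by (simp add: g_def)
qed

text \<open>The theorem for vector-valued integrands, applied to vectors with a single component.\<close>

lemma real_change_of_variables:
  fixes f :: "real^'n::{finite,wellorder} \<Rightarrow> real" and g :: "real^'n::_ \<Rightarrow> real^'n::_"
  assumes "S \<in> sets lebesgue" "\<And>x. x \<in> S \<Longrightarrow> (g has_derivative g' x) (at x within S)" "inj_on g S"
    "(\<lambda>x. \<bar>det (matrix (g' x))\<bar> * f (g x)) absolutely_integrable_on S"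
  shows "f absolutely_integrable_on (g ` S)"
    "integral (g ` S) f = integral S (\<lambda>x. \<bar>det (matrix (g' x))\<bar> * f (g x))"
proof -
  have "(\<lambda>x. \<bar>det (matrix (g' x))\<bar> *\<^sub>R vec (f (g x)) :: real^1) absolutely_integrable_on S \<and>
           integral S (\<lambda>x. \<bar>det (matrix (g' x))\<bar> *\<^sub>R vec (f (g x))) = (vec b :: real^1)
         \<longleftrightarrow> (\<lambda>x. vec (f x) :: real^1) absolutely_integrable_on (g ` S) \<and>
           integral (g ` S) (\<lambda>x. vec (f x)) = (vec b :: real^1)" for b
    by (intro has_absolute_integral_change_of_variables assms)
  then have "(\<lambda>x. \<bar>det (matrix (g' x))\<bar> * f (g x)) absolutely_integrable_on S \<and>
           integral S (\<lambda>x. \<bar>det (matrix (g' x))\<bar> * f (g x)) = b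
         \<longleftrightarrow> f absolutely_integrable_on (g ` S) \<and> integral (g ` S) f = b" for b
    by (simp add: absolutely_integrable_on_1_iff integral_on_1_eq)
  then show "f absolutely_integrable_on (g ` S)"
    "integral (g ` S) f = integral S (\<lambda>x. \<bar>det (matrix (g' x))\<bar> * f (g x))"
    using assms(4) by blast+
qed

lemma det_matrix_chart:
  "\<bar>det (matrix (\<lambda>h::real^2. (h $ 1) *\<^sub>R w + (h $ 2) *\<^sub>R e))\<bar> = \<bar>perp w \<bullet> e\<bar>"
proof -
  have "det (matrix (\<lambda>h::real^2. (h $ 1) *\<^sub>R w + (h $ 2) *\<^sub>R e)) = - (perp w \<bullet> e)"
    by (simp add: det_2 matrix_def perp_inner axis_def)
  then show ?thesis by simp
qed

text \<open>The Jacobian of the chart is \<open>|perp (w s) \<bullet> e|\<close>, which does not depend on the second coordinate,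
  so after the change of variables the inner integral is evaluated by the fundamental theorem of
  calculus.\<close>

lemma integral_chart_derivative:
  fixes \<gamma> :: "real \<Rightarrow> real^2" and f :: "real^2 \<Rightarrow> real" and a b s1 s2 :: real
  defines "B \<equiv> cbox (vector [s1, a]) (vector [s2, b]) :: (real^2) set"
  assumes \<gamma>: "\<And>s. (\<gamma> has_vector_derivative w s) (at s)" "continuous_on {s1..s2} w"
    and inj: "inj_on (chart \<gamma> e) B" and ab: "a \<le> b"
    and f: "\<And>x. x \<in> chart \<gamma> e ` B \<Longrightarrow> (f has_derivative f' x) (at x)"
    and cont: "continuous_on (chart \<gamma> e ` B) (\<lambda>x. f' x e)"
  shows "integral (chart \<gamma> e ` B) (\<lambda>x. f' x e) =
    integral {s1..s2} (\<lambda>s. (f (\<gamma> s + b *\<^sub>R e) - f (\<gamma> s + a *\<^sub>R e)) * \<bar>perp (w s) \<bullet> e\<bar>)"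
proof -
  have memB: "p \<in> B \<longleftrightarrow> p $ 1 \<in> {s1..s2} \<and> p $ 2 \<in> {a..b}" for p
    by (auto simp: B_def mem_box_cart forall_2)
  have der: "(chart \<gamma> e has_derivative (\<lambda>h. (h $ 1) *\<^sub>R w (p $ 1) + (h $ 2) *\<^sub>R e)) (at p within T)" for p T
    by (rule chart_has_derivative[OF \<gamma>(1)])
  have chart_cont: "continuous_on T (chart \<gamma> e)" for T
    by (rule has_derivative_continuous_on[OF der])
  define F where "F p = \<bar>perp (w (p $ 1)) \<bullet> e\<bar> * f' (chart \<gamma> e p) e" for p :: "real^2"
  have c1: "continuous_on {s1..s2} (\<lambda>s. \<bar>perp (w s) \<bullet> e\<bar>)"
    by (intro continuous_intros bounded_linear.continuous_on[OF bounded_linear_perp] \<gamma>(2))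
  have contF: "continuous_on B F"
    unfolding F_def
    by (intro continuous_on_mult continuous_on_compose2[OF c1] continuous_on_compose2[OF cont] chart_cont continuous_intros)
      (auto simp: memB)
  have "F absolutely_integrable_on B"
    using contF unfolding B_def by (rule absolutely_integrable_continuous)
  then have "integral (chart \<gamma> e ` B) (\<lambda>x. f' x e) = integral B F"
    using real_change_of_variables(2)[of B "chart \<gamma> e" "\<lambda>p h. (h $ 1) *\<^sub>R w (p $ 1) + (h $ 2) *\<^sub>R e" "\<lambda>x. f' x e"] der inj
    unfolding det_matrix_chart F_def by (auto simp: B_def)
  also have "\<dots> = integral {s1..s2} (\<lambda>s. integral {a..b} (\<lambda>r. F (vector [s, r])))"
    using contF unfolding B_def by (rule integral_cbox_cart2)
  also have "\<dots> = integral {s1..s2} (\<lambda>s. (f (\<gamma> s + b *\<^sub>R e) - f (\<gamma> s + a *\<^sub>R e)) * \<bar>perp (w s) \<bullet> e\<bar>)"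
  proof (rule integral_cong)
    fix s assume s: "s \<in> {s1..s2}"
    have "((\<lambda>r. f' (\<gamma> s + r *\<^sub>R e) e) has_integral f (\<gamma> s + b *\<^sub>R e) - f (\<gamma> s + a *\<^sub>R e)) {a..b}"
    proof (rule fundamental_theorem_of_calculus[OF ab])
      fix r assume r: "r \<in> {a..b}"
      have "chart \<gamma> e (vector [s, r]) \<in> chart \<gamma> e ` B" by (rule imageI) (use s r in \<open>simp add: memB\<close>)
      then have d: "(f has_derivative f' (\<gamma> s + r *\<^sub>R e)) (at (\<gamma> s + r *\<^sub>R e))"
        using f by (simp add: chart_def)
      have "((\<lambda>r. \<gamma> s + r *\<^sub>R e) has_derivative (\<lambda>h. h *\<^sub>R e)) (at r within {a..b})"
        by (auto intro!: derivative_eq_intros)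
      from has_derivative_compose[OF this d]
      show "((\<lambda>r. f (\<gamma> s + r *\<^sub>R e)) has_vector_derivative f' (\<gamma> s + r *\<^sub>R e) e) (at r within {a..b})"
        unfolding has_vector_derivative_def using linear_cmul[OF has_derivative_linear[OF d]] by simp
    qed
    then show "integral {a..b} (\<lambda>r. F (vector [s, r])) = (f (\<gamma> s + b *\<^sub>R e) - f (\<gamma> s + a *\<^sub>R e)) * \<bar>perp (w s) \<bullet> e\<bar>"
      by (simp add: F_def chart_def integral_unique mult.commute)
  qed
  finally show ?thesis .
qed

text \<open>The two integrals agree at \<open>a = 0\<close>, and by periodicity the derivative in \<open>a\<close> of the left one
  is zero.\<close>

lemma integral_periodic:
  fixes g :: "real \<Rightarrow> real"
  assumes "continuous_on UNIV g" "\<And>s. g (s + 1) = g s"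
  shows "integral {a..a+1} g = integral {0..1} g"
proof -
  \<comment> \<open>a lower limit to the left of all points that occur\<close>
  define F where "F x = integral {-\<bar>a\<bar>-1..x} g" for x
  have c: "continuous_on S g" for S using assms(1) continuous_on_subset by blast
  have F: "integral {x..y} g = F y - F x" if "-\<bar>a\<bar>-1 \<le> x" "x \<le> y" for x y
    using Henstock_Kurzweil_Integration.integral_combine[of "-\<bar>a\<bar>-1" x y g] that
    by (simp add: F_def integrable_continuous_interval[OF c])
  have dF: "(F has_real_derivative g x) (at x)" if "-\<bar>a\<bar>-1 < x" for x
  proof -
    have "(F has_real_derivative g x) (at x within {-\<bar>a\<bar>-1..x+1})"
      unfolding F_def by (rule integral_has_real_derivative[OF c]) (use that in auto)
    moreover have "x \<in> interior {-\<bar>a\<bar>-1..x+1}" using that by auto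
    ultimately show ?thesis by (metis at_within_interior)
  qed
  define d where "d x = F (x + 1) - F x" for x
  have dd: "(d has_real_derivative 0) (at x)" if "-\<bar>a\<bar>-1 < x" for x
  proof -
    have "((\<lambda>x. F (x + 1)) has_real_derivative g (x + 1)) (at x)"
      using dF[of "x + 1"] that by (simp add: DERIV_shift)
    from DERIV_diff[OF this dF[OF that]] show ?thesis
      unfolding d_def using assms(2) by simp
  qed
  have "d a = d 0"
  proof (rule DERIV_isconst3[of "-\<bar>a\<bar>-1" "\<bar>a\<bar>+1" a 0 d])
    show "(d has_real_derivative 0) (at x)" if "x \<in> {-\<bar>a\<bar>-1<..<\<bar>a\<bar>+1}" for x using dd that by auto
  qed auto
  then show ?thesis using F[of a "a+1"] F[of 0 1] by (simp add: d_def)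
qed

text \<open>The integrand of \<open>\<integral> n \<bullet> W ds\<close> in terms of the parameter. The speed cancels against the
  normalization of the normal, which leaves an expression that is continuous in \<open>s\<close> and linear in
  the tangent.\<close>

definition flux_density :: "(real^2) set \<Rightarrow> (real \<Rightarrow> real^2) \<Rightarrow> (real^2 \<Rightarrow> real^2) \<Rightarrow> real \<Rightarrow> real" where
  "flux_density \<Omega> \<gamma> W s = orientation \<Omega> \<gamma> * (perp (vector_derivative \<gamma> (at s)) \<bullet> W (\<gamma> s))"

lemma flux_density_eq:
  assumes "C1_domain \<Omega> \<C>" "\<gamma> \<in> \<C>"
  shows "(outer_normal \<Omega> (\<gamma> s) \<bullet> W (\<gamma> s)) * norm (vector_derivative \<gamma> (at s)) = flux_density \<Omega> \<gamma> W s"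
  using arg_cong[OF outer_normal_curve(1)[OF assms, of s], of "\<lambda>v. v \<bullet> W (\<gamma> s)"]
  by (simp add: flux_density_def mult.commute)

lemma flux_density_continuous:
  assumes "C1_domain \<Omega> \<C>" "\<gamma> \<in> \<C>" "continuous_on (frontier \<Omega>) W"
  shows "continuous_on S (flux_density \<Omega> \<gamma> W)"
proof -
  note \<gamma> = C1_domain_curveD(1)[OF assms(1,2)]
  have "continuous_on S (\<lambda>s. W (\<gamma> s))"
    by (rule continuous_on_compose2[OF assms(3) closed_C1_curve_derivative(4)[OF \<gamma>]])
      (use C1_domain_curveD(2)[OF assms(1,2)] in auto)
  then show ?thesis unfolding flux_density_def
    by (intro continuous_intros bounded_linear.continuous_on[OF bounded_linear_perp] closed_C1_curve_derivative(2)[OF \<gamma>])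
qed

lemma bd_integral_normal:
  assumes "C1_domain \<Omega> \<C>"
  shows "bd_integral \<C> (frontier \<Omega>) (\<lambda>x. outer_normal \<Omega> x \<bullet> W x) = (\<Sum>\<gamma>\<in>\<C>. integral {0..1} (flux_density \<Omega> \<gamma> W))"
  unfolding bd_integral_def
proof (rule sum.cong[OF refl])
  fix \<gamma> assume \<gamma>: "\<gamma> \<in> \<C>"
  have "{s \<in> {0..1}. \<gamma> s \<in> frontier \<Omega>} = {0..1}" using C1_domain_curveD(2)[OF assms \<gamma>] by auto
  then show "integral {s \<in> {0..1}. \<gamma> s \<in> frontier \<Omega>}
      (\<lambda>s. (outer_normal \<Omega> (\<gamma> s) \<bullet> W (\<gamma> s)) * norm (vector_derivative \<gamma> (at s))) =
      integral {0..1} (flux_density \<Omega> \<gamma> W)"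
    by (simp add: flux_density_eq[OF assms \<gamma>])
qed

lemma frechet_derivative_zero_off_support:
  assumes "open N" "closed K" "\<And>y. y \<in> N - K \<Longrightarrow> f y = 0" "x \<in> N - K"
  shows "frechet_derivative f (at x) e = 0"
  using frechet_derivative_cong_open[of "N - K" x f "\<lambda>_. 0"] assms
  by (auto simp: open_Diff frechet_derivative_const)

lemma negligible_C1_curve:
  assumes "closed_C1_curve \<gamma>" shows "negligible (range \<gamma>)"
proof (rule negligible_differentiable_image_lowdim)
  show "\<gamma> differentiable_on UNIV"
    using closed_C1_curve_derivative(1)[OF assms] by (metis differentiableI_vector differentiable_at_imp_differentiable_on)
qed simp

text \<open>The divergence theorem for fields \<open>f e\<close> with \<open>f\<close> supported in a small ball. The condition on the
  support refers to the neighbourhood \<open>N\<close> only, since \<open>f\<close> is arbitrary elsewhere.\<close>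

definition local_divergence_formula :: "(real^2) set \<Rightarrow> (real \<Rightarrow> real^2) set \<Rightarrow> real^2 \<Rightarrow> real^2 \<Rightarrow> real \<Rightarrow> bool" where
  "local_divergence_formula \<Omega> \<C> e x r \<longleftrightarrow>
    (\<forall>N f. open N \<longrightarrow> closure \<Omega> \<subseteq> N \<longrightarrow> Ck_on (Suc 0) f N \<longrightarrow> (\<forall>y\<in>N - cball x r. f y = 0) \<longrightarrow>
      integral \<Omega> (\<lambda>x. frechet_derivative f (at x) e) = (\<Sum>c\<in>\<C>. integral {0..1} (flux_density \<Omega> c (\<lambda>x. f x *\<^sub>R e))))"

lemma local_divergence_formula_mono:
  "local_divergence_formula \<Omega> \<C> e x r \<Longrightarrow> r' \<le> r \<Longrightarrow> local_divergence_formula \<Omega> \<C> e x r'"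
  unfolding local_divergence_formula_def using subset_cball[of r' r x] by (auto simp del: Ck_on.simps)

text \<open>In a boundary chart with \<open>e\<close> pointing outwards, \<open>\<Omega>\<close> is the half \<open>r < 0\<close> up to a negligible set.
  At the lower edge \<open>f\<close> vanishes, at \<open>r = 0\<close> it gives the boundary integral, and there the
  Jacobian equals the flux density of \<open>e\<close> because \<open>n \<bullet> e > 0\<close>.\<close>

lemma local_divergence_boundary:
  assumes dom: "C1_domain \<Omega> \<C>" "\<gamma> \<in> \<C>" and e: "outer_normal \<Omega> (\<gamma> s0) \<bullet> e > 0"
  shows "\<exists>r>0. local_divergence_formula \<Omega> \<C> e (\<gamma> s0) r"
proof -
  note \<gamma> = C1_domain_curveD(1)[OF dom]
  obtain \<delta> where \<delta>: "0 < \<delta>" "\<delta> < 1/2" and inj: "inj_on (chart \<gamma> e) (square s0 \<delta>)"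
    and inside: "\<And>p. p \<in> square s0 \<delta> \<Longrightarrow> p $ 2 < 0 \<Longrightarrow> chart \<gamma> e p \<in> \<Omega>"
    and outside: "\<And>p. p \<in> square s0 \<delta> \<Longrightarrow> p $ 2 > 0 \<Longrightarrow> chart \<gamma> e p \<notin> \<Omega>"
    and hit: "\<And>c s. c \<in> \<C> \<Longrightarrow> c s \<in> chart \<gamma> e ` square s0 \<delta> \<Longrightarrow>
       c = \<gamma> \<and> (\<exists>n::int. \<bar>s - s0 - of_int n\<bar> < \<delta>)"
    and pos: "\<And>s. \<bar>s - s0\<bar> < \<delta> \<Longrightarrow> outer_normal \<Omega> (\<gamma> s) \<bullet> e > 0"
    using boundary_chart[OF dom e] by metis
  \<comment> \<open>a closed square inside the open one on which the chart is controlled\<close>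
  define d where "d = \<delta> / 2"
  have d: "0 < d" "d < \<delta>" using \<delta> by (auto simp: d_def)
  have sub: "square s0 d \<subseteq> square s0 \<delta>" using d by (auto simp: mem_square)
  have "open (chart \<gamma> e ` square s0 d)"
    by (rule invariance_of_domain[OF chart_continuous[OF \<gamma>] _ inj_on_subset[OF inj sub]]) (simp add: square_def open_box)
  moreover have "\<gamma> s0 \<in> chart \<gamma> e ` square s0 d"
    by (rule image_eqI[of _ _ "vector [s0, 0]"]) (use d in \<open>auto simp: mem_square chart_def\<close>)
  ultimately obtain r where r: "r > 0" "cball (\<gamma> s0) r \<subseteq> chart \<gamma> e ` square s0 d"
    by (meson open_contains_cball)
  define B :: "(real^2) set" where "B = cbox (vector [s0 - d, - d]) (vector [s0 + d, 0])"
  have memB: "p \<in> B \<longleftrightarrow> \<bar>p $ 1 - s0\<bar> \<le> d \<and> - d \<le> p $ 2 \<and> p $ 2 \<le> 0" for p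
    by (auto simp: B_def mem_box_cart forall_2)
  have Bsub: "B \<subseteq> square s0 \<delta>" using d by (auto simp: mem_square memB)
  show ?thesis
    unfolding local_divergence_formula_def
  proof (intro exI[of _ r] conjI r(1) allI impI)
    fix N and f :: "real^2 \<Rightarrow> real"
    assume N: "open N" "closure \<Omega> \<subseteq> N" and f: "Ck_on (Suc 0) f N" and z: "\<forall>y\<in>N - cball (\<gamma> s0) r. f y = 0"
    define D where "D x = frechet_derivative f (at x)" for x
    have fz: "f x = 0" if "x \<in> N" "x \<notin> chart \<gamma> e ` square s0 d" for x using z r(2) that by auto
    have Dz: "D x e = 0" if "x \<in> N" "x \<notin> chart \<gamma> e ` square s0 d" for x
      unfolding D_def by (rule frechet_derivative_zero_off_support[OF N(1) closed_cball]) (use z r(2) that in auto)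
    have img: "chart \<gamma> e p \<in> N" "chart \<gamma> e p \<in> \<Omega> \<or> chart \<gamma> e p \<in> range \<gamma>" if "p \<in> B" for p
    proof -
      have "p $ 2 = 0 \<or> p $ 2 < 0" using that by (auto simp: memB)
      then show *: "chart \<gamma> e p \<in> \<Omega> \<or> chart \<gamma> e p \<in> range \<gamma>"
        using inside Bsub that by (auto simp: chart_def)
      have "\<Omega> \<subseteq> N" "range \<gamma> \<subseteq> N" using N(2) closure_subset[of \<Omega>] C1_domain_curveD(4)[OF dom] by auto
      with * show "chart \<gamma> e p \<in> N" by (elim disjE) (auto intro: subsetD)
    qed
    have "integral \<Omega> (\<lambda>x. D x e) = integral (chart \<gamma> e ` B) (\<lambda>x. D x e)"
    proof (rule integral_spike_set)
      have "{x \<in> chart \<gamma> e ` B - \<Omega>. D x e \<noteq> 0} \<subseteq> range \<gamma>" using img by auto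
      then show "negligible {x \<in> chart \<gamma> e ` B - \<Omega>. D x e \<noteq> 0}"
        using negligible_C1_curve[OF \<gamma>] negligible_subset by blast
      have "x \<in> chart \<gamma> e ` B" if x: "x \<in> \<Omega>" "D x e \<noteq> 0" for x
      proof -
        have "x \<in> N" using x(1) N(2) closure_subset[of \<Omega>] by auto
        then obtain p where p: "p \<in> square s0 d" "x = chart \<gamma> e p" using Dz x(2) by blast
        then have "\<not> p $ 2 > 0" using outside sub x(1) by blast
        then have "p \<in> B" using p(1) by (auto simp: memB mem_square)
        then show ?thesis using p by blast
      qed
      then have "{x \<in> \<Omega> - chart \<gamma> e ` B. D x e \<noteq> 0} = {}" by auto
      then show "negligible {x \<in> \<Omega> - chart \<gamma> e ` B. D x e \<noteq> 0}" by (metis negligible_empty)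
    qed
    also have "\<dots> = integral {s0 - d..s0 + d} (\<lambda>s. (f (\<gamma> s + 0 *\<^sub>R e) - f (\<gamma> s + (- d) *\<^sub>R e)) * \<bar>perp (vector_derivative \<gamma> (at s)) \<bullet> e\<bar>)"
      unfolding B_def
    proof (rule integral_chart_derivative[OF closed_C1_curve_derivative(1,2)[OF \<gamma>]])
      show "inj_on (chart \<gamma> e) (cbox (vector [s0 - d, - d]) (vector [s0 + d, 0]))"
        using inj_on_subset[OF inj Bsub] by (simp add: B_def)
      show "(f has_derivative D x) (at x)" if "x \<in> chart \<gamma> e ` cbox (vector [s0 - d, - d]) (vector [s0 + d, 0])" for x
        unfolding D_def by (rule Ck_on_has_derivative[OF f]) (use that img in \<open>auto simp: B_def\<close>)
      have "continuous_on N (\<lambda>x. D x e)"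
        using Ck_on_frechet_derivative[OF f] by (simp add: D_def)
      then show "continuous_on (chart \<gamma> e ` cbox (vector [s0 - d, - d]) (vector [s0 + d, 0])) (\<lambda>x. D x e)"
        by (rule continuous_on_subset) (use img in \<open>auto simp: B_def\<close>)
    qed (use d in auto)
    also have "\<dots> = integral {s0 - d..s0 + d} (flux_density \<Omega> \<gamma> (\<lambda>x. f x *\<^sub>R e))"
    proof (rule integral_cong)
      fix s assume s: "s \<in> {s0 - d..s0 + d}"
      define p :: "real^2" where "p = vector [s, - d]"
      have p: "p $ 1 = s" "p $ 2 = - d" by (simp_all add: p_def)
      have pB: "p \<in> B" using s d by (auto simp: memB p)
      have "chart \<gamma> e p \<notin> chart \<gamma> e ` square s0 d"
      proof
        assume "chart \<gamma> e p \<in> chart \<gamma> e ` square s0 d"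
        then have "p \<in> square s0 d" using inj Bsub pB sub by (auto dest!: inj_onD)
        then show False using d by (simp add: mem_square p)
      qed
      then have "f (chart \<gamma> e p) = 0" using fz img pB by blast
      then have f0: "f (\<gamma> s + (- d) *\<^sub>R e) = 0" by (simp add: chart_def p)
      have "\<bar>s - s0\<bar> < \<delta>" using s d by auto
      from pos[OF this] have "norm (vector_derivative \<gamma> (at s)) * (outer_normal \<Omega> (\<gamma> s) \<bullet> e) > 0"
        using closed_C1_curve_derivative(3)[OF \<gamma>] by simp
      then have "orientation \<Omega> \<gamma> * (perp (vector_derivative \<gamma> (at s)) \<bullet> e) > 0"
        using arg_cong[OF outer_normal_curve(1)[OF dom, of s], of "\<lambda>v. v \<bullet> e"] by simp
      then have "\<bar>perp (vector_derivative \<gamma> (at s)) \<bullet> e\<bar> = orientation \<Omega> \<gamma> * (perp (vector_derivative \<gamma> (at s)) \<bullet> e)"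
        using outer_normal_curve(2)[OF dom] by (metis abs_mult abs_of_pos mult_1)
      then show "(f (\<gamma> s + 0 *\<^sub>R e) - f (\<gamma> s + (- d) *\<^sub>R e)) * \<bar>perp (vector_derivative \<gamma> (at s)) \<bullet> e\<bar> =
          flux_density \<Omega> \<gamma> (\<lambda>x. f x *\<^sub>R e) s"
        using f0 by (simp add: flux_density_def)
    qed
    \<comment> \<open>outside the chart \<open>f\<close> vanishes on the curve, so the interval may be enlarged to a full period\<close>
    also have "\<dots> = integral {s0 - 1/2..s0 - 1/2 + 1} (flux_density \<Omega> \<gamma> (\<lambda>x. f x *\<^sub>R e))"
    proof (rule integral_spike_set)
      have "flux_density \<Omega> \<gamma> (\<lambda>x. f x *\<^sub>R e) s = 0" if s: "s \<in> {s0 - 1/2..s0 - 1/2 + 1}" "s \<notin> {s0 - d..s0 + d}" for s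
      proof -
        have "\<gamma> s \<notin> chart \<gamma> e ` square s0 d"
        proof
          assume a: "\<gamma> s \<in> chart \<gamma> e ` square s0 d"
          then obtain n :: int where n: "\<bar>s - s0 - of_int n\<bar> < \<delta>" using hit[OF dom(2), of s] sub by blast
          have "\<bar>real_of_int n\<bar> < 1" using n s(1) \<delta> by auto
          then have "n = 0" by linarith
          define q :: "real^2" where "q = vector [s, 0]"
          have q: "q $ 1 = s" "q $ 2 = 0" by (simp_all add: q_def)
          have "q \<in> square s0 \<delta>" using n \<open>n = 0\<close> \<delta> by (simp add: mem_square q)
          moreover have "chart \<gamma> e q \<in> chart \<gamma> e ` square s0 d" using a by (simp add: chart_def q)
          ultimately have "q \<in> square s0 d" using inj sub by (auto dest!: inj_onD)
          then show False using s(2) by (simp add: mem_square q) linarith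
        qed
        then have "f (\<gamma> s) = 0" by (intro fz subsetD[OF N(2) C1_domain_curveD(4)[OF dom]])
        then show ?thesis by (simp add: flux_density_def)
      qed
      then have "{x \<in> {s0 - 1/2..s0 - 1/2 + 1} - {s0 - d..s0 + d}. flux_density \<Omega> \<gamma> (\<lambda>x. f x *\<^sub>R e) x \<noteq> 0} = {}" by blast
      then show "negligible {x \<in> {s0 - 1/2..s0 - 1/2 + 1} - {s0 - d..s0 + d}. flux_density \<Omega> \<gamma> (\<lambda>x. f x *\<^sub>R e) x \<noteq> 0}"
        by (metis negligible_empty)
      have "{s0 - d..s0 + d} - {s0 - 1/2..s0 - 1/2 + 1} = {}" using d \<delta> by auto
      then show "negligible {x \<in> {s0 - d..s0 + d} - {s0 - 1/2..s0 - 1/2 + 1}. flux_density \<Omega> \<gamma> (\<lambda>x. f x *\<^sub>R e) x \<noteq> 0}"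
        by (metis (no_types, lifting) Collect_empty_eq empty_iff negligible_empty)
    qed
    also have "\<dots> = integral {0..1} (flux_density \<Omega> \<gamma> (\<lambda>x. f x *\<^sub>R e))"
    proof (rule integral_periodic)
      have "continuous_on (frontier \<Omega>) (\<lambda>x. f x *\<^sub>R e)"
        by (intro continuous_intros continuous_on_subset[OF Ck_on_continuous[OF f]]) (use C1_domainD(8)[OF dom(1)] N(2) in blast)
      then show "continuous_on UNIV (flux_density \<Omega> \<gamma> (\<lambda>x. f x *\<^sub>R e))"
        by (rule flux_density_continuous[OF dom])
      show "flux_density \<Omega> \<gamma> (\<lambda>x. f x *\<^sub>R e) (s + 1) = flux_density \<Omega> \<gamma> (\<lambda>x. f x *\<^sub>R e) s" for s
        using closed_C1_curve_periodic[OF \<gamma>, of s 1] closed_C1_curve_derivative_periodic[OF \<gamma>, of s 1]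
        by (simp add: flux_density_def)
    qed
    also have "\<dots> = (\<Sum>c\<in>\<C>. if c = \<gamma> then integral {0..1} (flux_density \<Omega> \<gamma> (\<lambda>x. f x *\<^sub>R e)) else 0)"
      using C1_domainD(3)[OF dom(1)] dom(2) by simp
    also have "\<dots> = (\<Sum>c\<in>\<C>. integral {0..1} (flux_density \<Omega> c (\<lambda>x. f x *\<^sub>R e)))"
    proof (rule sum.cong)
      fix c assume c: "c \<in> \<C>"
      have "f (c s) = 0" if "c \<noteq> \<gamma>" for s
        by (rule fz[OF subsetD[OF N(2) C1_domain_curveD(4)[OF dom(1) c]]]) (use hit[OF c, of s] sub that in auto)
      then have "integral {0..1} (flux_density \<Omega> c (\<lambda>x. f x *\<^sub>R e)) = 0" if "c \<noteq> \<gamma>"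
        using that by (simp add: flux_density_def[abs_def])
      then show "(if c = \<gamma> then integral {0..1} (flux_density \<Omega> \<gamma> (\<lambda>x. f x *\<^sub>R e)) else 0) =
          integral {0..1} (flux_density \<Omega> c (\<lambda>x. f x *\<^sub>R e))" by auto
    qed simp
    finally show "integral \<Omega> (\<lambda>x. frechet_derivative f (at x) e) = (\<Sum>c\<in>\<C>. integral {0..1} (flux_density \<Omega> c (\<lambda>x. f x *\<^sub>R e)))"
      by (simp add: D_def)
  qed
qed

text \<open>Around an interior point an affine chart does the same, with \<open>f\<close> vanishing at both edges and on
  the boundary of \<open>\<Omega>\<close>.\<close>

lemma local_divergence_interior:
  assumes dom: "C1_domain \<Omega> \<C>" and x0: "x0 \<in> \<Omega>" and e: "e \<noteq> 0"
  shows "\<exists>r>0. local_divergence_formula \<Omega> \<C> e x0 r"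
proof -
  obtain \<eta> where \<eta>: "\<eta> > 0" "ball x0 \<eta> \<subseteq> \<Omega>"
    using C1_domainD(1)[OF dom] x0 open_contains_ball by blast
  define \<gamma> where "\<gamma> s = x0 + s *\<^sub>R perp e" for s
  have chart: "chart \<gamma> e p = x0 + ((p $ 1) *\<^sub>R perp e + (p $ 2) *\<^sub>R e)" for p
    by (simp add: chart_def \<gamma>_def)
  have inj: "inj_on (chart \<gamma> e) T" for T
  proof (rule inj_onI)
    fix p q assume "chart \<gamma> e p = chart \<gamma> e q"
    then have *: "(p $ 1 - q $ 1) *\<^sub>R perp e + (p $ 2 - q $ 2) *\<^sub>R e = 0"
      by (simp add: chart algebra_simps)
    have ee: "e \<bullet> e \<noteq> 0" "perp e \<bullet> perp e \<noteq> 0" using e norm_perp[of e] by (simp_all add: dot_square_norm)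
    have "p $ 1 - q $ 1 = 0" using arg_cong[OF *, of "\<lambda>v. v \<bullet> perp e"] ee
      by (simp add: inner_add_left inner_commute[of e "perp e"])
    moreover have "p $ 2 - q $ 2 = 0" using arg_cong[OF *, of "\<lambda>v. v \<bullet> e"] ee
      by (simp add: inner_add_left)
    ultimately show "p = q" by (simp add: vec_eq_iff forall_2)
  qed
  define d where "d = \<eta> / (4 * norm e)"
  have d: "d > 0" "2 * d * norm e < \<eta>" using \<eta>(1) e by (auto simp: d_def)
  define r where "r = d * norm e / 2"
  have r: "r > 0" "r < d * norm e" using d(1) e by (auto simp: r_def)
  define B :: "(real^2) set" where "B = cbox (vector [- d, - d]) (vector [d, d])"
  have memB: "p \<in> B \<longleftrightarrow> \<bar>p $ 1\<bar> \<le> d \<and> \<bar>p $ 2\<bar> \<le> d" for p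
    by (auto simp: B_def mem_box_cart forall_2)
  have img: "chart \<gamma> e p \<in> \<Omega>" if "p \<in> B" for p
  proof -
    have "norm ((p $ 1) *\<^sub>R perp e + (p $ 2) *\<^sub>R e) \<le> \<bar>p $ 1\<bar> * norm e + \<bar>p $ 2\<bar> * norm e"
      by (rule order_trans[OF norm_triangle_ineq]) simp
    also have "\<dots> \<le> d * norm e + d * norm e"
      using that by (intro add_mono mult_right_mono) (auto simp: memB)
    finally have "dist (chart \<gamma> e p) x0 < \<eta>" using d(2) by (simp add: chart dist_norm)
    then show ?thesis using \<eta>(2) by (auto simp: dist_commute)
  qed
  have ball: "cball x0 r \<subseteq> chart \<gamma> e ` square 0 d"
  proof
    fix y assume "y \<in> cball x0 r"
    then have y: "norm (y - x0) \<le> r" by (simp add: dist_norm norm_minus_commute)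
    define p :: "real^2" where "p = vector [((y - x0) \<bullet> perp e) / (norm e)\<^sup>2, ((y - x0) \<bullet> e) / (norm e)\<^sup>2]"
    have bound: "\<bar>((y - x0) \<bullet> v) / (norm e)\<^sup>2\<bar> < d" if "norm v = norm e" for v
    proof -
      have "\<bar>(y - x0) \<bullet> v\<bar> \<le> r * norm e"
        using Cauchy_Schwarz_ineq2[of "y - x0" v] y that mult_right_mono[OF y, of "norm e"] by simp
      also have "\<dots> < d * (norm e)\<^sup>2" using r(2) e by (simp add: power2_eq_square)
      finally show ?thesis using e by (simp add: divide_less_eq)
    qed
    have "chart \<gamma> e p = y"
      using perp_expansion[OF e, of "y - x0"] by (simp add: chart p_def algebra_simps)
    moreover have "p \<in> square 0 d" using bound[of e] bound[of "perp e"] by (simp add: mem_square p_def)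
    ultimately show "y \<in> chart \<gamma> e ` square 0 d" by blast
  qed
  have sub: "chart \<gamma> e ` square 0 d \<subseteq> chart \<gamma> e ` B" by (rule image_mono) (auto simp: mem_square memB)
  show ?thesis
    unfolding local_divergence_formula_def
  proof (intro exI[of _ r] conjI r(1) allI impI)
    fix N and f :: "real^2 \<Rightarrow> real"
    assume N: "open N" "closure \<Omega> \<subseteq> N" and f: "Ck_on (Suc 0) f N" and z: "\<forall>y\<in>N - cball x0 r. f y = 0"
    define D where "D x = frechet_derivative f (at x)" for x
    have \<Omega>N: "\<Omega> \<subseteq> N" using N(2) closure_subset[of \<Omega>] by auto
    have fz: "f x = 0" if "x \<in> N" "x \<notin> chart \<gamma> e ` square 0 d" for x using z ball that by auto
    have Dz: "D x e = 0" if "x \<in> N" "x \<notin> chart \<gamma> e ` square 0 d" for x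
      unfolding D_def by (rule frechet_derivative_zero_off_support[OF N(1) closed_cball]) (use z ball that in auto)
    have "integral \<Omega> (\<lambda>x. D x e) = integral (chart \<gamma> e ` B) (\<lambda>x. D x e)"
    proof (rule integral_spike_set)
      have "{x \<in> chart \<gamma> e ` B - \<Omega>. D x e \<noteq> 0} = {}" using img by auto
      then show "negligible {x \<in> chart \<gamma> e ` B - \<Omega>. D x e \<noteq> 0}" by (metis negligible_empty)
      have "{x \<in> \<Omega> - chart \<gamma> e ` B. D x e \<noteq> 0} = {}" using Dz \<Omega>N sub by blast
      then show "negligible {x \<in> \<Omega> - chart \<gamma> e ` B. D x e \<noteq> 0}" by (metis negligible_empty)
    qed
    also have "\<dots> = integral {- d..d} (\<lambda>s. (f (\<gamma> s + d *\<^sub>R e) - f (\<gamma> s + (- d) *\<^sub>R e)) * \<bar>perp (perp e) \<bullet> e\<bar>)"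
      unfolding B_def
    proof (rule integral_chart_derivative[OF _ continuous_on_const])
      show "(\<gamma> has_vector_derivative perp e) (at s)" for s
        unfolding \<gamma>_def[abs_def] has_vector_derivative_def by (auto intro!: derivative_eq_intros)
      show "(f has_derivative D x) (at x)" if "x \<in> chart \<gamma> e ` cbox (vector [- d, - d]) (vector [d, d])" for x
        unfolding D_def by (rule Ck_on_has_derivative[OF f]) (use that img \<Omega>N in \<open>auto simp: B_def\<close>)
      have "continuous_on N (\<lambda>x. D x e)"
        using Ck_on_frechet_derivative[OF f] by (simp add: D_def)
      then show "continuous_on (chart \<gamma> e ` cbox (vector [- d, - d]) (vector [d, d])) (\<lambda>x. D x e)"
        by (rule continuous_on_subset) (use img \<Omega>N in \<open>auto simp: B_def\<close>)
    qed (use d inj in auto)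
    also have "\<dots> = integral {- d..d} (\<lambda>s. 0)"
    proof (rule integral_cong)
      fix s assume s: "s \<in> {- d..d}"
      have "f (\<gamma> s + b *\<^sub>R e) = 0" if b: "\<bar>b\<bar> = d" for b
      proof -
        define p :: "real^2" where "p = vector [s, b]"
        have p: "p $ 1 = s" "p $ 2 = b" by (simp_all add: p_def)
        have pB: "p \<in> B" using s b by (auto simp: memB p)
        have "p \<notin> square 0 d" using b by (simp add: mem_square p)
        then have "chart \<gamma> e p \<notin> chart \<gamma> e ` square 0 d" using inj[of UNIV] by (auto dest: injD)
        then have "f (chart \<gamma> e p) = 0" using fz img[OF pB] \<Omega>N by blast
        then show ?thesis by (simp add: chart_def p)
      qed
      from this[of d] this[of "-d"]
      show "(f (\<gamma> s + d *\<^sub>R e) - f (\<gamma> s + (- d) *\<^sub>R e)) * \<bar>perp (perp e) \<bullet> e\<bar> = 0" using d(1) by simp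
    qed
    finally have "integral \<Omega> (\<lambda>x. D x e) = 0" by simp
    moreover have "integral {0..1} (flux_density \<Omega> c (\<lambda>x. f x *\<^sub>R e)) = 0" if c: "c \<in> \<C>" for c
    proof -
      have "f (c s) = 0" for s
      proof -
        have "c s \<notin> chart \<gamma> e ` square 0 d" using C1_domain_curveD(3)[OF dom c, of s] img sub by auto
        then show ?thesis using fz C1_domain_curveD(4)[OF dom c, of s] N(2) by blast
      qed
      then show ?thesis by (simp add: flux_density_def[abs_def])
    qed
    then have "(\<Sum>c\<in>\<C>. integral {0..1} (flux_density \<Omega> c (\<lambda>x. f x *\<^sub>R e))) = 0"
      by simp
    ultimately show "integral \<Omega> (\<lambda>x. frechet_derivative f (at x) e) = (\<Sum>c\<in>\<C>. integral {0..1} (flux_density \<Omega> c (\<lambda>x. f x *\<^sub>R e)))"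
      by (simp add: D_def)
  qed
qed

lemma C1_domain_integrable:
  fixes f :: "real^2 \<Rightarrow> real"
  assumes "C1_domain \<Omega> \<C>" "continuous_on (closure \<Omega>) f"
  shows "f integrable_on \<Omega>"
  using absolutely_integrable_continuous_on_compact[OF C1_domainD(5)[OF assms(1)] assms(2) closure_subset]
    lmeasurable_open[OF C1_domainD(2,1)[OF assms(1)]] by (simp add: absolutely_integrable_on_def fmeasurableD)

text \<open>Both sides are linear in \<open>e\<close>, and the two directions span the plane. At a boundary point with
  normal \<open>\<nu>\<close> both point outwards, whereas \<open>perp \<nu>\<close> is tangent.\<close>

lemma local_divergence_formula_all:
  assumes dom: "C1_domain \<Omega> \<C>" and \<nu>: "norm \<nu> = 1"
    and 1: "local_divergence_formula \<Omega> \<C> \<nu> x r" and 2: "local_divergence_formula \<Omega> \<C> (\<nu> + perp \<nu>) x r"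
  shows "local_divergence_formula \<Omega> \<C> e x r"
  unfolding local_divergence_formula_def
proof (intro allI impI)
  fix N and f :: "real^2 \<Rightarrow> real"
  assume N: "open N" "closure \<Omega> \<subseteq> N" and f: "Ck_on (Suc 0) f N" and z: "\<forall>y\<in>N - cball x r. f y = 0"
  define b where "b = e \<bullet> perp \<nu>"
  define a where "a = e \<bullet> \<nu> - b"
  have e: "e = a *\<^sub>R \<nu> + b *\<^sub>R (\<nu> + perp \<nu>)"
  proof -
    have "\<nu> \<noteq> 0" using \<nu> by auto
    then show ?thesis using perp_expansion[of \<nu> e] \<nu> by (simp add: a_def b_def algebra_simps)
  qed
  define D where "D x = frechet_derivative f (at x)" for x
  have D: "linear (D x)" if "x \<in> \<Omega>" for x
    using has_derivative_linear[OF Ck_on_has_derivative[OF f]] that N(2) closure_subset[of \<Omega>] unfolding D_def by blast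
  have Dint: "(\<lambda>x. D x h) integrable_on \<Omega>" for h
    by (rule C1_domain_integrable[OF dom]) (use Ck_on_frechet_derivative[OF f] N(2) in \<open>auto intro: continuous_on_subset simp: D_def\<close>)
  have fc: "continuous_on (frontier \<Omega>) (\<lambda>x. f x *\<^sub>R h)" for h :: "real^2"
    by (intro continuous_intros continuous_on_subset[OF Ck_on_continuous[OF f]]) (use C1_domainD(8)[OF dom] N(2) in blast)
  have fi: "flux_density \<Omega> c (\<lambda>x. f x *\<^sub>R h) integrable_on {0..1}" if "c \<in> \<C>" for c h
    by (intro integrable_continuous_interval flux_density_continuous[OF dom that fc])
  have "integral \<Omega> (\<lambda>x. D x e) = integral \<Omega> (\<lambda>x. a * D x \<nu> + b * D x (\<nu> + perp \<nu>))"
    by (rule integral_cong) (simp add: e linear_add[OF D] linear_cmul[OF D])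
  also have "\<dots> = a * integral \<Omega> (\<lambda>x. D x \<nu>) + b * integral \<Omega> (\<lambda>x. D x (\<nu> + perp \<nu>))"
    by (subst integral_add) (simp_all add: integrable_on_mult_right Dint)
  also have "\<dots> = a * (\<Sum>c\<in>\<C>. integral {0..1} (flux_density \<Omega> c (\<lambda>x. f x *\<^sub>R \<nu>))) +
      b * (\<Sum>c\<in>\<C>. integral {0..1} (flux_density \<Omega> c (\<lambda>x. f x *\<^sub>R (\<nu> + perp \<nu>))))"
    using 1 2 N f z unfolding local_divergence_formula_def D_def by metis
  also have "\<dots> = (\<Sum>c\<in>\<C>. integral {0..1} (\<lambda>s. a * flux_density \<Omega> c (\<lambda>x. f x *\<^sub>R \<nu>) s + b * flux_density \<Omega> c (\<lambda>x. f x *\<^sub>R (\<nu> + perp \<nu>)) s))"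
    unfolding sum_distrib_left sum.distrib[symmetric]
    by (rule sum.cong[OF refl], subst integral_add) (simp_all add: integrable_on_mult_right fi)
  also have "\<dots> = (\<Sum>c\<in>\<C>. integral {0..1} (flux_density \<Omega> c (\<lambda>x. f x *\<^sub>R e)))"
    by (intro sum.cong refl integral_cong) (simp add: flux_density_def e inner_add_right algebra_simps)
  finally show "integral \<Omega> (\<lambda>x. frechet_derivative f (at x) e) = (\<Sum>c\<in>\<C>. integral {0..1} (flux_density \<Omega> c (\<lambda>x. f x *\<^sub>R e)))"
    by (simp add: D_def)
qed

lemma local_divergence:
  assumes dom: "C1_domain \<Omega> \<C>" and x: "x \<in> closure \<Omega>"
  obtains r where "r > 0" "\<And>e. local_divergence_formula \<Omega> \<C> e x r"
proof -
  have "\<exists>\<nu>. norm \<nu> = 1 \<and> (\<exists>r>0. local_divergence_formula \<Omega> \<C> \<nu> x r) \<and> (\<exists>r>0. local_divergence_formula \<Omega> \<C> (\<nu> + perp \<nu>) x r)"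
  proof (cases "x \<in> \<Omega>")
    case True
    define \<nu> :: "real^2" where "\<nu> = axis 1 1"
    have "\<nu> \<noteq> 0" "\<nu> + perp \<nu> \<noteq> 0" by (auto simp: \<nu>_def vec_eq_iff forall_2 axis_def)
    moreover have "norm \<nu> = 1" by (simp add: \<nu>_def)
    ultimately show ?thesis using local_divergence_interior[OF dom True] by blast
  next
    case False
    then have "x \<in> frontier \<Omega>" using x C1_domainD(1)[OF dom] by (simp add: frontier_def interior_open)
    then obtain \<gamma> s0 where \<gamma>: "\<gamma> \<in> \<C>" "x = \<gamma> s0" using C1_domainD(4)[OF dom] by auto
    define \<nu> where "\<nu> = outer_normal \<Omega> (\<gamma> s0)"
    have n: "norm \<nu> = 1" using C1_domain_curveD(5)[OF dom \<gamma>(1), of s0] by (simp add: \<nu>_def outer_normal_at_def)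
    then have "\<nu> \<bullet> \<nu> > 0" "\<nu> \<bullet> (\<nu> + perp \<nu>) > 0" by (auto simp: inner_add_right inner_commute[of \<nu> "perp \<nu>"])
    then show ?thesis using local_divergence_boundary[OF dom \<gamma>(1), of s0] n \<gamma>(2) unfolding \<nu>_def by blast
  qed
  then obtain \<nu> r1 r2 where \<nu>: "norm \<nu> = 1" "r1 > 0" "r2 > 0"
    "local_divergence_formula \<Omega> \<C> \<nu> x r1" "local_divergence_formula \<Omega> \<C> (\<nu> + perp \<nu>) x r2" by blast
  have "local_divergence_formula \<Omega> \<C> e x (min r1 r2)" for e
    by (rule local_divergence_formula_all[OF dom \<nu>(1)])
      (use \<nu> local_divergence_formula_mono in \<open>metis min.cobounded1 min.cobounded2\<close>)+
  then show ?thesis using that[of "min r1 r2"] \<nu>(2,3) by simp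
qed

text \<open>The square of the positive part makes the bump continuously differentiable across the boundary of
  its ball.\<close>

definition bump :: "real^2 \<Rightarrow> real \<Rightarrow> real^2 \<Rightarrow> real" where
  "bump x r y = (max 0 (r\<^sup>2 - (y - x) \<bullet> (y - x)))\<^sup>2"

lemma Ck_on_positive_part_squared: "Ck_on (Suc 0) (\<lambda>t::real. (max 0 t)\<^sup>2) UNIV"
proof (rule Ck_on_SucI[where f' = "\<lambda>t h. h * (2 * max 0 t)"])
  fix t :: real
  have "((\<lambda>t. (max 0 t)\<^sup>2) has_real_derivative 2 * max 0 t) (at t)"
  proof (cases t "0::real" rule: linorder_cases)
    case less
    then have "((\<lambda>t. (max 0 t)\<^sup>2) has_real_derivative 0) (at t)"
      by (intro has_field_derivative_transform_within_open[OF DERIV_const[of 0], of "{..<0}"]) auto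
    then show ?thesis using less by simp
  next
    case greater
    have "((\<lambda>t::real. t\<^sup>2) has_real_derivative 2 * t) (at t)"
      by (auto intro!: derivative_eq_intros)
    then have "((\<lambda>t. (max 0 t)\<^sup>2) has_real_derivative 2 * t) (at t)"
      by (rule has_field_derivative_transform_within_open[of _ _ _ "{0<..}"]) (use greater in auto)
    then show ?thesis using greater by simp
  next
    case equal
    have "((\<lambda>y::real. ((max 0 y)\<^sup>2 - (max 0 0)\<^sup>2) / (y - 0)) \<longlongrightarrow> 0) (at 0)"
    proof (rule Lim_null_comparison)
      show "\<forall>\<^sub>F y::real in at 0. norm (((max 0 y)\<^sup>2 - (max 0 0)\<^sup>2) / (y - 0)) \<le> \<bar>y\<bar>"
        by (intro always_eventually allI) (auto simp: max_def power2_eq_square)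
      show "((\<lambda>y::real. \<bar>y\<bar>) \<longlongrightarrow> 0) (at 0)" by (rule tendsto_rabs_zero) (rule tendsto_ident_at)
    qed
    then show ?thesis using equal by (simp add: has_field_derivative_iff)
  qed
  then show "((\<lambda>t. (max 0 t)\<^sup>2) has_derivative (\<lambda>h. h * (2 * max 0 t))) (at t)"
    unfolding has_field_derivative_def by (rule has_derivative_eq_rhs) (simp add: fun_eq_iff)
  show "Ck_on 0 (\<lambda>t::real. h * (2 * max 0 t)) UNIV" for h
    by (auto intro!: continuous_intros)
qed simp

lemma Ck_on_bump: "Ck_on (Suc 0) (bump x r) UNIV"
  unfolding bump_def[abs_def]
  by (rule Ck_on_compose[OF open_UNIV open_UNIV _ _ Ck_on_positive_part_squared])
    (auto simp del: Ck_on.simps intro!: Ck_on_diff Ck_on_inner Ck_on_const Ck_on_ident)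

lemma bump_nonneg: "bump x r y \<ge> 0" and bump_pos: "r > 0 \<Longrightarrow> y \<in> ball x r \<Longrightarrow> bump x r y > 0"
  and bump_zero: "r > 0 \<Longrightarrow> y \<notin> cball x r \<Longrightarrow> bump x r y = 0"
proof -
  have "dist x y = norm (y - x)" by (simp add: dist_norm norm_minus_commute)
  then have n: "(y - x) \<bullet> (y - x) = (dist x y)\<^sup>2" by (simp add: power2_norm_eq_inner)
  show "bump x r y \<ge> 0" by (simp add: bump_def)
  show "bump x r y > 0" if "r > 0" "y \<in> ball x r"
  proof -
    have "(dist x y)\<^sup>2 < r\<^sup>2" using that by (intro power_strict_mono) auto
    then show ?thesis by (simp add: bump_def n)
  qed
  show "bump x r y = 0" if "r > 0" "y \<notin> cball x r"
  proof -
    have "r\<^sup>2 \<le> (dist x y)\<^sup>2" using that by (intro power_mono) auto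
    then show ?thesis by (simp add: bump_def n)
  qed
qed

text \<open>Finitely many balls on which the local formula holds cover the compact closure of \<open>\<Omega>\<close>. Dividing
  the bumps by their sum, which is positive near the closure, splits \<open>f\<close> into \<open>C\<^sup>1\<close> pieces
  with small support.\<close>

theorem directional_divergence_theorem:
  assumes dom: "C1_domain \<Omega> \<C>" and N: "open N" "closure \<Omega> \<subseteq> N" and f: "Ck_on (Suc 0) f N"
  shows "integral \<Omega> (\<lambda>x. frechet_derivative f (at x) e) = (\<Sum>c\<in>\<C>. integral {0..1} (flux_density \<Omega> c (\<lambda>x. f x *\<^sub>R e)))"
proof -
  have "\<forall>x\<in>closure \<Omega>. \<exists>r>0. local_divergence_formula \<Omega> \<C> e x r"
    using local_divergence[OF dom] by metis
  then obtain r where r: "\<And>x. x \<in> closure \<Omega> \<Longrightarrow> r x > 0" "\<And>x. x \<in> closure \<Omega> \<Longrightarrow> local_divergence_formula \<Omega> \<C> e x (r x)"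
    by metis
  have "closure \<Omega> \<subseteq> (\<Union>x\<in>closure \<Omega>. ball x (r x))" using r(1) by force
  then obtain T where T: "T \<subseteq> closure \<Omega>" "finite T" "closure \<Omega> \<subseteq> (\<Union>x\<in>T. ball x (r x))"
    using compactE_image[OF C1_domainD(5)[OF dom], of "closure \<Omega>" "\<lambda>x. ball x (r x)"] by auto
  define S where "S y = (\<Sum>x\<in>T. bump x (r x) y)" for y
  have S: "Ck_on (Suc 0) S UNIV" unfolding S_def[abs_def] by (intro Ck_on_sum Ck_on_bump open_UNIV)
  have Spos: "S y > 0" if y: "y \<in> closure \<Omega>" for y
  proof -
    obtain x where "x \<in> T" "y \<in> ball x (r x)" using T(3) y by blast
    moreover from this have "bump x (r x) y > 0" using bump_pos[OF r(1)] T(1) by blast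
    ultimately show ?thesis unfolding S_def using T(2)
      by (intro sum_pos2[of T x]) (auto intro: bump_nonneg)
  qed
  define M where "M = N \<inter> {y. S y > 0}"
  have M: "open M" "closure \<Omega> \<subseteq> M"
    using N Spos Ck_on_continuous[OF S] by (auto simp: M_def intro!: open_Int open_Collect_less continuous_intros)
  define g where "g x y = bump x (r x) y * f y / S y" for x y
  have g: "Ck_on (Suc 0) (g x) M" for x
    unfolding g_def[abs_def]
    by (intro Ck_on_divide Ck_on_mult M Ck_on_subset[OF f] Ck_on_subset[OF S] Ck_on_subset[OF Ck_on_bump]) (auto simp: M_def)
  have fg: "f y = (\<Sum>x\<in>T. g x y)" if "y \<in> M" for y
  proof -
    have "S y \<noteq> 0" using that by (simp add: M_def)
    then show ?thesis by (simp add: g_def S_def[symmetric] sum_divide_distrib[symmetric] sum_distrib_right[symmetric])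
  qed
  have \<Omega>M: "\<Omega> \<subseteq> M" using M(2) closure_subset[of \<Omega>] by auto
  have Dint: "(\<lambda>y. frechet_derivative (g x) (at y) e) integrable_on \<Omega>" for x
    by (rule C1_domain_integrable[OF dom]) (use Ck_on_frechet_derivative[OF g] M(2) in \<open>auto intro: continuous_on_subset\<close>)
  have fi: "flux_density \<Omega> c (\<lambda>y. g x y *\<^sub>R e) integrable_on {0..1}" if "c \<in> \<C>" for c x
    by (intro integrable_continuous_interval flux_density_continuous[OF dom that] continuous_intros
        continuous_on_subset[OF Ck_on_continuous[OF g]]) (use C1_domainD(8)[OF dom] M(2) in blast)
  have "integral \<Omega> (\<lambda>y. frechet_derivative f (at y) e) = integral \<Omega> (\<lambda>y. \<Sum>x\<in>T. frechet_derivative (g x) (at y) e)"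
  proof (rule integral_cong)
    fix y assume y: "y \<in> \<Omega>"
    have "frechet_derivative f (at y) = frechet_derivative (\<lambda>y. \<Sum>x\<in>T. g x y) (at y)"
      by (rule frechet_derivative_cong_open[OF M(1)]) (use y \<Omega>M fg in auto)
    also have "\<dots> = (\<lambda>h. \<Sum>x\<in>T. frechet_derivative (g x) (at y) h)"
      by (intro frechet_derivative_eqI has_derivative_sum Ck_on_has_derivative[OF g]) (use y \<Omega>M in auto)
    finally show "frechet_derivative f (at y) e = (\<Sum>x\<in>T. frechet_derivative (g x) (at y) e)" by simp
  qed
  also have "\<dots> = (\<Sum>x\<in>T. integral \<Omega> (\<lambda>y. frechet_derivative (g x) (at y) e))"
    by (intro integral_sum T(2) Dint)
  also have "\<dots> = (\<Sum>x\<in>T. \<Sum>c\<in>\<C>. integral {0..1} (flux_density \<Omega> c (\<lambda>y. g x y *\<^sub>R e)))"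
  proof (rule sum.cong[OF refl])
    fix x assume x: "x \<in> T"
    then have x': "x \<in> closure \<Omega>" using T(1) by blast
    have "\<forall>y\<in>M - cball x (r x). g x y = 0" using bump_zero[OF r(1)[OF x']] by (simp add: g_def)
    then show "integral \<Omega> (\<lambda>y. frechet_derivative (g x) (at y) e) = (\<Sum>c\<in>\<C>. integral {0..1} (flux_density \<Omega> c (\<lambda>y. g x y *\<^sub>R e)))"
      using r(2)[OF x'] M g unfolding local_divergence_formula_def by blast
  qed
  also have "\<dots> = (\<Sum>c\<in>\<C>. \<Sum>x\<in>T. integral {0..1} (flux_density \<Omega> c (\<lambda>y. g x y *\<^sub>R e)))"
    by (rule sum.swap)
  also have "\<dots> = (\<Sum>c\<in>\<C>. integral {0..1} (\<lambda>s. \<Sum>x\<in>T. flux_density \<Omega> c (\<lambda>y. g x y *\<^sub>R e) s))"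
    by (intro sum.cong refl integral_sum[symmetric] T(2) fi)
  also have "\<dots> = (\<Sum>c\<in>\<C>. integral {0..1} (flux_density \<Omega> c (\<lambda>x. f x *\<^sub>R e)))"
  proof (intro sum.cong refl integral_cong)
    fix c s assume c: "c \<in> \<C>"
    have "c s \<in> M" using C1_domain_curveD(4)[OF dom c] M(2) by blast
    then show "(\<Sum>x\<in>T. flux_density \<Omega> c (\<lambda>y. g x y *\<^sub>R e) s) = flux_density \<Omega> c (\<lambda>x. f x *\<^sub>R e) s"
      by (simp add: flux_density_def fg sum_distrib_left sum_distrib_right)
  qed
  finally show ?thesis .
qed

theorem divergence_theorem:
  fixes P :: "real^2 \<Rightarrow> real^2"
  assumes dom: "C1_domain \<Omega> \<C>" and N: "open N" "closure \<Omega> \<subseteq> N" and P: "Ck_on (Suc 0) P N"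
  shows "integral \<Omega> (divergence P) = bd_integral \<C> (frontier \<Omega>) (\<lambda>x. outer_normal \<Omega> x \<bullet> P x)"
proof -
  have C: "Ck_on (Suc 0) (\<lambda>x. P x $ k) N" for k by (rule Ck_on_vec_nth[OF N(1) P])
  have Dint: "(\<lambda>y. frechet_derivative (\<lambda>x. P x $ k) (at y) e) integrable_on \<Omega>" for k e
    by (rule C1_domain_integrable[OF dom]) (use Ck_on_frechet_derivative[OF C] N(2) in \<open>auto intro: continuous_on_subset\<close>)
  have fi: "flux_density \<Omega> c (\<lambda>y. (P y $ k) *\<^sub>R e) integrable_on {0..1}" if "c \<in> \<C>" for c k e
    by (intro integrable_continuous_interval flux_density_continuous[OF dom that] continuous_intros
        continuous_on_subset[OF Ck_on_continuous[OF C]]) (use C1_domainD(8)[OF dom] N(2) in blast)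
  have "integral \<Omega> (divergence P) = (\<Sum>k\<in>UNIV. integral \<Omega> (\<lambda>y. frechet_derivative (\<lambda>x. P x $ k) (at y) (axis k 1)))"
    unfolding divergence_def[abs_def] pd_def by (intro integral_sum Dint) simp
  also have "\<dots> = (\<Sum>k\<in>UNIV. \<Sum>c\<in>\<C>. integral {0..1} (flux_density \<Omega> c (\<lambda>x. (P x $ k) *\<^sub>R axis k 1)))"
    by (intro sum.cong refl directional_divergence_theorem[OF dom N C])
  also have "\<dots> = (\<Sum>c\<in>\<C>. \<Sum>k\<in>UNIV. integral {0..1} (flux_density \<Omega> c (\<lambda>x. (P x $ k) *\<^sub>R axis k 1)))"
    by (rule sum.swap)
  also have "\<dots> = (\<Sum>c\<in>\<C>. integral {0..1} (\<lambda>s. \<Sum>k\<in>UNIV. flux_density \<Omega> c (\<lambda>x. (P x $ k) *\<^sub>R axis k 1) s))"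
    by (intro sum.cong refl integral_sum[symmetric] fi) simp_all
  also have "\<dots> = (\<Sum>c\<in>\<C>. integral {0..1} (flux_density \<Omega> c P))"
    by (intro sum.cong refl integral_cong)
      (simp add: flux_density_def sum_distrib_left[symmetric] inner_axis inner2 UNIV_2 axis_def algebra_simps)
  finally show ?thesis by (simp add: bd_integral_normal[OF dom])
qed

section \<open>Domains moved by a small displacement\<close>

lemma continuous_on_frechet_derivative:
  fixes f :: "'a::euclidean_space \<Rightarrow> 'b::real_normed_vector"
  assumes "Ck_on (Suc 0) f S" "continuous_on T p" "p ` T \<subseteq> S" "continuous_on T q"
  shows "continuous_on T (\<lambda>z. frechet_derivative f (at (p z)) (q z))"
proof -
  have "continuous_on T (\<lambda>z. \<Sum>b\<in>Basis. (q z \<bullet> b) *\<^sub>R frechet_derivative f (at (p z)) b)"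
    using Ck_on_frechet_derivative[OF assms(1)]
    by (intro continuous_intros assms(4) continuous_on_compose2[OF _ assms(2,3)]) simp
  moreover have "(\<Sum>b\<in>Basis. (q z \<bullet> b) *\<^sub>R frechet_derivative f (at (p z)) b) = frechet_derivative f (at (p z)) (q z)"
    if "z \<in> T" for z
    by (rule linear_basis_expansion[OF has_derivative_linear[OF Ck_on_has_derivative[OF assms(1)]], symmetric]) (use assms(3) that in blast)
  ultimately show ?thesis by (simp cong: continuous_on_cong)
qed

text \<open>The derivative is bounded on the compact support and zero elsewhere.\<close>

lemma compact_support_lipschitz:
  fixes V :: "real^2 \<Rightarrow> real^2"
  assumes V: "Ck_on (Suc 0) V UNIV" and K: "compact K" "\<And>x. x \<notin> K \<Longrightarrow> V x = 0"
  obtains L where "L > 0" "\<And>x h. norm (frechet_derivative V (at x) h) \<le> L * norm h"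
    "\<And>x y. norm (V x - V y) \<le> L * norm (x - y)"
proof -
  define D where "D x = frechet_derivative V (at x)" for x
  have der: "(V has_derivative D x) (at x)" for x
    unfolding D_def by (rule Ck_on_has_derivative[OF V]) simp
  have D0: "D x h = 0" if "x \<notin> K" for x h
    unfolding D_def using frechet_derivative_zero_off_support[of UNIV K V x h] K that compact_imp_closed by auto
  have "\<exists>B>0. \<forall>x. norm (D x h) \<le> B" for h
  proof -
    have "continuous_on K (\<lambda>x. D x h)"
      unfolding D_def by (rule continuous_on_frechet_derivative[OF V]) (auto intro: continuous_intros)
    then have "bounded ((\<lambda>x. D x h) ` K)" using K(1) compact_continuous_image compact_imp_bounded by blast
    then obtain B where "B > 0" "\<forall>x\<in>K. norm (D x h) \<le> B" unfolding bounded_pos by auto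
    then show ?thesis using D0 by (metis less_eq_real_def norm_zero)
  qed
  then obtain B where B: "\<And>h. B h > 0" "\<And>h x. norm (D x h) \<le> B h" by metis
  define L where "L = B (axis 1 1) + B (axis 2 1)"
  have L: "norm (D x h) \<le> L * norm h" for x h
  proof -
    have "D x h = (h $ 1) *\<^sub>R D x (axis 1 1) + (h $ 2) *\<^sub>R D x (axis 2 1)"
      by (rule linear_cart2_expansion[OF has_derivative_linear[OF der]])
    then have "norm (D x h) \<le> \<bar>h $ 1\<bar> * norm (D x (axis 1 1)) + \<bar>h $ 2\<bar> * norm (D x (axis 2 1))"
      by (metis norm_scaleR norm_triangle_ineq)
    also have "\<dots> \<le> norm h * B (axis 1 1) + norm h * B (axis 2 1)"
      by (intro add_mono mult_mono component_le_norm_cart B) (auto)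
    finally show ?thesis by (simp add: L_def algebra_simps)
  qed
  have "norm (V x - V y) \<le> L * norm (x - y)" for x y
    by (rule differentiable_bound[of UNIV V D]) (use der L in \<open>auto intro!: onorm_le\<close>)
  moreover have "L > 0" unfolding L_def using B(1) by (simp add: add_pos_pos)
  ultimately show ?thesis using that L unfolding D_def by blast
qed

text \<open>A homeomorphism that is differentiable at \<open>x\<close> maps cones at \<open>x\<close> to cones up to an error
  \<open>\<eta> |z - x|\<close>. The vector \<open>\<mu>\<close> is the image of the covector \<open>\<nu>\<close>, normalized; the lower
  Lipschitz bound compares distances before and after.\<close>

lemma outer_normal_at_image:
  fixes \<phi> :: "real^2 \<Rightarrow> real^2"
  assumes \<phi>: "bij \<phi>" "c > 0" "\<And>z w. c * norm (z - w) \<le> norm (\<phi> z - \<phi> w)"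
    and der: "(\<phi> has_derivative A) (at x)"
    and \<nu>: "outer_normal_at \<Omega> x \<nu>" and \<mu>: "norm \<mu> = 1" "\<kappa> > 0" "\<And>h. \<mu> \<bullet> A h = \<kappa> * (\<nu> \<bullet> h)"
  shows "outer_normal_at (\<phi> ` \<Omega>) (\<phi> x) \<mu>"
  unfolding outer_normal_at_def
proof (intro conjI allI impI \<mu>(1))
  fix \<epsilon> :: real assume "\<epsilon> > 0"
  \<comment> \<open>half of the opening of the cone absorbs the linearization error, the other half remains for the cone at \<open>x\<close>\<close>
  define \<eta> where "\<eta> = \<epsilon> * c / 2"
  have \<eta>: "\<eta> > 0" using \<open>\<epsilon> > 0\<close> \<phi>(2) by (simp add: \<eta>_def)
  obtain d1 where d1: "d1 > 0" "\<And>z. norm (z - x) < d1 \<Longrightarrow> norm (\<phi> z - \<phi> x - A (z - x)) \<le> \<eta> * norm (z - x)"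
    using der \<eta> unfolding has_derivative_at_alt by blast
  have "\<eta> / \<kappa> > 0" using \<eta> \<mu>(2) by simp
  then obtain d2 where d2: "d2 > 0" "\<And>z. z \<noteq> x \<Longrightarrow> dist z x < d2 \<Longrightarrow>
      (\<nu> \<bullet> (z - x) < - (\<eta> / \<kappa>) * norm (z - x) \<longrightarrow> z \<in> \<Omega>) \<and> (\<nu> \<bullet> (z - x) > (\<eta> / \<kappa>) * norm (z - x) \<longrightarrow> z \<notin> \<Omega>)"
    using \<nu> unfolding outer_normal_at_def eventually_at by (metis UNIV_I)
  define d where "d = min d1 d2"
  have d: "d > 0" using d1 d2 by (simp add: d_def)
  have main: "(\<mu> \<bullet> (y - \<phi> x) < - \<epsilon> * norm (y - \<phi> x) \<longrightarrow> y \<in> \<phi> ` \<Omega>) \<and>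
      (\<mu> \<bullet> (y - \<phi> x) > \<epsilon> * norm (y - \<phi> x) \<longrightarrow> y \<notin> \<phi> ` \<Omega>)"
    if y: "y \<noteq> \<phi> x" "dist y (\<phi> x) < c * d" for y
  proof -
    obtain z where z: "y = \<phi> z" using \<phi>(1) by (metis bij_pointE)
    have "z \<noteq> x" using y z by auto
    have lo: "c * norm (z - x) \<le> norm (y - \<phi> x)" using \<phi>(3) z by simp
    also have "\<dots> < c * d" using y(2) by (simp add: dist_norm)
    finally have "norm (z - x) < d" using \<phi>(2) by simp
    then have zd: "norm (z - x) < d1" "dist z x < d2" by (simp_all add: d_def dist_norm)
    have "\<bar>\<mu> \<bullet> (\<phi> z - \<phi> x - A (z - x))\<bar> \<le> norm \<mu> * norm (\<phi> z - \<phi> x - A (z - x))"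
      by (rule Cauchy_Schwarz_ineq2)
    also have "\<dots> \<le> \<eta> * norm (z - x)" using d1(2)[OF zd(1)] \<mu>(1) by simp
    finally have err: "\<bar>\<mu> \<bullet> (y - \<phi> x) - \<kappa> * (\<nu> \<bullet> (z - x))\<bar> \<le> \<eta> * norm (z - x)"
      by (simp add: z inner_diff_right \<mu>(3))
    have cone: "\<epsilon> * norm (y - \<phi> x) \<ge> 2 * \<eta> * norm (z - x)"
      using mult_left_mono[OF lo, of \<epsilon>] \<open>\<epsilon> > 0\<close> by (simp add: \<eta>_def algebra_simps)
    note cz = d2(2)[OF \<open>z \<noteq> x\<close> zd(2)]
    show ?thesis
    proof (intro conjI impI)
      assume "\<mu> \<bullet> (y - \<phi> x) < - \<epsilon> * norm (y - \<phi> x)"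
      then have "\<kappa> * (\<nu> \<bullet> (z - x)) < - \<eta> * norm (z - x)" using err cone by simp
      then have "\<nu> \<bullet> (z - x) < - (\<eta> / \<kappa>) * norm (z - x)" using \<mu>(2) by (simp add: field_simps)
      then show "y \<in> \<phi> ` \<Omega>" using cz z by blast
    next
      assume "\<mu> \<bullet> (y - \<phi> x) > \<epsilon> * norm (y - \<phi> x)"
      then have "\<kappa> * (\<nu> \<bullet> (z - x)) > \<eta> * norm (z - x)" using err cone by simp
      then have "\<nu> \<bullet> (z - x) > (\<eta> / \<kappa>) * norm (z - x)" using \<mu>(2) by (simp add: field_simps)
      then have "z \<notin> \<Omega>" using cz by blast
      then show "y \<notin> \<phi> ` \<Omega>" using \<phi>(1) z by (auto simp: bij_def dest: injD)
    qed
  qed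
  show "\<forall>\<^sub>F y in at (\<phi> x). (\<mu> \<bullet> (y - \<phi> x) < - \<epsilon> * norm (y - \<phi> x) \<longrightarrow> y \<in> \<phi> ` \<Omega>) \<and>
      (\<mu> \<bullet> (y - \<phi> x) > \<epsilon> * norm (y - \<phi> x) \<longrightarrow> y \<notin> \<phi> ` \<Omega>)"
    unfolding eventually_at by (rule exI[of _ "c * d"]) (use main d \<phi>(2) in auto)
qed

text \<open>The Jacobian determinant of \<open>move V t\<close>, written out as a polynomial in \<open>t\<close>, so that it can be
  differentiated in \<open>t\<close> and is visibly continuous in \<open>x\<close>.\<close>

definition jacobian :: "(real^2 \<Rightarrow> real^2) \<Rightarrow> real \<Rightarrow> real^2 \<Rightarrow> real" where
  "jacobian V t x =
    (1 + t * frechet_derivative V (at x) (axis 1 1) $ 1) * (1 + t * frechet_derivative V (at x) (axis 2 1) $ 2) -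
    t\<^sup>2 * (frechet_derivative V (at x) (axis 1 1) $ 2 * frechet_derivative V (at x) (axis 2 1) $ 1)"

text \<open>As \<open>t V\<close> has Lipschitz constant less than \<open>1/2\<close>, the perturbed identity \<open>move V t\<close> is
  invertible by the contraction principle, and its Jacobian determinant is positive.\<close>

locale displacement =
  fixes V :: "real^2 \<Rightarrow> real^2" and L t :: real
  assumes C1: "Ck_on (Suc 0) V UNIV"
    and deriv_bound: "\<And>x h. norm (frechet_derivative V (at x) h) \<le> L * norm h"
    and lipschitz: "\<And>x y. norm (V x - V y) \<le> L * norm (x - y)"
    and small: "\<bar>t\<bar> * L < 1/2"
begin

abbreviation "DV x \<equiv> frechet_derivative V (at x)"

lemma tV_lipschitz: "norm (t *\<^sub>R V x - t *\<^sub>R V y) \<le> 1/2 * norm (x - y)"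
proof -
  have "norm (t *\<^sub>R V x - t *\<^sub>R V y) = \<bar>t\<bar> * norm (V x - V y)"
    by (simp add: scaleR_diff_right[symmetric])
  also have "\<dots> \<le> \<bar>t\<bar> * (L * norm (x - y))" by (intro mult_left_mono lipschitz) simp
  also have "\<dots> \<le> 1/2 * norm (x - y)" using small mult_right_mono[of "\<bar>t\<bar> * L" "1/2" "norm (x - y)"] by simp
  finally show ?thesis .
qed

lemma move_lower_bound: "1/2 * norm (x - y) \<le> norm (move V t x - move V t y)"
proof -
  have "x - y = (move V t x - move V t y) - (t *\<^sub>R V x - t *\<^sub>R V y)" by (simp add: move_def)
  then have "norm (x - y) \<le> norm (move V t x - move V t y) + norm (t *\<^sub>R V x - t *\<^sub>R V y)"
    by (metis norm_triangle_ineq4)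
  then show ?thesis using tV_lipschitz[of x y] by simp
qed

lemma inj_move: "inj_on (move V t) S"
  by (rule inj_onI) (use move_lower_bound in \<open>metis (no_types, opaque_lifting) cancel_comm_monoid_add_class.diff_cancel divide_eq_0_iff half_gt_zero_iff
      mult_cancel_left2 norm_le_zero_iff norm_zero right_minus_eq zero_less_norm_iff linorder_not_less mult.commute times_divide_eq_right\<close>)

text \<open>Solving \<open>y = x + t V x\<close> for \<open>x\<close> is a fixed point problem for the contraction
  \<open>x \<mapsto> y - t V x\<close>.\<close>

lemma bij_move: "bij (move V t)"
proof -
  have "\<exists>x. y = move V t x" for y
  proof -
    have "\<exists>!x. (\<lambda>x. y - t *\<^sub>R V x) x = x"
    proof (rule banach_fix_type[of "1/2"])
      show "\<forall>x z. dist (y - t *\<^sub>R V x) (y - t *\<^sub>R V z) \<le> 1/2 * dist x z"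
        using tV_lipschitz by (simp add: dist_norm norm_minus_commute)
    qed auto
    then obtain x where "y - t *\<^sub>R V x = x" by blast
    then have "y = move V t x" by (simp add: move_def algebra_simps)
    then show ?thesis by blast
  qed
  then show ?thesis using inj_move by (auto simp: bij_def surj_def)
qed

lemma move_derivative: "(move V t has_derivative (\<lambda>h. h + t *\<^sub>R DV x h)) (at x within S)"
proof -
  have "(V has_derivative DV x) (at x within S)"
    by (rule has_derivative_at_withinI[OF Ck_on_has_derivative[OF C1]]) simp
  then show ?thesis unfolding move_def[abs_def]
    by (intro has_derivative_add has_derivative_ident has_derivative_scaleR_right)
qed

lemma move_continuous: "continuous_on S (move V t)"
  by (rule has_derivative_continuous_on[OF move_derivative])

lemma linear_DV: "linear (DV x)"
  using has_derivative_linear[OF Ck_on_has_derivative[OF C1, of x]] by simp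

lemmas DV_expand = linear_cart2_expansion[OF linear_DV]

lemma jacobian_det: "det (matrix (\<lambda>h. h + t *\<^sub>R DV x h)) = jacobian V t x"
  by (simp add: det_2 matrix_def jacobian_def axis_def power2_eq_square algebra_simps)

text \<open>The entries of \<open>t DV\<close> are less than \<open>1/2\<close> in absolute value, so the product of the diagonal
  entries of the Jacobian matrix exceeds \<open>1/4\<close> while that of the others is at most \<open>1/4\<close>.\<close>

lemma jacobian_pos: "jacobian V t x > 0"
proof -
  have entry: "\<bar>t * DV x (axis k 1) $ i\<bar> < 1/2" for i k
  proof -
    have "\<bar>DV x (axis k 1) $ i\<bar> \<le> L"
      using component_le_norm_cart[of "DV x (axis k 1)" i] deriv_bound[of x "axis k 1"] by simp
    then have "\<bar>t * DV x (axis k 1) $ i\<bar> \<le> \<bar>t\<bar> * L" by (simp add: abs_mult mult_left_mono)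
    then show ?thesis using small by simp
  qed
  define a b c d where "a = t * DV x (axis 1 1) $ 1" and "b = t * DV x (axis 1 1) $ 2"
    and "c = t * DV x (axis 2 1) $ 1" and "d = t * DV x (axis 2 1) $ 2"
  have J: "jacobian V t x = (1 + a) * (1 + d) - b * c"
    by (simp add: jacobian_def a_def b_def c_def d_def power2_eq_square)
  have "1/2 * (1/2) < (1 + a) * (1 + d)"
    using entry[of 1 1] entry[of 2 2] by (intro mult_strict_mono) (auto simp: a_def d_def)
  moreover have "\<bar>b * c\<bar> \<le> 1/2 * (1/2)"
    unfolding abs_mult using entry[of 1 2] entry[of 2 1] by (intro mult_mono) (auto simp: b_def c_def)
  ultimately show ?thesis unfolding J by linarith
qed

text \<open>The determinant as the factor by which a linear map scales areas.\<close>

lemma perp_move_derivative: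
  "perp (a + t *\<^sub>R DV x a) \<bullet> (b + t *\<^sub>R DV x b) = jacobian V t x * (perp a \<bullet> b)"
  unfolding DV_expand[of x a] DV_expand[of x b]
  by (simp add: perp_inner jacobian_def power2_eq_square algebra_simps)

lemma open_move_image: "open \<Omega> \<Longrightarrow> open (move V t ` \<Omega>)"
  by (rule invariance_of_domain[OF move_continuous _ inj_move])

lemma frontier_move: assumes "open \<Omega>" "x \<in> frontier \<Omega>" shows "move V t x \<in> frontier (move V t ` \<Omega>)"
proof -
  have "move V t ` closure \<Omega> \<subseteq> closure (move V t ` \<Omega>)"
    by (rule continuous_image_closure_subset[OF move_continuous]) auto
  moreover have "move V t x \<notin> move V t ` \<Omega>"
    using assms inj_move[of UNIV] by (auto simp: frontier_def interior_open dest: injD)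
  ultimately show ?thesis
    using assms by (auto simp: frontier_def interior_open open_move_image)
qed

lemma closure_move: "compact (closure \<Omega>) \<Longrightarrow> closure (move V t ` \<Omega>) \<subseteq> move V t ` closure \<Omega>"
  by (intro closure_minimal image_mono closure_subset compact_imp_closed compact_continuous_image move_continuous)

lemma moved_curve_derivative:
  assumes "closed_C1_curve \<gamma>"
  shows "vector_derivative (move V t \<circ> \<gamma>) (at s) =
    vector_derivative \<gamma> (at s) + t *\<^sub>R DV (\<gamma> s) (vector_derivative \<gamma> (at s))"
proof -
  let ?w = "vector_derivative \<gamma> (at s)"
  have "((\<lambda>s. move V t (\<gamma> s)) has_derivative (\<lambda>h. h *\<^sub>R ?w + t *\<^sub>R DV (\<gamma> s) (h *\<^sub>R ?w))) (at s)"
    using has_derivative_compose[OF closed_C1_curve_derivative(1)[OF assms, of s UNIV, unfolded has_vector_derivative_def] move_derivative] .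
  moreover have "(\<lambda>h. h *\<^sub>R ?w + t *\<^sub>R DV (\<gamma> s) (h *\<^sub>R ?w)) = (\<lambda>h. h *\<^sub>R (?w + t *\<^sub>R DV (\<gamma> s) ?w))"
    by (simp add: linear_cmul[OF linear_DV] scaleR_add_right mult.commute)
  ultimately show ?thesis by (simp add: o_def vector_derivative_at has_vector_derivative_def)
qed

text \<open>By the preceding determinant identity, \<open>perp\<close> of the moved tangent represents a positive multiple
  of the covector \<open>perp\<close> of the tangent after the move. In particular the moved curve has the
  orientation of the original one.\<close>

lemma outer_normal_moved:
  assumes dom: "C1_domain \<Omega> \<C>" "\<gamma> \<in> \<C>"
  defines "w \<equiv> vector_derivative (move V t \<circ> \<gamma>)"
  shows "norm (w (at s)) *\<^sub>R outer_normal (move V t ` \<Omega>) (move V t (\<gamma> s)) = orientation \<Omega> \<gamma> *\<^sub>R perp (w (at s))"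
proof -
  note \<gamma> = C1_domain_curveD(1)[OF dom]
  define w0 where "w0 = vector_derivative \<gamma> (at s)"
  define \<nu> where "\<nu> = outer_normal \<Omega> (\<gamma> s)"
  define ws where "ws = w (at s)"
  have ws: "ws = w0 + t *\<^sub>R DV (\<gamma> s) w0"
    using moved_curve_derivative[OF \<gamma>, of s] by (simp add: ws_def w_def w0_def)
  have w0: "w0 \<noteq> 0" unfolding w0_def by (rule closed_C1_curve_derivative(3)[OF \<gamma>])
  have "ws \<noteq> 0"
  proof
    assume "ws = 0"
    then have "jacobian V t (\<gamma> s) * (perp w0 \<bullet> b) = 0" for b
      using perp_move_derivative[of w0 "\<gamma> s" b] ws by (simp add: linear_0[OF linear_perp])
    then have "perp w0 \<bullet> perp w0 = 0" using jacobian_pos[of "\<gamma> s"] by (metis less_irrefl mult_eq_0_iff)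
    then show False using w0 norm_perp[of w0] by simp
  qed
  have \<nu>: "norm w0 *\<^sub>R \<nu> = orientation \<Omega> \<gamma> *\<^sub>R perp w0" "\<bar>orientation \<Omega> \<gamma>\<bar> = 1"
    using outer_normal_curve(1)[OF dom, of s] outer_normal_curve(2)[OF dom] by (simp_all add: w0_def \<nu>_def)
  define \<mu> where "\<mu> = (orientation \<Omega> \<gamma> / norm ws) *\<^sub>R perp ws"
  have "outer_normal_at (move V t ` \<Omega>) (move V t (\<gamma> s)) \<mu>"
  proof (rule outer_normal_at_image[OF bij_move _ move_lower_bound move_derivative])
    show "outer_normal_at \<Omega> (\<gamma> s) \<nu>" unfolding \<nu>_def by (rule C1_domain_curveD(5)[OF dom])
    show "norm \<mu> = 1" using \<nu>(2) \<open>ws \<noteq> 0\<close> by (simp add: \<mu>_def)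
    show "jacobian V t (\<gamma> s) * norm w0 / norm ws > 0" using jacobian_pos w0 \<open>ws \<noteq> 0\<close> by simp
    fix h
    have "\<mu> \<bullet> (h + t *\<^sub>R DV (\<gamma> s) h) = orientation \<Omega> \<gamma> / norm ws * (jacobian V t (\<gamma> s) * (perp w0 \<bullet> h))"
      by (simp add: \<mu>_def ws perp_move_derivative)
    also have "\<dots> = jacobian V t (\<gamma> s) / norm ws * ((norm w0 *\<^sub>R \<nu>) \<bullet> h)"
      unfolding \<nu>(1) by simp
    finally show "\<mu> \<bullet> (h + t *\<^sub>R DV (\<gamma> s) h) = jacobian V t (\<gamma> s) * norm w0 / norm ws * (\<nu> \<bullet> h)" by simp
  qed simp
  from outer_normal_eq[OF this] show ?thesis
    using \<open>ws \<noteq> 0\<close> by (simp add: \<mu>_def ws_def)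
qed

lemma bd_integral_moved:
  assumes dom: "C1_domain \<Omega> \<C>"
  shows "bd_integral (moved_curves V t \<C>) (frontier (move V t ` \<Omega>)) (\<lambda>x. outer_normal (move V t ` \<Omega>) x \<bullet> W x) =
    (\<Sum>\<gamma>\<in>\<C>. integral {0..1} (\<lambda>s. orientation \<Omega> \<gamma> *
       (perp (vector_derivative \<gamma> (at s) + t *\<^sub>R DV (\<gamma> s) (vector_derivative \<gamma> (at s))) \<bullet> W (move V t (\<gamma> s)))))"
proof -
  have "inj_on (\<lambda>\<gamma>. move V t \<circ> \<gamma>) \<C>"
    using inj_move[of UNIV] by (auto intro!: inj_onI simp: fun_eq_iff inj_eq)
  then have "bd_integral (moved_curves V t \<C>) (frontier (move V t ` \<Omega>)) (\<lambda>x. outer_normal (move V t ` \<Omega>) x \<bullet> W x) =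
    (\<Sum>\<gamma>\<in>\<C>. integral {s \<in> {0..1}. (move V t \<circ> \<gamma>) s \<in> frontier (move V t ` \<Omega>)}
      (\<lambda>s. (outer_normal (move V t ` \<Omega>) ((move V t \<circ> \<gamma>) s) \<bullet> W ((move V t \<circ> \<gamma>) s)) * norm (vector_derivative (move V t \<circ> \<gamma>) (at s))))"
    unfolding bd_integral_def by (simp add: sum.reindex)
  also have "\<dots> = (\<Sum>\<gamma>\<in>\<C>. integral {0..1} (\<lambda>s. orientation \<Omega> \<gamma> *
       (perp (vector_derivative \<gamma> (at s) + t *\<^sub>R DV (\<gamma> s) (vector_derivative \<gamma> (at s))) \<bullet> W (move V t (\<gamma> s)))))"
  proof (rule sum.cong[OF refl])
    fix \<gamma> assume \<gamma>: "\<gamma> \<in> \<C>"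
    have 1: "{s \<in> {0..1}. (move V t \<circ> \<gamma>) s \<in> frontier (move V t ` \<Omega>)} = {0..1}"
      using frontier_move[OF C1_domainD(1)[OF dom]] C1_domain_curveD(2)[OF dom \<gamma>] by auto
    have 2: "(outer_normal (move V t ` \<Omega>) ((move V t \<circ> \<gamma>) s) \<bullet> W ((move V t \<circ> \<gamma>) s)) * norm (vector_derivative (move V t \<circ> \<gamma>) (at s)) =
      orientation \<Omega> \<gamma> * (perp (vector_derivative \<gamma> (at s) + t *\<^sub>R DV (\<gamma> s) (vector_derivative \<gamma> (at s))) \<bullet> W (move V t (\<gamma> s)))" for s
      using arg_cong[OF outer_normal_moved[OF dom \<gamma>, of s], of "\<lambda>v. v \<bullet> W (move V t (\<gamma> s))"]
      by (simp add: moved_curve_derivative[OF C1_domain_curveD(1)[OF dom \<gamma>]] mult.commute)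
    show "integral {s \<in> {0..1}. (move V t \<circ> \<gamma>) s \<in> frontier (move V t ` \<Omega>)}
      (\<lambda>s. (outer_normal (move V t ` \<Omega>) ((move V t \<circ> \<gamma>) s) \<bullet> W ((move V t \<circ> \<gamma>) s)) * norm (vector_derivative (move V t \<circ> \<gamma>) (at s))) =
      integral {0..1} (\<lambda>s. orientation \<Omega> \<gamma> *
       (perp (vector_derivative \<gamma> (at s) + t *\<^sub>R DV (\<gamma> s) (vector_derivative \<gamma> (at s))) \<bullet> W (move V t (\<gamma> s))))"
      unfolding 1 2 ..
  qed
  finally show ?thesis .
qed

lemma integral_moved:
  fixes f :: "real^2 \<Rightarrow> real"
  assumes dom: "C1_domain \<Omega> \<C>" and f: "continuous_on (move V t ` closure \<Omega>) f"
  shows "integral (move V t ` \<Omega>) f = integral \<Omega> (\<lambda>x. f (move V t x) * jacobian V t x)"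
proof -
  have Dc: "continuous_on S (\<lambda>x. DV x h)" for S h
    by (rule continuous_on_frechet_derivative[OF C1]) (auto intro: continuous_intros)
  have Jc: "continuous_on S (jacobian V t)" for S
    unfolding jacobian_def[abs_def] by (intro continuous_intros Dc)
  have "continuous_on (closure \<Omega>) (\<lambda>x. f (move V t x))"
    by (rule continuous_on_compose2[OF f move_continuous]) auto
  then have "(\<lambda>x. \<bar>jacobian V t x\<bar> * f (move V t x)) absolutely_integrable_on \<Omega>"
    by (intro absolutely_integrable_continuous_on_compact[OF C1_domainD(5)[OF dom] _ closure_subset] continuous_intros Jc
        fmeasurableD lmeasurable_open C1_domainD(1,2)[OF dom])
  then have "integral (move V t ` \<Omega>) f = integral \<Omega> (\<lambda>x. \<bar>jacobian V t x\<bar> * f (move V t x))"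
    using real_change_of_variables(2)[of \<Omega> "move V t" "\<lambda>x h. h + t *\<^sub>R DV x h" f] move_derivative inj_move
      fmeasurableD[OF lmeasurable_open[OF C1_domainD(2,1)[OF dom]]]
    by (simp add: jacobian_det)
  then show ?thesis using jacobian_pos by (simp add: abs_of_pos mult.commute)
qed

end

section \<open>Transport formulas\<close>

lemma tube_around_compact:
  fixes K :: "'a::heine_borel set" and M :: "(real \<times> 'a) set"
  assumes "open M" "{0} \<times> K \<subseteq> M" "compact K"
  obtains a :: real where "a > 0" "{-a..a} \<times> K \<subseteq> M"
proof -
  have "compact ({0::real} \<times> K)" by (intro compact_Times assms) simp
  moreover have "closed (- M)" using assms(1) by (simp add: closed_def)
  moreover have "({0} \<times> K) \<inter> (- M) = {}" using assms(2) by auto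
  ultimately obtain d where d: "d > 0" "\<And>x y. x \<in> {0} \<times> K \<Longrightarrow> y \<in> - M \<Longrightarrow> d \<le> dist x y"
    using separate_compact_closed[of "{0} \<times> K" "- M"] by blast
  have "(t, x) \<in> M" if "\<bar>t\<bar> \<le> d / 2" "x \<in> K" for t x
  proof (rule ccontr)
    assume "(t, x) \<notin> M"
    then have "d \<le> dist (0, x) (t, x)" using d(2) that(2) by auto
    then show False using that(1) d(1) by (simp add: dist_Pair_Pair)
  qed
  then have "{- (d / 2)..d / 2} \<times> K \<subseteq> M" by (auto simp: abs_le_iff)
  then show ?thesis using that[of "d / 2"] d(1) by simp
qed

text \<open>Uniform continuity of \<open>F'\<close> on a compact set gives a linearization error \<open>\<le> \<epsilon> |h|\<close> that is uniform in
  \<open>x\<close>, by the mean value inequality in \<open>t\<close>. The set \<open>S\<close> need not be a box.\<close>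

lemma has_derivative_integral_parameter:
  fixes F F' :: "real \<Rightarrow> 'a::euclidean_space \<Rightarrow> real"
  assumes K: "compact K" "S \<subseteq> K" "S \<in> lmeasurable" and a: "a > 0"
    and der: "\<And>t x. \<bar>t\<bar> \<le> a \<Longrightarrow> x \<in> K \<Longrightarrow> ((\<lambda>t. F t x) has_real_derivative F' t x) (at t)"
    and cont: "continuous_on ({-a..a} \<times> K) (\<lambda>(t, x). F' t x)"
    and F: "\<And>t. \<bar>t\<bar> \<le> a \<Longrightarrow> continuous_on K (F t)"
  shows "((\<lambda>t. integral S (F t)) has_real_derivative integral S (F' 0)) (at 0)"
proof -
  have int: "f integrable_on S" if "continuous_on K f" for f :: "'a \<Rightarrow> real"
    using absolutely_integrable_continuous_on_compact[OF K(1) that K(2) fmeasurableD[OF K(3)]]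
    by (simp add: absolutely_integrable_on_def)
  have F'0: "continuous_on K (F' 0)"
  proof -
    have c: "continuous_on K (\<lambda>x. (0::real, x))" by (intro continuous_intros)
    have "(\<lambda>x. (0, x)) ` K \<subseteq> {-a..a} \<times> K" using a by auto
    from continuous_on_compose2[OF cont c this] show ?thesis by simp
  qed
  have uc: "uniformly_continuous_on ({-a..a} \<times> K) (\<lambda>(t, x). F' t x)"
    by (intro compact_uniformly_continuous cont compact_Times K(1)) simp
  \<comment> \<open>a positive bound for the measure of \<open>S\<close>, by which \<open>\<epsilon>\<close> is divided\<close>
  define m where "m = measure lebesgue S + 1"
  have m: "m > 0" "measure lebesgue S < m" by (simp_all add: m_def add_nonneg_pos)
  show ?thesis
    unfolding has_field_derivative_def has_derivative_at_alt
  proof (intro conjI allI impI bounded_linear_mult_right)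
    fix \<epsilon> :: real assume \<epsilon>: "\<epsilon> > 0"
    have "\<epsilon> / m > 0" using \<epsilon> m(1) by simp
    then obtain d where d: "d > 0" "\<And>p q. p \<in> {-a..a} \<times> K \<Longrightarrow> q \<in> {-a..a} \<times> K \<Longrightarrow> dist q p < d \<Longrightarrow>
        dist ((\<lambda>(t, x). F' t x) q) ((\<lambda>(t, x). F' t x) p) < \<epsilon> / m"
      using uc unfolding uniformly_continuous_on_def by metis
    show "\<exists>d>0. \<forall>h. norm (h - 0) < d \<longrightarrow>
        norm (integral S (F h) - integral S (F 0) - integral S (F' 0) * (h - 0)) \<le> \<epsilon> * norm (h - 0)"
    proof (intro exI[of _ "min a d"] conjI allI impI)
      fix h :: real assume "norm (h - 0) < min a d"
      then have h: "\<bar>h\<bar> < a" "\<bar>h\<bar> < d" by auto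
      have pt: "norm (F h x - F 0 x - F' 0 x * h) \<le> \<epsilon> / m * \<bar>h\<bar>" if x: "x \<in> S" for x
      proof -
        have xK: "x \<in> K" using x K(2) by blast
        have "norm (F h x - F 0 x - (h - 0) *\<^sub>R F' 0 x) \<le> norm (h - 0) * (\<epsilon> / m)"
        proof (rule differentiable_bound_linearization[where S = "{-\<bar>h\<bar>..\<bar>h\<bar>}" and f = "\<lambda>t. F t x" and f' = "\<lambda>t s. s *\<^sub>R F' t x"])
          show "0 + \<tau> *\<^sub>R (h - 0) \<in> {-\<bar>h\<bar>..\<bar>h\<bar>}" if "\<tau> \<in> {0..1}" for \<tau>
          proof -
            have "\<bar>\<tau> * h\<bar> \<le> \<bar>h\<bar>" using that by (simp add: abs_mult mult_left_le_one_le)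
            then show ?thesis by (simp add: abs_le_iff)
          qed
          show "((\<lambda>t. F t x) has_derivative (\<lambda>s. s *\<^sub>R F' t x)) (at t within {-\<bar>h\<bar>..\<bar>h\<bar>})" if "t \<in> {-\<bar>h\<bar>..\<bar>h\<bar>}" for t
          proof -
            have "\<bar>t\<bar> \<le> a" using that h by auto
            from der[OF this xK] have "((\<lambda>t. F t x) has_derivative (\<lambda>s. s *\<^sub>R F' t x)) (at t)"
              unfolding has_field_derivative_def by (rule has_derivative_eq_rhs) (simp add: fun_eq_iff)
            then show ?thesis by (rule has_derivative_at_withinI)
          qed
          show "onorm ((\<lambda>s. s *\<^sub>R F' t x) - (\<lambda>s. s *\<^sub>R F' 0 x)) \<le> \<epsilon> / m" if "t \<in> {-\<bar>h\<bar>..\<bar>h\<bar>}" for t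
          proof (rule onorm_le)
            fix s :: real
            have "dist ((\<lambda>(t, x). F' t x) (t, x)) ((\<lambda>(t, x). F' t x) (0, x)) < \<epsilon> / m"
              by (rule d(2)) (use that h xK a in \<open>auto simp: dist_Pair_Pair\<close>)
            then have "\<bar>F' t x - F' 0 x\<bar> \<le> \<epsilon> / m" by (simp add: dist_real_def)
            then have "\<bar>s\<bar> * \<bar>F' t x - F' 0 x\<bar> \<le> \<bar>s\<bar> * (\<epsilon> / m)" by (rule mult_left_mono) simp
            then show "norm (((\<lambda>s. s *\<^sub>R F' t x) - (\<lambda>s. s *\<^sub>R F' 0 x)) s) \<le> \<epsilon> / m * norm s"
              by (simp add: right_diff_distrib[symmetric] abs_mult mult.commute)
          qed
        qed auto
        then show ?thesis by (simp add: mult.commute)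
      qed
      have i: "F h integrable_on S" "F 0 integrable_on S" "F' 0 integrable_on S"
        using int F F'0 h a by auto
      have "integral S (F h) - integral S (F 0) - integral S (F' 0) * (h - 0) = integral S (\<lambda>x. F h x - F 0 x - F' 0 x * h)"
        using i by (simp add: integral_diff integrable_diff integrable_on_mult_left)
      also have "norm \<dots> \<le> integral S (\<lambda>x. \<epsilon> / m * \<bar>h\<bar>)"
        by (rule integral_norm_bound_integral)
          (use i pt K(3) in \<open>auto intro!: integrable_diff integrable_on_mult_left integrable_on_const\<close>)
      also have "integral S (\<lambda>x. \<epsilon> / m * \<bar>h\<bar>) = measure lebesgue S * (\<epsilon> / m * \<bar>h\<bar>)"
        using integral_mult_left[of S "\<lambda>_. 1" "\<epsilon> / m * \<bar>h\<bar>"] unfolding lmeasure_integral[OF K(3)] by simp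
      also have "measure lebesgue S * (\<epsilon> / m * \<bar>h\<bar>) \<le> m * (\<epsilon> / m * \<bar>h\<bar>)"
        using m \<epsilon> by (intro mult_right_mono) auto
      also have "m * (\<epsilon> / m * \<bar>h\<bar>) = \<epsilon> * norm (h - 0)" using m by simp
      finally show "norm (integral S (F h) - integral S (F 0) - integral S (F' 0) * (h - 0)) \<le> \<epsilon> * norm (h - 0)" .
    qed (use a d in auto)
  qed
qed

lemma small_displacements:
  assumes V: "Ck_on (Suc 0) V UNIV" and K: "compact K" "\<And>x. x \<notin> K \<Longrightarrow> V x = (0::real^2)"
  obtains L a where "a > 0" "\<And>t. \<bar>t\<bar> \<le> a \<Longrightarrow> displacement V L t"
proof -
  obtain L where L: "L > 0" "\<And>x h. norm (frechet_derivative V (at x) h) \<le> L * norm h"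
    "\<And>x y. norm (V x - V y) \<le> L * norm (x - y)"
    using compact_support_lipschitz[OF V K] by metis
  have "displacement V L t" if "\<bar>t\<bar> \<le> 1 / (4 * L)" for t
  proof
    have "\<bar>t\<bar> * L \<le> 1 / (4 * L) * L" using that L(1) by (intro mult_right_mono) auto
    then show "\<bar>t\<bar> * L < 1/2" using L(1) by simp
  qed (use V L in auto)
  then show ?thesis using that[of "1 / (4 * L)" L] L(1) by simp
qed

text \<open>Functions of \<open>(t, x)\<close> that are regular near \<open>{0} \<times> K\<close> can by compactness be evaluated at the
  moved points of \<open>K\<close> on a common time interval.\<close>

lemma joint_tube:
  fixes V :: "real^2 \<Rightarrow> real^2"
  assumes "continuous_on UNIV V" "open M" "{0} \<times> K \<subseteq> M" "compact K"
  obtains a where "a > 0" "\<And>t x. \<bar>t\<bar> \<le> a \<Longrightarrow> x \<in> K \<Longrightarrow> (t, move V t x) \<in> M"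
proof -
  have c: "continuous_on UNIV (\<lambda>p::real \<times> (real^2). (fst p, move V (fst p) (snd p)))"
    unfolding move_def by (intro continuous_intros continuous_on_compose2[OF assms(1)]) auto
  have "open ((\<lambda>p. (fst p, move V (fst p) (snd p))) -` M)"
    by (rule open_vimage[OF assms(2) c])
  moreover have "{0} \<times> K \<subseteq> (\<lambda>p. (fst p, move V (fst p) (snd p))) -` M"
    using assms(3) by (auto simp: move_def)
  ultimately obtain a where "a > 0" "{-a..a} \<times> K \<subseteq> (\<lambda>p. (fst p, move V (fst p) (snd p))) -` M"
    by (rule tube_around_compact[OF _ _ assms(4)])
  then show ?thesis using that[of a] by (auto simp: abs_le_iff subset_iff)
qed

lemma time_slice:
  fixes f :: "real \<times> (real^2) \<Rightarrow> 'b::real_normed_vector"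
  assumes "open M" "Ck_on k f M"
  shows "open {x. (t, x) \<in> M}" "Ck_on k (\<lambda>x. f (t, x)) {x. (t, x) \<in> M}"
proof -
  have c: "continuous_on UNIV (\<lambda>x::real^2. (t, x))" by (intro continuous_intros)
  have e: "{x. (t, x) \<in> M} = (\<lambda>x. (t, x)) -` M" by auto
  show o: "open {x. (t, x) \<in> M}" unfolding e by (rule open_vimage[OF assms(1) c])
  show "Ck_on k (\<lambda>x. f (t, x)) {x. (t, x) \<in> M}"
    by (rule Ck_on_compose[OF o assms(1) _ _ assms(2)]) (auto intro!: Ck_on_Pair o Ck_on_const Ck_on_ident)
qed

lemma time_slice_derivative:
  fixes f :: "real \<times> (real^2) \<Rightarrow> 'b::real_normed_vector"
  assumes "Ck_on (Suc 0) f M" "(t, x) \<in> M"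
  shows "frechet_derivative (\<lambda>x. f (t, x)) (at x) h = frechet_derivative f (at (t, x)) (0, h)"
    "((\<lambda>x. f (t, x)) has_derivative (\<lambda>h. frechet_derivative f (at (t, x)) (0, h))) (at x)"
    "((\<lambda>t. f (t, x)) has_vector_derivative frechet_derivative f (at (t, x)) (1, 0)) (at t)"
proof -
  let ?D = "frechet_derivative f (at (t, x))"
  have d: "(f has_derivative ?D) (at (t, x))" by (rule Ck_on_has_derivative[OF assms])
  have "((\<lambda>x. (t, x)) has_derivative (\<lambda>h. (0, h))) (at x)" by (auto intro!: derivative_eq_intros)
  from has_derivative_compose[OF this d]
  show *: "((\<lambda>x. f (t, x)) has_derivative (\<lambda>h. ?D (0, h))) (at x)" .
  show "frechet_derivative (\<lambda>x. f (t, x)) (at x) h = ?D (0, h)" by (simp add: frechet_derivative_eqI[OF *])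
  have "((\<lambda>t. (t, x)) has_derivative (\<lambda>h. (h, 0))) (at t)" by (auto intro!: derivative_eq_intros)
  from has_derivative_compose[OF this d]
  have "((\<lambda>t. f (t, x)) has_derivative (\<lambda>h. ?D (h, 0))) (at t)" .
  moreover have "?D (h, 0) = h *\<^sub>R ?D (1, 0)" for h
    using linear_cmul[OF has_derivative_linear[OF d], of h "(1, 0)"] by simp
  then have "(\<lambda>h. ?D (h, 0)) = (\<lambda>h. h *\<^sub>R ?D (1, 0))" by (rule ext)
  ultimately show "((\<lambda>t. f (t, x)) has_vector_derivative ?D (1, 0)) (at t)"
    by (simp only: has_vector_derivative_def)
qed

lemma derivative_along_displacement:
  fixes f :: "real \<times> (real^2) \<Rightarrow> 'b::real_normed_vector"
  assumes "Ck_on (Suc 0) f M" "(t, move V t x) \<in> M"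
  shows "((\<lambda>t. f (t, move V t x)) has_vector_derivative frechet_derivative f (at (t, move V t x)) (1, V x)) (at t)"
proof -
  let ?D = "frechet_derivative f (at (t, move V t x))"
  have d: "(f has_derivative ?D) (at (t, move V t x))" by (rule Ck_on_has_derivative[OF assms])
  have "((\<lambda>t. (t, move V t x)) has_derivative (\<lambda>h. (h, h *\<^sub>R V x))) (at t)"
    unfolding move_def by (auto intro!: derivative_eq_intros)
  from has_derivative_compose[OF this d]
  have "((\<lambda>t. f (t, move V t x)) has_derivative (\<lambda>h. ?D (h, h *\<^sub>R V x))) (at t)" .
  moreover have "?D (h, h *\<^sub>R V x) = h *\<^sub>R ?D (1, V x)" for h
    using linear_cmul[OF has_derivative_linear[OF d], of h "(1, V x)"] by simp
  then have "(\<lambda>h. ?D (h, h *\<^sub>R V x)) = (\<lambda>h. h *\<^sub>R ?D (1, V x))" by (rule ext)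
  ultimately show ?thesis by (simp only: has_vector_derivative_def)
qed

text \<open>After the change of variables the domain is fixed and the integrand is \<open>f(t, x + t V x)\<close> times the
  Jacobian. Its derivative at \<open>0\<close> is \<open>f' + \<nabla>f \<bullet> V + f (\<nabla> \<cdot> V)\<close>, that is
  \<open>f' + \<nabla> \<cdot> (f V)\<close>.\<close>

theorem derivative_of_volume_integral:
  fixes f :: "real \<times> (real^2) \<Rightarrow> real" and V :: "real^2 \<Rightarrow> real^2"
  assumes dom: "C1_domain \<Omega> \<C>" and V: "Ck_on (Suc 0) V UNIV" and KV: "compact KV" "\<And>x. x \<notin> KV \<Longrightarrow> V x = 0"
    and M: "open M" "{0} \<times> closure \<Omega> \<subseteq> M" and f: "Ck_on (Suc 0) f M"
  shows "((\<lambda>t. integral (move V t ` \<Omega>) (\<lambda>x. f (t, x))) has_real_derivative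
      integral \<Omega> (\<lambda>x. frechet_derivative f (at (0, x)) (1, 0)) +
      bd_integral \<C> (frontier \<Omega>) (\<lambda>x. outer_normal \<Omega> x \<bullet> (f (0, x) *\<^sub>R V x))) (at 0)"
proof -
  let ?K = "closure \<Omega>"
  note K = C1_domainD(5)[OF dom]
  define D where "D = (\<lambda>p. frechet_derivative f (at p))"
  define v where "v j i x = frechet_derivative V (at x) (axis j 1) $ i" for i j :: 2 and x
  obtain L a1 where a1: "a1 > 0" "\<And>t. \<bar>t\<bar> \<le> a1 \<Longrightarrow> displacement V L t"
    using small_displacements[OF V KV] by metis
  obtain a2 where a2: "a2 > 0" "\<And>t x. \<bar>t\<bar> \<le> a2 \<Longrightarrow> x \<in> ?K \<Longrightarrow> (t, move V t x) \<in> M"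
    using joint_tube[OF Ck_on_continuous[OF V] M K] by metis
  define a where "a = min a1 a2"
  have a: "a > 0" "\<And>t. \<bar>t\<bar> \<le> a \<Longrightarrow> displacement V L t" "\<And>t x. \<bar>t\<bar> \<le> a \<Longrightarrow> x \<in> ?K \<Longrightarrow> (t, move V t x) \<in> M"
    using a1 a2 by (auto simp: a_def)
  have J: "jacobian V t x = (1 + t * v 1 1 x) * (1 + t * v 2 2 x) - t\<^sup>2 * (v 1 2 x * v 2 1 x)" for t x
    by (simp add: jacobian_def v_def)
  define J' where "J' t x = v 1 1 x * (1 + t * v 2 2 x) + (1 + t * v 1 1 x) * v 2 2 x - 2 * t * (v 1 2 x * v 2 1 x)" for t x
  have dJ: "((\<lambda>t. jacobian V t x) has_real_derivative J' t x) (at t)" for t x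
    unfolding J J'_def by (auto intro!: derivative_eq_intros simp: algebra_simps)
  have vc: "continuous_on S (v j i)" for S i j
    unfolding v_def by (intro continuous_intros continuous_on_frechet_derivative[OF V]) (auto intro: continuous_intros)
  have vc2: "continuous_on S (\<lambda>p. v j i (snd p))" for i j and S :: "(real \<times> (real^2)) set"
    by (rule continuous_on_compose2[OF vc[of UNIV]]) (auto intro: continuous_intros)
  define F where "F t x = f (t, move V t x) * jacobian V t x" for t x
  define F' where "F' t x = f (t, move V t x) * J' t x + D (t, move V t x) (1, V x) * jacobian V t x" for t x
  have Vc: "continuous_on S V" for S using Ck_on_continuous[OF V] continuous_on_subset by blast
  have mc: "continuous_on S (\<lambda>p. (fst p, move V (fst p) (snd p)))" for S :: "(real \<times> (real^2)) set"
    unfolding move_def by (intro continuous_intros continuous_on_compose2[OF Vc[of UNIV]]) auto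
  have mM: "(\<lambda>p. (fst p, move V (fst p) (snd p))) ` ({-a..a} \<times> ?K) \<subseteq> M"
    using a(3) by (auto simp: abs_le_iff)
  have fc: "continuous_on ({-a..a} \<times> ?K) (\<lambda>p. f (fst p, move V (fst p) (snd p)))"
    by (rule continuous_on_compose2[OF Ck_on_continuous[OF f] mc mM])
  have "((\<lambda>t. integral \<Omega> (F t)) has_real_derivative integral \<Omega> (F' 0)) (at 0)"
  proof (rule has_derivative_integral_parameter[OF K closure_subset lmeasurable_open[OF C1_domainD(2,1)[OF dom]] a(1)])
    show "((\<lambda>t. F t x) has_real_derivative F' t x) (at t)" if "\<bar>t\<bar> \<le> a" "x \<in> ?K" for t x
      unfolding F_def F'_def
      using DERIV_mult'[OF derivative_along_displacement[OF f a(3)[OF that], folded has_real_derivative_iff_has_vector_derivative] dJ[where t = t and x = x]]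
      by (simp add: D_def)
    show "continuous_on ({-a..a} \<times> ?K) (\<lambda>(t, x). F' t x)"
      unfolding F'_def case_prod_unfold J J'_def D_def
      by (intro continuous_intros fc vc2 continuous_on_frechet_derivative[OF f mc mM] continuous_on_compose2[OF Vc[of UNIV]]) auto
    show "continuous_on ?K (F t)" if "\<bar>t\<bar> \<le> a" for t
    proof -
      have "continuous_on ?K (\<lambda>x. f (t, move V t x))"
      proof -
        have c: "continuous_on ?K (\<lambda>x. (t, x))" by (intro continuous_intros)
        have "(\<lambda>x. (t, x)) ` ?K \<subseteq> {-a..a} \<times> ?K" using that by (auto simp: abs_le_iff)
        from continuous_on_compose2[OF fc c this] show ?thesis by simp
      qed
      then show ?thesis unfolding F_def J by (intro continuous_intros vc)
    qed
  qed
  moreover have "\<forall>\<^sub>F t in nhds 0. integral (move V t ` \<Omega>) (\<lambda>x. f (t, x)) = integral \<Omega> (F t)"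
  proof -
    have "\<forall>\<^sub>F t in nhds 0. t \<in> {-a<..<a}" by (rule eventually_nhds_in_open) (use a(1) in auto)
    then show ?thesis
    proof eventually_elim
      case (elim t)
      then have t: "\<bar>t\<bar> \<le> a" by auto
      interpret displacement V L t by (rule a(2)[OF t])
      have "continuous_on (move V t ` ?K) (\<lambda>x. f (t, x))"
        by (rule continuous_on_compose2[OF Ck_on_continuous[OF f], where f = "\<lambda>x. (t, x)"]) (use a(3)[OF t] in \<open>auto intro!: continuous_intros\<close>)
      from integral_moved[OF dom this] show ?case by (simp add: F_def[abs_def])
    qed
  qed
  ultimately have main: "((\<lambda>t. integral (move V t ` \<Omega>) (\<lambda>x. f (t, x))) has_real_derivative integral \<Omega> (F' 0)) (at 0)"
    by (subst DERIV_cong_ev[OF refl _ refl]) auto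
  define N where "N = {x. (0, x) \<in> M}"
  define P where "P x = f (0, x) *\<^sub>R V x" for x
  have N: "open N" "?K \<subseteq> N" using time_slice(1)[OF M(1) f] M(2) by (auto simp: N_def)
  have f0: "Ck_on (Suc 0) (\<lambda>x. f (0, x)) N" unfolding N_def by (rule time_slice(2)[OF M(1) f])
  have P: "Ck_on (Suc 0) P N" unfolding P_def[abs_def]
    by (intro Ck_on_scaleR N f0 Ck_on_subset[OF V]) auto
  have divP: "divergence P x = D (0, x) (0, V x) + f (0, x) * (v 1 1 x + v 2 2 x)" if x: "x \<in> N" for x
  proof -
    have xM: "(0, x) \<in> M" using x by (simp add: N_def)
    have "pd k (\<lambda>y. P y $ k) x = f (0, x) * v k k x + D (0, x) (0, axis k 1) * V x $ k" for k
    proof -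
      have "((\<lambda>x. V x $ k) has_derivative (\<lambda>h. frechet_derivative V (at x) h $ k)) (at x)"
        by (rule bounded_linear.has_derivative[OF bounded_linear_vec_nth Ck_on_has_derivative[OF V]]) simp
      from has_derivative_mult[OF time_slice_derivative(2)[OF f xM] this]
      show ?thesis by (simp add: pd_def P_def frechet_derivative_eqI v_def D_def)
    qed
    moreover have "D (0, x) (0, V x) = V x $ 1 * D (0, x) (0, axis 1 1) + V x $ 2 * D (0, x) (0, axis 2 1)"
    proof -
      have lin: "linear (\<lambda>h. D (0, x) (0, h))"
        using has_derivative_linear[OF time_slice_derivative(2)[OF f xM]] by (simp add: D_def)
      show ?thesis using linear_cart2_expansion[OF lin, of "V x"] by simp
    qed
    ultimately show ?thesis by (simp add: divergence_def UNIV_2 algebra_simps)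
  qed
  have F'0: "F' 0 x = D (0, x) (1, 0) + divergence P x" if "x \<in> \<Omega>" for x
  proof -
    have x: "x \<in> N" "(0, x) \<in> M" using that N(2) closure_subset[of \<Omega>] by (auto simp: N_def)
    have lin: "linear (D (0, x))" unfolding D_def by (rule has_derivative_linear[OF Ck_on_has_derivative[OF f x(2)]])
    have "D (0, x) (1, V x) = D (0, x) (1, 0) + D (0, x) (0, V x)"
      using linear_add[OF lin, of "(1, 0)" "(0, V x)"] by simp
    then show ?thesis by (simp add: divP[OF x(1)] F'_def J J'_def move_def algebra_simps)
  qed
  have D10: "(\<lambda>x. D (0, x) (1, 0)) integrable_on \<Omega>"
    unfolding D_def
    by (intro C1_domain_integrable[OF dom] continuous_on_frechet_derivative[OF f] continuous_intros) (use M(2) in auto)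
  have "continuous_on ?K (divergence P)"
    unfolding divergence_def[abs_def] pd_def using Ck_on_frechet_derivative[OF Ck_on_vec_nth[OF N(1) P]] N(2)
    by (intro continuous_intros) (auto intro: continuous_on_subset)
  then have dP: "divergence P integrable_on \<Omega>" by (rule C1_domain_integrable[OF dom])
  have "integral \<Omega> (F' 0) = integral \<Omega> (\<lambda>x. D (0, x) (1, 0) + divergence P x)"
    by (rule integral_cong) (rule F'0)
  also have "\<dots> = integral \<Omega> (\<lambda>x. D (0, x) (1, 0)) + integral \<Omega> (divergence P)"
    by (rule integral_add[OF D10 dP])
  also have "integral \<Omega> (divergence P) = bd_integral \<C> (frontier \<Omega>) (\<lambda>x. outer_normal \<Omega> x \<bullet> P x)"
    by (rule divergence_theorem[OF dom N P])
  finally show ?thesis using main by (simp add: D_def P_def)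
qed

text \<open>The left side is an alternating bilinear form in \<open>a\<close> and \<open>b\<close>, hence in the plane a multiple of
  \<open>perp b \<bullet> a\<close>, and the factor is the trace of \<open>A\<close>.\<close>

lemma trace_identity:
  fixes A :: "real^2 \<Rightarrow> real^2"
  assumes "linear A"
  shows "perp b \<bullet> A a - perp a \<bullet> A b = (A (axis 1 1) $ 1 + A (axis 2 1) $ 2) * (perp b \<bullet> a)"
proof -
  show ?thesis unfolding linear_cart2_expansion[OF assms, of a] linear_cart2_expansion[OF assms, of b]
    by (simp add: perp_inner algebra_simps)
qed

text \<open>With \<open>w = \<gamma>'\<close>, the derivative of the integrand at \<open>t = 0\<close> is, up to orientation,
  \<open>perp w \<bullet> (W' + DW V) + perp (DV w) \<bullet> W\<close>. Subtracting the derivative along the curve of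
  \<open>perp V \<bullet> W\<close>, whose integral over the closed curve is zero, leaves
  \<open>perp w \<bullet> W' + perp w \<bullet> DW V - perp V \<bullet> DW w\<close>, and the last two terms combine to
  \<open>(\<nabla> \<cdot> W) (perp w \<bullet> V)\<close> by the trace identity. Only one derivative of \<open>W\<close> is involved.\<close>

theorem derivative_of_boundary_flux:
  fixes W :: "real \<times> (real^2) \<Rightarrow> real^2" and V :: "real^2 \<Rightarrow> real^2"
  assumes dom: "C1_domain \<Omega> \<C>" and V: "Ck_on (Suc 0) V UNIV" and KV: "compact KV" "\<And>x. x \<notin> KV \<Longrightarrow> V x = 0"
    and M: "open M" "{0} \<times> closure \<Omega> \<subseteq> M" and W: "Ck_on (Suc 0) W M"
  shows "((\<lambda>t. bd_integral (moved_curves V t \<C>) (frontier (move V t ` \<Omega>)) (\<lambda>x. outer_normal (move V t ` \<Omega>) x \<bullet> W (t, x)))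
      has_real_derivative
      bd_integral \<C> (frontier \<Omega>) (\<lambda>x. outer_normal \<Omega> x \<bullet>
        (frechet_derivative W (at (0, x)) (1, 0) + divergence (\<lambda>y. W (0, y)) x *\<^sub>R V x))) (at 0)"
proof -
  define D where "D = (\<lambda>p. frechet_derivative W (at p))"
  define DV where "DV = (\<lambda>x. frechet_derivative V (at x))"
  obtain L a1 where a1: "a1 > 0" "\<And>t. \<bar>t\<bar> \<le> a1 \<Longrightarrow> displacement V L t"
    using small_displacements[OF V KV] by metis
  obtain a2 where a2: "a2 > 0" "\<And>t x. \<bar>t\<bar> \<le> a2 \<Longrightarrow> x \<in> closure \<Omega> \<Longrightarrow> (t, move V t x) \<in> M"
    using joint_tube[OF Ck_on_continuous[OF V] M C1_domainD(5)[OF dom]] by metis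
  define a where "a = min a1 a2"
  have a: "a > 0" "\<And>t. \<bar>t\<bar> \<le> a \<Longrightarrow> displacement V L t" "\<And>t x. \<bar>t\<bar> \<le> a \<Longrightarrow> x \<in> closure \<Omega> \<Longrightarrow> (t, move V t x) \<in> M"
    using a1 a2 by (auto simp: a_def)
  have Vc: "continuous_on S V" for S using Ck_on_continuous[OF V] continuous_on_subset by blast
  have linDV: "linear (DV x)" for x unfolding DV_def by (rule has_derivative_linear[OF Ck_on_has_derivative[OF V]]) simp
  define F where "F \<gamma> t s = orientation \<Omega> \<gamma> * (perp (vector_derivative \<gamma> (at s) + t *\<^sub>R DV (\<gamma> s) (vector_derivative \<gamma> (at s))) \<bullet> W (t, move V t (\<gamma> s)))" for \<gamma> t s
  define F' where "F' \<gamma> t s = orientation \<Omega> \<gamma> *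
     (perp (vector_derivative \<gamma> (at s) + t *\<^sub>R DV (\<gamma> s) (vector_derivative \<gamma> (at s))) \<bullet> D (t, move V t (\<gamma> s)) (1, V (\<gamma> s)) +
      perp (DV (\<gamma> s) (vector_derivative \<gamma> (at s))) \<bullet> W (t, move V t (\<gamma> s)))" for \<gamma> t s
  have curve: "((\<lambda>t. integral {0..1} (F \<gamma> t)) has_real_derivative integral {0..1} (F' \<gamma> 0)) (at 0)" if \<gamma>C: "\<gamma> \<in> \<C>" for \<gamma>
  proof -
    note \<gamma> = C1_domain_curveD(1)[OF dom \<gamma>C] and cl = C1_domain_curveD(4)[OF dom \<gamma>C]
    have gc: "continuous_on S (\<lambda>p. \<gamma> (snd p))" for S :: "(real \<times> real) set"
      by (rule continuous_on_compose2[OF closed_C1_curve_derivative(4)[OF \<gamma>, of UNIV]]) (auto intro: continuous_intros)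
    have wc: "continuous_on S (\<lambda>p. vector_derivative \<gamma> (at (snd p)))" for S :: "(real \<times> real) set"
      by (rule continuous_on_compose2[OF closed_C1_curve_derivative(2)[OF \<gamma>, of UNIV]]) (auto intro: continuous_intros)
    have Vgc: "continuous_on S (\<lambda>p. V (\<gamma> (snd p)))" for S :: "(real \<times> real) set"
      by (rule continuous_on_compose2[OF Vc[of UNIV] gc]) auto
    have DVc: "continuous_on S (\<lambda>p. DV (\<gamma> (snd p)) (vector_derivative \<gamma> (at (snd p))))" for S :: "(real \<times> real) set"
      unfolding DV_def by (rule continuous_on_frechet_derivative[OF V gc _ wc]) auto
    have mc: "continuous_on S (\<lambda>p. (fst p, move V (fst p) (\<gamma> (snd p))))" for S :: "(real \<times> real) set"
      unfolding move_def by (intro continuous_intros gc Vgc)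
    have mM: "(\<lambda>p. (fst p, move V (fst p) (\<gamma> (snd p)))) ` ({-a..a} \<times> {0..1}) \<subseteq> M"
      using a(3) cl by (auto simp: abs_le_iff)
    have Wc: "continuous_on ({-a..a} \<times> {0..1}) (\<lambda>p. W (fst p, move V (fst p) (\<gamma> (snd p))))"
      by (rule continuous_on_compose2[OF Ck_on_continuous[OF W] mc mM])
    have Dc: "continuous_on ({-a..a} \<times> {0..1}) (\<lambda>p. D (fst p, move V (fst p) (\<gamma> (snd p))) (1, V (\<gamma> (snd p))))"
      unfolding D_def by (intro continuous_on_frechet_derivative[OF W mc mM] continuous_intros Vgc)
    note pc = bounded_linear.continuous_on[OF bounded_linear_perp]
    show ?thesis
    proof (rule has_derivative_integral_parameter[OF _ subset_refl _ a(1)])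
      show "((\<lambda>t. F \<gamma> t s) has_real_derivative F' \<gamma> t s) (at t)" if "\<bar>t\<bar> \<le> a" "s \<in> {0..1}" for t s
      proof -
        let ?w = "vector_derivative \<gamma> (at s)"
        have 1: "((\<lambda>t. W (t, move V t (\<gamma> s))) has_derivative (\<lambda>h. h *\<^sub>R D (t, move V t (\<gamma> s)) (1, V (\<gamma> s)))) (at t)"
          using derivative_along_displacement[OF W a(3)[OF that(1) cl]] unfolding has_vector_derivative_def D_def .
        have "((\<lambda>t. ?w + t *\<^sub>R DV (\<gamma> s) ?w) has_derivative (\<lambda>h. h *\<^sub>R DV (\<gamma> s) ?w)) (at t)"
          by (auto intro!: derivative_eq_intros)
        from bounded_linear.has_derivative[OF bounded_linear_perp this]
        have 2: "((\<lambda>t. perp (?w + t *\<^sub>R DV (\<gamma> s) ?w)) has_derivative (\<lambda>h. h *\<^sub>R perp (DV (\<gamma> s) ?w))) (at t)"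
          by (simp add: linear_cmul[OF linear_perp])
        from has_derivative_mult_right[OF has_derivative_inner[OF 2 1], of "orientation \<Omega> \<gamma>"]
        show ?thesis unfolding F_def F'_def has_field_derivative_def
          by (rule has_derivative_eq_rhs) (simp add: fun_eq_iff algebra_simps)
      qed
      show "continuous_on ({-a..a} \<times> {0..1}) (\<lambda>(t, s). F' \<gamma> t s)"
        unfolding F'_def case_prod_unfold by (intro continuous_intros pc wc DVc Wc Dc)
      have "continuous_on ({-a..a} \<times> {0..1}) (\<lambda>p. F \<gamma> (fst p) (snd p))"
        unfolding F_def by (intro continuous_intros pc wc DVc Wc)
      then show "continuous_on {0..1} (F \<gamma> t)" if "\<bar>t\<bar> \<le> a" for t
      proof -
        assume F: "continuous_on ({-a..a} \<times> {0..1}) (\<lambda>p. F \<gamma> (fst p) (snd p))"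
        have c: "continuous_on {0..1} (\<lambda>s::real. (t, s))" by (intro continuous_intros)
        have "(\<lambda>s. (t, s)) ` {0..1} \<subseteq> {-a..a} \<times> {0..1}" using that by (auto simp: abs_le_iff)
        from continuous_on_compose2[OF F c this] show ?thesis by simp
      qed
    qed auto
  qed
  have "((\<lambda>t. \<Sum>\<gamma>\<in>\<C>. integral {0..1} (F \<gamma> t)) has_real_derivative (\<Sum>\<gamma>\<in>\<C>. integral {0..1} (F' \<gamma> 0))) (at 0)"
    by (rule DERIV_sum) (rule curve)
  moreover have "\<forall>\<^sub>F t in nhds 0. bd_integral (moved_curves V t \<C>) (frontier (move V t ` \<Omega>)) (\<lambda>x. outer_normal (move V t ` \<Omega>) x \<bullet> W (t, x)) =
      (\<Sum>\<gamma>\<in>\<C>. integral {0..1} (F \<gamma> t))"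
  proof -
    have "\<forall>\<^sub>F t in nhds 0. t \<in> {-a<..<a}" by (rule eventually_nhds_in_open) (use a(1) in auto)
    then show ?thesis
    proof eventually_elim
      case (elim t)
      interpret displacement V L t by (rule a(2)) (use elim in auto)
      show ?case using bd_integral_moved[OF dom, of "\<lambda>x. W (t, x)"] by (simp add: F_def[abs_def] DV_def)
    qed
  qed
  ultimately have main: "((\<lambda>t. bd_integral (moved_curves V t \<C>) (frontier (move V t ` \<Omega>)) (\<lambda>x. outer_normal (move V t ` \<Omega>) x \<bullet> W (t, x)))
      has_real_derivative (\<Sum>\<gamma>\<in>\<C>. integral {0..1} (F' \<gamma> 0))) (at 0)"
    by (subst DERIV_cong_ev[OF refl _ refl]) auto
  define Q where "Q x = D (0, x) (1, 0) + divergence (\<lambda>y. W (0, y)) x *\<^sub>R V x" for x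
  have "integral {0..1} (F' \<gamma> 0) = integral {0..1} (flux_density \<Omega> \<gamma> Q)" if \<gamma>C: "\<gamma> \<in> \<C>" for \<gamma>
  proof -
    note \<gamma> = C1_domain_curveD(1)[OF dom \<gamma>C] and cl = C1_domain_curveD(4)[OF dom \<gamma>C]
    define w where "w s = vector_derivative \<gamma> (at s)" for s
    \<comment> \<open>the derivative of \<open>perp V \<bullet> W\<close> along the curve\<close>
    define E where "E s = orientation \<Omega> \<gamma> * (perp (V (\<gamma> s)) \<bullet> D (0, \<gamma> s) (0, w s) + perp (DV (\<gamma> s) (w s)) \<bullet> W (0, \<gamma> s))" for s
    have gM: "(0, \<gamma> s) \<in> M" for s using cl M(2) by auto
    have dV: "((\<lambda>s. V (\<gamma> s)) has_derivative (\<lambda>h. h *\<^sub>R DV (\<gamma> s) (w s))) (at s within T)" for s T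
    proof -
      have "(V has_derivative DV (\<gamma> s)) (at (\<gamma> s))" unfolding DV_def by (rule Ck_on_has_derivative[OF V]) simp
      from has_derivative_compose[OF closed_C1_curve_derivative(1)[OF \<gamma>, of s T, unfolded has_vector_derivative_def] this]
      show ?thesis by (simp add: linear_cmul[OF linDV] w_def)
    qed
    have dW: "((\<lambda>s. W (0, \<gamma> s)) has_derivative (\<lambda>h. h *\<^sub>R D (0, \<gamma> s) (0, w s))) (at s within T)" for s T
    proof -
      note d = time_slice_derivative(2)[OF W gM[of s]]
      from has_derivative_compose[OF closed_C1_curve_derivative(1)[OF \<gamma>, of s T, unfolded has_vector_derivative_def] d]
      show ?thesis using linear_cmul[OF has_derivative_linear[OF d]] by (simp add: D_def w_def)
    qed
    have dE: "((\<lambda>s. orientation \<Omega> \<gamma> * (perp (V (\<gamma> s)) \<bullet> W (0, \<gamma> s))) has_vector_derivative E s) (at s within T)" for s T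
    proof -
      have "((\<lambda>s. perp (V (\<gamma> s))) has_derivative (\<lambda>h. h *\<^sub>R perp (DV (\<gamma> s) (w s)))) (at s within T)"
        using bounded_linear.has_derivative[OF bounded_linear_perp dV] by (simp add: linear_cmul[OF linear_perp])
      from has_derivative_mult_right[OF has_derivative_inner[OF this dW], of "orientation \<Omega> \<gamma>"]
      show ?thesis unfolding E_def has_vector_derivative_def
        by (rule has_derivative_eq_rhs) (simp add: fun_eq_iff algebra_simps)
    qed
    have "\<gamma> 1 = \<gamma> 0" using closed_C1_curve_periodic[OF \<gamma>, of 0 1] by simp
    then have E: "(E has_integral 0) {0..1}"
      using fundamental_theorem_of_calculus[of 0 1 "\<lambda>s. orientation \<Omega> \<gamma> * (perp (V (\<gamma> s)) \<bullet> W (0, \<gamma> s))" E] dE by simp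
    have eq: "F' \<gamma> 0 s = flux_density \<Omega> \<gamma> Q s + E s" for s
    proof -
      have lin: "linear (D (0, \<gamma> s))" unfolding D_def by (rule has_derivative_linear[OF Ck_on_has_derivative[OF W gM]])
      have split: "D (0, \<gamma> s) (1, V (\<gamma> s)) = D (0, \<gamma> s) (1, 0) + D (0, \<gamma> s) (0, V (\<gamma> s))"
        using linear_add[OF lin, of "(1, 0)" "(0, V (\<gamma> s))"] by simp
      have lin0: "linear (\<lambda>h. D (0, \<gamma> s) (0, h))"
        using has_derivative_linear[OF time_slice_derivative(2)[OF W gM]] by (simp add: D_def)
      have "pd k (\<lambda>y. W (0, y) $ k) (\<gamma> s) = D (0, \<gamma> s) (0, axis k 1) $ k" for k
        unfolding pd_def D_def
        by (simp add: frechet_derivative_eqI[OF bounded_linear.has_derivative[OF bounded_linear_vec_nth time_slice_derivative(2)[OF W gM]]])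
      then have div: "divergence (\<lambda>y. W (0, y)) (\<gamma> s) = D (0, \<gamma> s) (0, axis 1 1) $ 1 + D (0, \<gamma> s) (0, axis 2 1) $ 2"
        by (simp add: divergence_def UNIV_2)
      show ?thesis
        using trace_identity[OF lin0, of "w s" "V (\<gamma> s)"]
        by (simp add: F'_def E_def flux_density_def Q_def div split move_def w_def[symmetric] inner_add_right distrib_left
            right_diff_distrib[symmetric] eq_diff_eq[symmetric] mult.assoc[symmetric])
          (simp add: algebra_simps)
    qed
    have "continuous_on (frontier \<Omega>) Q"
    proof -
      have N: "open {x. (0, x) \<in> M}" "Ck_on (Suc 0) (\<lambda>x. W (0, x)) {x. (0, x) \<in> M}" by (rule time_slice[OF M(1) W])+
      have sub: "frontier \<Omega> \<subseteq> {x. (0, x) \<in> M}" using M(2) C1_domainD(8)[OF dom] by auto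
      have "continuous_on (frontier \<Omega>) (\<lambda>x. frechet_derivative (\<lambda>y. W (0, y) $ k) (at x) (axis k 1))" for k
        by (rule continuous_on_subset[OF Ck_on_continuous[OF Ck_on_frechet_derivative[OF Ck_on_vec_nth[OF N]]] sub])
      then have "continuous_on (frontier \<Omega>) (divergence (\<lambda>y. W (0, y)))"
        unfolding divergence_def[abs_def] pd_def by (intro continuous_on_sum)
      moreover have "continuous_on (frontier \<Omega>) (\<lambda>x. D (0, x) (1, 0))"
        unfolding D_def by (intro continuous_on_frechet_derivative[OF W] continuous_intros)
          (use M(2) C1_domainD(8)[OF dom] in auto)
      ultimately show ?thesis unfolding Q_def by (intro continuous_intros Vc)
    qed
    then have "flux_density \<Omega> \<gamma> Q integrable_on {0..1}"
      by (intro integrable_continuous_interval flux_density_continuous[OF dom \<gamma>C])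
    then have "integral {0..1} (\<lambda>s. flux_density \<Omega> \<gamma> Q s + E s) = integral {0..1} (flux_density \<Omega> \<gamma> Q)"
      using E by (subst integral_add) (auto simp: has_integral_iff)
    then show ?thesis by (simp add: eq[abs_def])
  qed
  then have "(\<Sum>\<gamma>\<in>\<C>. integral {0..1} (F' \<gamma> 0)) = bd_integral \<C> (frontier \<Omega>) (\<lambda>x. outer_normal \<Omega> x \<bullet> Q x)"
    by (simp add: bd_integral_normal[OF dom])
  then show ?thesis using main by (simp add: Q_def D_def)
qed

section \<open>Regularity and linearization of the fluxes\<close>

lemma Ck_on_transform:
  assumes "open S" "Ck_on k f S" "\<And>x. x \<in> S \<Longrightarrow> f x = g x"
  shows "Ck_on k g S"
  using Ck_on_cong[OF assms(1), of f g k] assms(2,3) by blast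

lemma Ck_on_frechet_derivative_apply:
  fixes f :: "'a::euclidean_space \<Rightarrow> 'b::real_normed_vector"
  assumes S: "open S" and T: "open T" and f: "Ck_on (Suc k) f S" and p: "Ck_on k p T" "p ` T \<subseteq> S" and q: "Ck_on k q T"
  shows "Ck_on k (\<lambda>z. frechet_derivative f (at (p z)) (q z)) T"
proof -
  have "Ck_on k (\<lambda>z. \<Sum>b\<in>Basis. (q z \<bullet> b) *\<^sub>R frechet_derivative f (at (p z)) b) T"
    by (intro Ck_on_sum Ck_on_scaleR Ck_on_inner Ck_on_const T q Ck_on_compose[OF T S p(2,1) Ck_on_frechet_derivative[OF f]])
  moreover have "(\<Sum>b\<in>Basis. (q z \<bullet> b) *\<^sub>R frechet_derivative f (at (p z)) b) = frechet_derivative f (at (p z)) (q z)"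
    if "z \<in> T" for z
    by (rule linear_basis_expansion[OF has_derivative_linear[OF Ck_on_has_derivative[OF f]], symmetric]) (use p(2) that in blast)
  ultimately show ?thesis by (rule Ck_on_transform[OF T])
qed

lemma Ck_on_vector2:
  fixes f1 f2 :: "'a::real_normed_vector \<Rightarrow> 'b::real_normed_vector"
  assumes "open S" "Ck_on k f1 S" "Ck_on k f2 S"
  shows "Ck_on k (\<lambda>x. vector [f1 x, f2 x] :: 'b^2) S"
proof -
  have "(\<lambda>x. vector [f1 x, f2 x] :: 'b^2) = (\<lambda>x. \<chi> i. (if i = 1 then f1 else f2) x)"
    by (simp add: fun_eq_iff vec_eq_iff forall_2)
  then show ?thesis using assms by (simp only:) (intro Ck_on_vec_lambda, auto)
qed

lemma vector_4 [simp]: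
  fixes a b c d :: "'b::zero"
  shows "(vector [a, b, c, d] :: 'b^4) $ 1 = a" "(vector [a, b, c, d] :: 'b^4) $ 2 = b"
    "(vector [a, b, c, d] :: 'b^4) $ 3 = c" "(vector [a, b, c, d] :: 'b^4) $ 4 = d"
  by (simp_all add: vector_def)

lemma Ck_on_vector4:
  fixes f1 f2 f3 f4 :: "'a::real_normed_vector \<Rightarrow> real"
  assumes "open S" "Ck_on k f1 S" "Ck_on k f2 S" "Ck_on k f3 S" "Ck_on k f4 S"
  shows "Ck_on k (\<lambda>x. vector [f1 x, f2 x, f3 x, f4 x] :: real^4) S"
proof -
  have "(\<lambda>x. vector [f1 x, f2 x, f3 x, f4 x] :: real^4) =
      (\<lambda>x. \<chi> i. (if i = 1 then f1 else if i = 2 then f2 else if i = 3 then f3 else f4) x)"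
    by (simp add: fun_eq_iff vec_eq_iff forall_4)
  then show ?thesis using assms by (simp only:) (intro Ck_on_vec_lambda, auto)
qed

definition positive_density :: "(real^4) set" where
  "positive_density = {w. w $ 1 > 0}"

text \<open>An open set on which the fluxes are of class \<open>C\<^sup>1\<close>: velocities divide by the density, and the
  transport coefficients are regular for positive temperatures.\<close>

definition physical_states :: "gas \<Rightarrow> (real^4) set" where
  "physical_states g = {w. density w > 0 \<and> temperature g w > 0}"

lemma open_positive_density: "open positive_density"
  unfolding positive_density_def by (intro open_Collect_less continuous_intros)

lemma Ck_on_component: "Ck_on k (\<lambda>w::real^4. w $ i) S"
  by (rule Ck_on_linear[OF bounded_linear_vec_nth])

lemma Ck_on_velocity: "Ck_on k velocity positive_density"
  unfolding velocity_def[abs_def]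
  by (intro Ck_on_vector2 Ck_on_divide open_positive_density Ck_on_component) (simp_all add: positive_density_def)

lemma Ck_on_energy: "Ck_on k energy positive_density"
  unfolding energy_def[abs_def]
  by (intro Ck_on_divide open_positive_density Ck_on_component) (simp_all add: positive_density_def)

lemma Ck_on_temperature: "Ck_on k (temperature g) positive_density"
proof -
  have "Ck_on k (\<lambda>w. (energy w - (velocity w \<bullet> velocity w) * (1/2)) * (1 / gas_cv g)) positive_density"
    by (intro Ck_on_mult Ck_on_diff Ck_on_inner Ck_on_velocity Ck_on_energy Ck_on_const open_positive_density)
  then show ?thesis unfolding temperature_def[abs_def] by (simp add: power2_norm_eq_inner)
qed

lemma Ck_on_pressure: "Ck_on k (pressure g) positive_density"
  unfolding pressure_def[abs_def] density_def
  by (intro Ck_on_mult Ck_on_component Ck_on_const Ck_on_temperature open_positive_density)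

lemma Ck_on_enthalpy: "Ck_on k (enthalpy g) positive_density"
  unfolding enthalpy_def[abs_def] density_def
  by (intro Ck_on_add Ck_on_divide Ck_on_component Ck_on_pressure Ck_on_energy open_positive_density)
    (simp add: positive_density_def)

lemma Ck_on_Fc: "Ck_on k (Fc g) positive_density"
  unfolding Fc_def[abs_def] Let_def density_def power2_eq_square
  by (intro Ck_on_vector2 Ck_on_vector4 Ck_on_add Ck_on_mult Ck_on_component Ck_on_pressure Ck_on_enthalpy
      Ck_on_vec_nth[OF open_positive_density Ck_on_velocity] open_positive_density)

lemma physical_states_subset: "physical_states g \<subseteq> positive_density"
  by (auto simp: physical_states_def positive_density_def density_def)

lemma open_physical_states: "open (physical_states g)"
proof -
  have "open (positive_density \<inter> temperature g -` {0<..})"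
    by (rule continuous_open_preimage[OF Ck_on_continuous[OF Ck_on_temperature] open_positive_density]) simp
  moreover have "positive_density \<inter> temperature g -` {0<..} = physical_states g"
    by (auto simp: physical_states_def positive_density_def density_def)
  ultimately show ?thesis by simp
qed

text \<open>Velocity and temperature are rational functions of the state, so their derivatives are still smooth;
  the transport coefficients limit the regularity to \<open>C\<^sup>1\<close>.\<close>

lemma Ck_on_Fv:
  assumes "gas_ok g"
  shows "Ck_on (Suc 0) (\<lambda>p. Fv g (fst p) (snd p)) (physical_states g \<times> UNIV)"
proof -
  let ?S = "physical_states g \<times> (UNIV :: (real^4^2) set)"
  have S: "open ?S" by (intro open_Times open_physical_states open_UNIV)
  have fst: "Ck_on k fst ?S" "fst ` ?S \<subseteq> positive_density" for k
    using Ck_on_fst physical_states_subset by auto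
  have q: "Ck_on k (\<lambda>p. snd p $ l) ?S" for k l by (rule Ck_on_vec_nth[OF S Ck_on_snd])
  have vp: "Ck_on (Suc 0) (\<lambda>p. velocity_pd (fst p) (snd p) l $ i) ?S" for l i
    unfolding velocity_pd_def
    by (intro Ck_on_vec_nth S Ck_on_frechet_derivative_apply[OF open_positive_density S Ck_on_velocity fst q])
  have tp: "Ck_on (Suc 0) (\<lambda>p. temperature_pd g (fst p) (snd p) l) ?S" for l
    unfolding temperature_pd_def
    by (intro Ck_on_frechet_derivative_apply[OF open_positive_density S Ck_on_temperature fst q])
  have T: "Ck_on (Suc 0) (\<lambda>p. temperature g (fst p)) ?S"
    by (rule Ck_on_compose[OF S open_positive_density fst(2,1) Ck_on_temperature])
  have img: "(\<lambda>p. temperature g (fst p)) ` ?S \<subseteq> {0<..}" by (auto simp: physical_states_def)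
  have coeff: "Ck_on (Suc 0) (\<lambda>p. gas_mu g (temperature g (fst p))) ?S" "Ck_on (Suc 0) (\<lambda>p. gas_kappa g (temperature g (fst p))) ?S"
    by (rule Ck_on_compose[OF S open_greaterThan img T]; use assms in \<open>simp add: gas_ok_def\<close>)+
  have v: "Ck_on (Suc 0) (\<lambda>p. velocity (fst p) $ j) ?S" for j
    by (intro Ck_on_vec_nth S Ck_on_compose[OF S open_positive_density fst(2,1) Ck_on_velocity])
  have st: "Ck_on (Suc 0) (\<lambda>p. stress g (fst p) (snd p) $ i $ j) ?S" for i j
  proof -
    have "Ck_on (Suc 0) (\<lambda>p. 2 / 3 * (\<Sum>l\<in>UNIV. velocity_pd (fst p) (snd p) l $ l)) ?S"
      by (intro Ck_on_mult Ck_on_sum S vp Ck_on_const)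
    then have "Ck_on (Suc 0) (\<lambda>p. if i = j then 2 / 3 * (\<Sum>l\<in>UNIV. velocity_pd (fst p) (snd p) l $ l) else 0) ?S"
      by (cases "i = j") (simp_all only: if_True if_False Ck_on_const simp_thms)
    then show ?thesis unfolding stress_def vec_lambda_beta
      by (intro Ck_on_mult Ck_on_diff Ck_on_add S coeff vp)
  qed
  show ?thesis unfolding Fv_def
    by (intro Ck_on_vec_lambda Ck_on_vector4 Ck_on_add Ck_on_sum Ck_on_mult Ck_on_const S st v coeff tp)
qed

text \<open>The flux as a function of the state and its gradient, taken as independent variables.\<close>

definition total_flux :: "gas \<Rightarrow> (real^4) \<times> (real^4^2) \<Rightarrow> real^4^2" where
  "total_flux g p = Fc g (fst p) - Fv g (fst p) (snd p)"

lemma Ck_on_total_flux: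
  assumes "gas_ok g"
  shows "Ck_on (Suc 0) (total_flux g) (physical_states g \<times> UNIV)"
proof -
  have S: "open (physical_states g \<times> (UNIV :: (real^4^2) set))" by (intro open_Times open_physical_states open_UNIV)
  show ?thesis unfolding total_flux_def[abs_def]
    by (intro Ck_on_diff S Ck_on_Fv[OF assms] Ck_on_compose[OF S open_positive_density _ Ck_on_fst Ck_on_Fc])
      (use physical_states_subset in auto)
qed

lemma linear_Fv:
  assumes w: "w \<in> positive_density"
  shows "linear (Fv g w)"
proof -
  have dv: "linear (frechet_derivative velocity (at w))"
    by (rule has_derivative_linear[OF Ck_on_has_derivative[OF Ck_on_velocity w]])
  have dT: "linear (frechet_derivative (temperature g) (at w))"
    by (rule has_derivative_linear[OF Ck_on_has_derivative[OF Ck_on_temperature w]])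
  show ?thesis
    by (rule linearI)
      (auto simp: Fv_def stress_def velocity_pd_def temperature_pd_def vec_eq_iff forall_4 linear_add[OF dv] linear_cmul[OF dv]
        linear_add[OF dT] linear_cmul[OF dT] UNIV_2 algebra_simps)
qed

lemma linear_Fv_nth: "w \<in> positive_density \<Longrightarrow> linear (\<lambda>q. Fv g w q $ k)"
  by (rule linearI) (simp_all add: linear_add[OF linear_Fv] linear_cmul[OF linear_Fv])

lemma matrix_linear: "linear f \<Longrightarrow> matrix f *v x = f x" for f :: "real^'n \<Rightarrow> real^'m"
  by (simp add: matrix_works)

text \<open>The viscous flux is linear in the gradient, so its derivative with respect to the gradient is the flux
  itself and depends on the state only. In particular the blocks \<open>G\<close> are as regular as \<open>Fv\<close> is in
  the state.\<close>

lemma G_mult: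
  assumes w: "w \<in> positive_density"
  shows "G g w q k l *v h = Fv g w (axis l h) $ k"
proof -
  have "frechet_derivative (\<lambda>q. Fv g w q $ k) (at q) = (\<lambda>q. Fv g w q $ k)"
    by (rule frechet_derivative_eqI[OF bounded_linear_imp_has_derivative])
      (use linear_Fv_nth[OF w] in \<open>simp add: linear_conv_bounded_linear\<close>)
  then have "G g w q k l = matrix (\<lambda>h. Fv g w (axis l h) $ k)" by (simp add: G_def)
  moreover have "linear (axis l :: real^4 \<Rightarrow> real^4^2)"
    by (rule linearI) (auto simp: axis_def vec_eq_iff)
  then have "linear (\<lambda>h. Fv g w (axis l h) $ k)"
    using linear_compose[OF _ linear_Fv_nth[OF w], of "axis l"] by (simp add: o_def)
  ultimately show ?thesis by (simp add: matrix_works)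
qed

lemma sum_G_mult:
  assumes w: "w \<in> positive_density"
  shows "(\<Sum>l\<in>UNIV. G g w q k l *v (r $ l)) = Fv g w r $ k"
proof -
  have r: "r = (\<Sum>l\<in>UNIV. axis l (r $ l))" by (simp add: vec_eq_iff axis_def)
  show ?thesis unfolding G_mult[OF w] by (subst (2) r) (simp add: linear_sum[OF linear_Fv[OF w]])
qed

lemma G_nth:
  assumes w: "w \<in> positive_density"
  shows "G g w q k l $ i $ j = Fv g w (axis l (axis j 1)) $ k $ i"
  unfolding G_mult[OF w, of g q, symmetric] by (simp add: matrix_vector_mult_basis column_def)

text \<open>The derivative is the sum of the partial ones, in the state at fixed gradient and in the gradient at
  fixed state.\<close>

lemma total_flux_derivative:
  assumes g: "gas_ok g" and w: "w \<in> physical_states g"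
  shows "frechet_derivative (total_flux g) (at (w, q)) (a, b) $ k =
    (Fc_u g w k - Fv_u g w q k) *v a - (\<Sum>l\<in>UNIV. G g w q k l *v (b $ l))"
proof -
  let ?D = "frechet_derivative (total_flux g) (at (w, q))"
  have w': "w \<in> positive_density" using w physical_states_subset by blast
  have d: "(total_flux g has_derivative ?D) (at (w, q))"
    by (rule Ck_on_has_derivative[OF Ck_on_total_flux[OF g]]) (use w in simp)
  have pair1: "((\<lambda>w. (w, q)) has_derivative (\<lambda>h. (h, 0))) (at w)" by (auto intro!: derivative_eq_intros)
  have pair2: "((\<lambda>q. (w, q)) has_derivative (\<lambda>h. (0, h))) (at q)" by (auto intro!: derivative_eq_intros)
  note nth = bounded_linear.has_derivative[OF bounded_linear_vec_nth]
  have 1: "((\<lambda>w. total_flux g (w, q) $ k) has_derivative (\<lambda>h. ?D (h, 0) $ k)) (at w)"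
    by (rule nth[OF has_derivative_compose[OF pair1 d]])
  have c: "((\<lambda>w. Fc g w $ k) has_derivative frechet_derivative (\<lambda>w. Fc g w $ k) (at w)) (at w)"
    by (rule Ck_on_has_derivative[OF Ck_on_vec_nth[OF open_positive_density Ck_on_Fc] w'])
  have "((\<lambda>p. Fv g (fst p) (snd p)) has_derivative frechet_derivative (\<lambda>p. Fv g (fst p) (snd p)) (at (w, q))) (at (w, q))"
    by (rule Ck_on_has_derivative[OF Ck_on_Fv[OF g]]) (use w in simp)
  from nth[OF has_derivative_compose[OF pair1 this], of k] have "(\<lambda>w. Fv g w q $ k) differentiable at w"
    by (auto simp: differentiable_def)
  then have f: "((\<lambda>w. Fv g w q $ k) has_derivative frechet_derivative (\<lambda>w. Fv g w q $ k) (at w)) (at w)"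
    by (simp add: frechet_derivative_works)
  have "((\<lambda>w. total_flux g (w, q) $ k) has_derivative (\<lambda>h. Fc_u g w k *v h - Fv_u g w q k *v h)) (at w)"
    using has_derivative_diff[OF c f]
    by (simp add: total_flux_def Fc_u_def Fv_u_def matrix_linear[OF has_derivative_linear[OF c]] matrix_linear[OF has_derivative_linear[OF f]])
  from has_derivative_unique[OF 1 this] have A: "?D (a, 0) $ k = Fc_u g w k *v a - Fv_u g w q k *v a" by (rule fun_cong)
  have 2: "((\<lambda>q. total_flux g (w, q) $ k) has_derivative (\<lambda>h. ?D (0, h) $ k)) (at q)"
    by (rule nth[OF has_derivative_compose[OF pair2 d]])
  have "((\<lambda>q. Fv g w q $ k) has_derivative (\<lambda>q. Fv g w q $ k)) (at q)"
    by (rule bounded_linear_imp_has_derivative) (use linear_Fv_nth[OF w'] in \<open>simp add: linear_conv_bounded_linear\<close>)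
  from has_derivative_diff[OF has_derivative_const[of "Fc g w $ k"] this]
  have "((\<lambda>q. total_flux g (w, q) $ k) has_derivative (\<lambda>h. - (Fv g w h $ k))) (at q)"
    by (simp add: total_flux_def)
  from has_derivative_unique[OF 2 this] have B: "?D (0, b) $ k = - (Fv g w b $ k)" by (rule fun_cong)
  have "?D (a, b) = ?D (a, 0) + ?D (0, b)"
    using linear_add[OF has_derivative_linear[OF d], of "(a, 0)" "(0, b)"] by simp
  then show ?thesis using A B by (simp add: sum_G_mult[OF w'] matrix_vector_mult_diff_rdistrib)
qed

text \<open>Families are treated as functions \<open>U\<close> of \<open>(t, x)\<close>, so that derivatives in \<open>t\<close> and in \<open>x\<close> are
  directional derivatives of the same map.\<close>

lemma grad_time_slice:
  fixes U :: "real \<times> (real^2) \<Rightarrow> real^4"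
  assumes "Ck_on (Suc 0) U N" "(t, x) \<in> N"
  shows "grad (\<lambda>x. U (t, x)) x = (\<chi> k. frechet_derivative U (at (t, x)) (0, axis k 1))"
  unfolding grad_def pd_def by (simp add: time_slice_derivative(1)[OF assms])

lemma family_grad_C1:
  fixes U :: "real \<times> (real^2) \<Rightarrow> real^4"
  assumes N: "open N" and U: "Ck_on 2 U N"
  shows "Ck_on (Suc 0) (\<lambda>p. grad (\<lambda>x. U (fst p, x)) (snd p)) N"
proof -
  have U2: "Ck_on (Suc (Suc 0)) U N" using U by (simp only: numeral_2_eq_2)
  have "Ck_on (Suc 0) (\<lambda>p. \<chi> k. frechet_derivative U (at p) (0, axis k 1)) N"
    by (intro Ck_on_vec_lambda N Ck_on_frechet_derivative[OF U2])
  then show ?thesis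
    by (rule Ck_on_transform[OF N]) (simp add: grad_time_slice[OF Ck_on_SucD[OF U2]])
qed

lemma family_local_derivative:
  fixes U :: "real \<times> (real^2) \<Rightarrow> 'b::real_normed_vector"
  assumes "Ck_on (Suc 0) U N" "(0, x) \<in> N"
  shows "local_derivative (\<lambda>t x. U (t, x)) x = frechet_derivative U (at (0, x)) (1, 0)"
  unfolding local_derivative_def by (rule vector_derivative_at[OF time_slice_derivative(3)[OF assms]])

lemma family_local_derivative_C1:
  fixes U :: "real \<times> (real^2) \<Rightarrow> 'b::real_normed_vector"
  assumes N: "open N" and U: "Ck_on 2 U N"
  shows "Ck_on (Suc 0) (local_derivative (\<lambda>t x. U (t, x))) {x. (0, x) \<in> N}"
proof -
  have U2: "Ck_on (Suc (Suc 0)) U N" using U by (simp only: numeral_2_eq_2)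
  note s = time_slice[OF N Ck_on_frechet_derivative[OF U2, of "(1, 0)"], of 0]
  show ?thesis
    by (rule Ck_on_transform[OF s]) (simp add: family_local_derivative[OF Ck_on_SucD[OF U2]])
qed

text \<open>The local derivative of the gradient is the gradient of the local derivative: this is where second
  derivatives have to commute.\<close>

lemma family_grad_local_derivative:
  fixes U :: "real \<times> (real^2) \<Rightarrow> real^4"
  assumes N: "open N" and U: "Ck_on 2 U N" and x: "(0, x) \<in> N"
  shows "frechet_derivative (\<lambda>p. grad (\<lambda>x. U (fst p, x)) (snd p)) (at (0, x)) (1, 0) = grad (local_derivative (\<lambda>t x. U (t, x))) x"
proof -
  have U2: "Ck_on (Suc (Suc 0)) U N" using U by (simp only: numeral_2_eq_2)
  note U1 = Ck_on_SucD[OF U2]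
  let ?D = "\<lambda>h p. frechet_derivative U (at p) h"
  have D1: "Ck_on (Suc 0) (?D h) N" for h by (rule Ck_on_frechet_derivative[OF U2])
  have "frechet_derivative (\<lambda>p. grad (\<lambda>x. U (fst p, x)) (snd p)) (at (0, x)) (1, 0) $ k = grad (local_derivative (\<lambda>t x. U (t, x))) x $ k" for k
  proof -
    have "((\<lambda>p. grad (\<lambda>x. U (fst p, x)) (snd p) $ k) has_derivative
        (\<lambda>h. frechet_derivative (\<lambda>p. grad (\<lambda>x. U (fst p, x)) (snd p)) (at (0, x)) h $ k)) (at (0, x))"
      by (intro bounded_linear.has_derivative[OF bounded_linear_vec_nth] Ck_on_has_derivative[OF family_grad_C1[OF N U] x])
    then have "frechet_derivative (\<lambda>p. grad (\<lambda>x. U (fst p, x)) (snd p)) (at (0, x)) (1, 0) $ k =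
        frechet_derivative (\<lambda>p. grad (\<lambda>x. U (fst p, x)) (snd p) $ k) (at (0, x)) (1, 0)"
      by (simp add: frechet_derivative_eqI)
    also have "\<dots> = frechet_derivative (?D (0, axis k 1)) (at (0, x)) (1, 0)"
      by (rule fun_cong[OF frechet_derivative_cong_open[OF N x]]) (use grad_time_slice[OF U1] in auto)
    also have "\<dots> = frechet_derivative (?D (1, 0)) (at (0, x)) (0, axis k 1)"
      by (rule second_derivative_symmetric[OF N x U])
    also have "\<dots> = frechet_derivative (\<lambda>x. ?D (1, 0) (0, x)) (at x) (axis k 1)"
      by (rule time_slice_derivative(1)[OF D1 x, symmetric])
    also have "\<dots> = frechet_derivative (local_derivative (\<lambda>t x. U (t, x))) (at x) (axis k 1)"
      by (rule fun_cong[OF frechet_derivative_cong_open[OF time_slice(1)[OF N U1, of 0]]])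
        (use family_local_derivative[OF U1] x in auto)
    finally show ?thesis by (simp add: grad_def pd_def)
  qed
  then show ?thesis by (simp add: vec_eq_iff)
qed

lemma flux_family_C1:
  fixes U :: "real \<times> (real^2) \<Rightarrow> real^4"
  assumes g: "gas_ok g" and N: "open N" and U: "Ck_on 2 U N" and phys: "U ` N \<subseteq> physical_states g"
  shows "Ck_on (Suc 0) (\<lambda>p. flux_field g (\<lambda>x. U (fst p, x)) (snd p)) N"
proof -
  have U2: "Ck_on (Suc (Suc 0)) U N" using U by (simp only: numeral_2_eq_2)
  have "Ck_on (Suc 0) (\<lambda>p. total_flux g (U p, grad (\<lambda>x. U (fst p, x)) (snd p))) N"
    by (rule Ck_on_compose[OF N _ _ Ck_on_Pair[OF N Ck_on_SucD[OF U2] family_grad_C1[OF N U]] Ck_on_total_flux[OF g]])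
      (use phys in \<open>auto intro: open_Times open_physical_states\<close>)
  then show ?thesis by (simp only: total_flux_def flux_field_def fst_conv snd_conv prod.collapse)
qed

text \<open>The chain rule for \<open>total_flux\<close> along \<open>t \<mapsto> (u, \<nabla>u)\<close>, whose derivative is \<open>(u', \<nabla>u')\<close>.\<close>

lemma flux_local_derivative:
  fixes U :: "real \<times> (real^2) \<Rightarrow> real^4"
  defines "u \<equiv> \<lambda>t x. U (t, x)"
  assumes g: "gas_ok g" and N: "open N" and U: "Ck_on 2 U N" and phys: "U ` N \<subseteq> physical_states g" and x: "(0, x) \<in> N"
  shows "local_derivative (\<lambda>t. flux_field g (u t)) x $ k =
    (Fc_u g (u 0 x) k - Fv_u g (u 0 x) (grad (u 0) x) k) *v local_derivative u x -
    (\<Sum>l\<in>UNIV. G g (u 0 x) (grad (u 0) x) k l *v (grad (local_derivative u) x $ l))"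
proof -
  have U2: "Ck_on (Suc (Suc 0)) U N" using U by (simp only: numeral_2_eq_2)
  let ?Q = "\<lambda>p. grad (\<lambda>x. U (fst p, x)) (snd p)"
  let ?DU = "frechet_derivative U (at (0, x))" and ?DQ = "frechet_derivative ?Q (at (0, x))"
  have eq: "flux_field g (\<lambda>x. U (fst p, x)) (snd p) = total_flux g (U p, ?Q p)" for p
    by (simp add: total_flux_def flux_field_def)
  have ux: "U (0, x) \<in> physical_states g" using phys x by blast
  have d: "(total_flux g has_derivative frechet_derivative (total_flux g) (at (U (0, x), ?Q (0, x)))) (at (U (0, x), ?Q (0, x)))"
    by (rule Ck_on_has_derivative[OF Ck_on_total_flux[OF g]]) (use ux in simp)
  have "((\<lambda>p. (U p, ?Q p)) has_derivative (\<lambda>h. (?DU h, ?DQ h))) (at (0, x))"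
    by (intro has_derivative_Pair Ck_on_has_derivative[OF Ck_on_SucD[OF U2] x] Ck_on_has_derivative[OF family_grad_C1[OF N U] x])
  from has_derivative_compose[OF this d]
  have "((\<lambda>p. total_flux g (U p, ?Q p)) has_derivative
      (\<lambda>h. frechet_derivative (total_flux g) (at (U (0, x), ?Q (0, x))) (?DU h, ?DQ h))) (at (0, x))" .
  then have "frechet_derivative (\<lambda>p. flux_field g (\<lambda>x. U (fst p, x)) (snd p)) (at (0, x)) (1, 0) =
      frechet_derivative (total_flux g) (at (U (0, x), ?Q (0, x))) (?DU (1, 0), ?DQ (1, 0))"
    unfolding eq by (simp add: frechet_derivative_eqI)
  moreover have "local_derivative (\<lambda>t. flux_field g (u t)) x =
      frechet_derivative (\<lambda>p. flux_field g (\<lambda>x. U (fst p, x)) (snd p)) (at (0, x)) (1, 0)"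
    using family_local_derivative[OF flux_family_C1[OF g N U phys] x] by (simp add: u_def)
  moreover have "?DU (1, 0) = local_derivative u x"
    using family_local_derivative[OF Ck_on_SucD[OF U2] x] by (simp add: u_def)
  moreover have "?DQ (1, 0) = grad (local_derivative u) x"
    using family_grad_local_derivative[OF N U x] by (simp add: u_def)
  ultimately show ?thesis
    using total_flux_derivative[OF g ux, of "?Q (0, x)"] by (simp add: u_def)
qed

lemma G_T_grad_C1:
  assumes g: "gas_ok g" and N: "open N" and u: "Ck_on (Suc 0) u N" "u ` N \<subseteq> physical_states g" and v: "Ck_on 2 v N"
  shows "Ck_on (Suc 0) (G_T_grad g u v) N"
proof -
  have v2: "Ck_on (Suc (Suc 0)) v N" using v by (simp only: numeral_2_eq_2)
  have up: "u x \<in> positive_density" if "x \<in> N" for x using u(2) physical_states_subset that by blast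
  have "Ck_on (Suc 0) (\<lambda>x. \<chi> l. \<chi> j. \<Sum>k\<in>UNIV. \<Sum>i\<in>UNIV. Fv g (u x) (axis l (axis j 1)) $ k $ i * pd k v x $ i) N"
  proof (intro Ck_on_vec_lambda Ck_on_sum Ck_on_mult Ck_on_vec_nth N)
    show "Ck_on (Suc 0) (pd k v) N" for k unfolding pd_def[abs_def] by (rule Ck_on_frechet_derivative[OF v2])
    show "Ck_on (Suc 0) (\<lambda>x. Fv g (u x) r) N" for r
      using Ck_on_compose[OF N _ _ Ck_on_Pair[OF N u(1) Ck_on_const] Ck_on_Fv[OF g]] u(2)
      by (auto simp del: Ck_on.simps intro: open_Times open_physical_states)
  qed
  moreover have "(\<chi> l. \<chi> j. \<Sum>k\<in>UNIV. \<Sum>i\<in>UNIV. Fv g (u x) (axis l (axis j 1)) $ k $ i * pd k v x $ i) = G_T_grad g u v x"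
    if "x \<in> N" for x
    by (simp add: G_T_grad_def vec_eq_iff G_nth[OF up[OF that]] matrix_vector_mult_def transpose_def)
  ultimately show ?thesis by (rule Ck_on_transform[OF N])
qed

section \<open>Differentiating the variational form\<close>

lemma bd_integral_cong:
  assumes "\<And>x. x \<in> S \<Longrightarrow> f x = g x"
  shows "bd_integral \<C> S f = bd_integral \<C> S g"
  unfolding bd_integral_def by (intro sum.cong refl integral_cong) (use assms in auto)

lemma bd_integral_normal_on:
  assumes "C1_domain \<Omega> \<C>"
  shows "bd_integral \<C> S (\<lambda>x. outer_normal \<Omega> x \<bullet> Y x) =
    (\<Sum>\<gamma>\<in>\<C>. integral {s \<in> {0..1}. \<gamma> s \<in> S} (flux_density \<Omega> \<gamma> Y))"
  unfolding bd_integral_def by (intro sum.cong refl) (simp add: flux_density_eq[OF assms])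

lemma flux_density_integrable_on:
  assumes dom: "C1_domain \<Omega> \<C>" and \<gamma>: "\<gamma> \<in> \<C>" and S: "S \<in> sets borel" and Y: "continuous_on (frontier \<Omega>) Y"
  shows "flux_density \<Omega> \<gamma> Y integrable_on {s \<in> {0..1}. \<gamma> s \<in> S}"
proof -
  have "\<gamma> \<in> borel_measurable borel"
    using closed_C1_curve_derivative(4)[OF C1_domain_curveD(1)[OF dom \<gamma>]] by (intro borel_measurable_continuous_onI)
  from measurable_sets[OF this S] have "\<gamma> -` S \<in> sets borel" by simp
  then have "{0..1} \<inter> \<gamma> -` S \<in> sets borel" by (intro sets.Int) simp_all
  moreover have "{0..1} \<inter> \<gamma> -` S = {s \<in> {0..1}. \<gamma> s \<in> S}" by auto
  ultimately have "{s \<in> {0..1}. \<gamma> s \<in> S} \<in> sets lebesgue" by (metis sets_completionI_sets sets_lborel)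
  then have "flux_density \<Omega> \<gamma> Y absolutely_integrable_on {s \<in> {0..1}. \<gamma> s \<in> S}"
    by (intro absolutely_integrable_continuous_on_compact[of "{0..1}"] flux_density_continuous[OF dom \<gamma> Y]) auto
  then show ?thesis by (simp add: absolutely_integrable_on_def)
qed

text \<open>Arc length integrals over arbitrary parts of the boundary are additive only for integrable
  integrands; fluxes of continuous fields are continuous in the parameter, so they qualify.\<close>

lemma bd_integral_normal_split:
  assumes dom: "C1_domain \<Omega> \<C>" and S: "S \<in> sets borel" and Y: "continuous_on (frontier \<Omega>) Y"
  shows "bd_integral \<C> (frontier \<Omega>) (\<lambda>x. outer_normal \<Omega> x \<bullet> Y x) =
    bd_integral \<C> S (\<lambda>x. outer_normal \<Omega> x \<bullet> Y x) + bd_integral \<C> (frontier \<Omega> - S) (\<lambda>x. outer_normal \<Omega> x \<bullet> Y x)"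
proof -
  have B: "frontier \<Omega> - S \<in> sets borel" using S by (intro sets.Diff) auto
  have "integral {s \<in> {0..1}. \<gamma> s \<in> frontier \<Omega>} (flux_density \<Omega> \<gamma> Y) =
      integral {s \<in> {0..1}. \<gamma> s \<in> S} (flux_density \<Omega> \<gamma> Y) + integral {s \<in> {0..1}. \<gamma> s \<in> frontier \<Omega> - S} (flux_density \<Omega> \<gamma> Y)"
    if \<gamma>: "\<gamma> \<in> \<C>" for \<gamma>
  proof -
    have e: "{s \<in> {0..1}. \<gamma> s \<in> frontier \<Omega>} = {s \<in> {0..1}. \<gamma> s \<in> S} \<union> {s \<in> {0..1}. \<gamma> s \<in> frontier \<Omega> - S}"
      using C1_domain_curveD(2)[OF dom \<gamma>] by auto
    have "{s \<in> {0..1}. \<gamma> s \<in> S} \<inter> {s \<in> {0..1}. \<gamma> s \<in> frontier \<Omega> - S} = {}" by auto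
    then show ?thesis unfolding e
      by (intro integral_Un flux_density_integrable_on[OF dom \<gamma> _ Y] S B) simp
  qed
  then show ?thesis by (simp add: bd_integral_normal_on[OF dom] sum.distrib)
qed

lemma bd_integral_normal_add:
  assumes dom: "C1_domain \<Omega> \<C>" and S: "S \<in> sets borel"
    and Y: "continuous_on (frontier \<Omega>) Y" "continuous_on (frontier \<Omega>) Z"
  shows "bd_integral \<C> S (\<lambda>x. outer_normal \<Omega> x \<bullet> (Y x + Z x)) =
    bd_integral \<C> S (\<lambda>x. outer_normal \<Omega> x \<bullet> Y x) + bd_integral \<C> S (\<lambda>x. outer_normal \<Omega> x \<bullet> Z x)"
proof -
  have "integral {s \<in> {0..1}. \<gamma> s \<in> S} (flux_density \<Omega> \<gamma> (\<lambda>x. Y x + Z x)) =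
      integral {s \<in> {0..1}. \<gamma> s \<in> S} (flux_density \<Omega> \<gamma> Y) + integral {s \<in> {0..1}. \<gamma> s \<in> S} (flux_density \<Omega> \<gamma> Z)"
    if \<gamma>: "\<gamma> \<in> \<C>" for \<gamma>
    unfolding integral_add[OF flux_density_integrable_on[OF dom \<gamma> S Y(1)] flux_density_integrable_on[OF dom \<gamma> S Y(2)], symmetric]
    by (rule integral_cong) (simp add: flux_density_def inner_add_right algebra_simps)
  then show ?thesis by (simp add: bd_integral_normal_on[OF dom] sum.distrib)
qed

lemma inner_transpose: "x \<bullet> (y v* A) = (A *v x) \<bullet> y" for A :: "real^'n^'m"
  by (metis dot_lmul_matrix inner_commute)

lemma grad_nth: "grad f x $ k = pd k f x"
  by (simp add: grad_def)

lemma inner_cart2: "X \<bullet> Y = (\<Sum>k\<in>UNIV. X $ k \<bullet> Y $ k)" for X Y :: "real^4^2"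
  by (simp add: inner_vec_def)

lemma Ck_on_grad:
  assumes N: "open N" and v: "Ck_on (Suc k) v N"
  shows "Ck_on k (grad v) N"
  unfolding grad_def[abs_def] pd_def by (intro Ck_on_vec_lambda N Ck_on_frechet_derivative[OF v])

text \<open>The two transport formulas are applied to \<open>F \<bullet> \<nabla>v\<close> and to the field \<open>W\<close> with components
  \<open>F\<^sub>k \<bullet> v\<close>; what remains is to sort the terms. The fields \<open>A\<close> and \<open>B\<close> are the parts of \<open>W'\<close> with
  \<open>F'\<close> and \<open>v'\<close>, and \<open>P\<close> with components \<open>u' \<bullet> (G\<^sup>T \<nabla>v)\<^sub>l\<close> is the field for the
  integration by parts. All boundary integrands are written as \<open>n \<bullet> Y\<close> with \<open>Y\<close> continuous on the
  boundary, so that they can be added and split.\<close>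

lemma shape_derivative:
  fixes U T :: "real \<times> (real^2) \<Rightarrow> real^4" and \<Omega> :: "(real^2) set"
  assumes g: "gas_ok g" and dom: "C1_domain \<Omega> \<C>" and wall: "\<Gamma>W \<subseteq> frontier \<Omega>" "\<Gamma>W \<in> sets borel"
    and V: "Ck_on (Suc 0) V UNIV" and KV: "compact KV" "\<And>x. x \<notin> KV \<Longrightarrow> V x = 0"
    and far: "\<And>x. x \<in> frontier \<Omega> - \<Gamma>W \<Longrightarrow> V x = 0"
    and N: "open N" "{0} \<times> closure \<Omega> \<subseteq> N" and U: "Ck_on 2 U N" and T: "Ck_on 2 T N"
    and phys: "U ` N \<subseteq> physical_states g"
    and weak: "variational_form g \<Omega> \<C> (\<lambda>x. U (0, x)) (local_derivative (\<lambda>t x. T (t, x))) = 0"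
  shows "((\<lambda>t. variational_form g (move V t ` \<Omega>) (moved_curves V t \<C>) (\<lambda>x. U (t, x)) (\<lambda>x. T (t, x))) has_real_derivative
     shape_form g \<Omega> \<C> \<Gamma>W V (\<lambda>x. U (0, x)) (local_derivative (\<lambda>t x. U (t, x)))
       (local_derivative (\<lambda>t. flux_field g (\<lambda>x. U (t, x)))) (\<lambda>x. T (0, x))) (at 0)"
proof -
  define n where "n = outer_normal \<Omega>"
  define \<Gamma> where "\<Gamma> = frontier \<Omega>"
  define F where "F p = flux_field g (\<lambda>x. U (fst p, x)) (snd p)" for p
  define R where "R p = grad (\<lambda>x. T (fst p, x)) (snd p)" for p
  define W :: "real \<times> (real^2) \<Rightarrow> real^2" where "W p = (\<chi> k. F p $ k \<bullet> T p)" for p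
  define u0 where "u0 x = U (0, x)" for x
  define v0 where "v0 x = T (0, x)" for x
  define F0 where "F0 = flux_field g u0"
  define du where "du = local_derivative (\<lambda>t x. U (t, x))"
  define dv where "dv = local_derivative (\<lambda>t x. T (t, x))"
  define dF where "dF = local_derivative (\<lambda>t. flux_field g (\<lambda>x. U (t, x)))"
  define N0 where "N0 = {x. (0, x) \<in> N}"
  have U1: "Ck_on (Suc 0) U N" and T1: "Ck_on (Suc 0) T N" using U T by (auto intro: Ck_on_le simp del: Ck_on.simps)
  have F: "Ck_on (Suc 0) F N" unfolding F_def[abs_def] by (rule flux_family_C1[OF g N(1) U phys])
  have R: "Ck_on (Suc 0) R N" unfolding R_def[abs_def] by (rule family_grad_C1[OF N(1) T])
  have W: "Ck_on (Suc 0) W N" unfolding W_def[abs_def] by (intro Ck_on_vec_lambda Ck_on_inner Ck_on_vec_nth N(1) F T1)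
  have N0: "open N0" "closure \<Omega> \<subseteq> N0" "\<Omega> \<subseteq> N0" "\<Gamma> \<subseteq> N0"
    using time_slice(1)[OF N(1) U1] N(2) closure_subset[of \<Omega>] C1_domainD(8)[OF dom] by (auto simp: N0_def \<Gamma>_def)
  have inN: "(0, x) \<in> N" if "x \<in> N0" for x using that by (simp add: N0_def)
  have u2: "Ck_on 2 u0 N0" and v2: "Ck_on 2 v0 N0"
    unfolding u0_def[abs_def] v0_def[abs_def] N0_def by (rule time_slice(2)[OF N(1) U] time_slice(2)[OF N(1) T])+
  have u1: "Ck_on (Suc 0) u0 N0" and v1: "Ck_on (Suc 0) v0 N0" using u2 v2 by (auto intro: Ck_on_le simp del: Ck_on.simps)
  have v2': "Ck_on (Suc (Suc 0)) v0 N0" using v2 by (simp only: numeral_2_eq_2)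
  have F0F: "F0 x = F (0, x)" for x by (simp add: F0_def F_def u0_def[abs_def])
  have F0: "Ck_on (Suc 0) F0 N0" using time_slice(2)[OF N(1) F, of 0] by (simp add: F0F[abs_def] N0_def del: Ck_on.simps)
  have du: "Ck_on (Suc 0) du N0" and dv: "Ck_on (Suc 0) dv N0"
    unfolding du_def dv_def N0_def by (rule family_local_derivative_C1[OF N(1) U] family_local_derivative_C1[OF N(1) T])+
  have gv: "Ck_on (Suc 0) (grad v0) N0" by (rule Ck_on_grad[OF N0(1) v2'])
  have gdu: "continuous_on N0 (grad du)" and gdv: "continuous_on N0 (grad dv)"
    using Ck_on_grad[OF N0(1) du] Ck_on_grad[OF N0(1) dv] by simp_all
  have RR: "R (0, x) = grad v0 x" for x by (simp add: R_def v0_def[abs_def])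
  have dFF: "dF x = frechet_derivative F (at (0, x)) (1, 0)" if "x \<in> N0" for x
    using family_local_derivative[OF F inN[OF that]] by (simp add: dF_def F_def)
  have dTT: "dv x = frechet_derivative T (at (0, x)) (1, 0)" if "x \<in> N0" for x
    using family_local_derivative[OF T1 inN[OF that]] by (simp add: dv_def)
  have dRR: "grad dv x = frechet_derivative R (at (0, x)) (1, 0)" if "x \<in> N0" for x
    using family_grad_local_derivative[OF N(1) T inN[OF that]] by (simp add: dv_def R_def[abs_def])
  have "continuous_on N0 (\<lambda>x. frechet_derivative F (at (0, x)) (1, 0))"
    by (rule continuous_on_frechet_derivative[OF F]) (auto intro!: continuous_intros inN)
  then have dFc: "continuous_on N0 dF" by (simp add: dFF cong: continuous_on_cong)
  note cont = Ck_on_continuous[OF F0] Ck_on_continuous[OF du] Ck_on_continuous[OF dv] Ck_on_continuous[OF v1] Ck_on_continuous[OF gv]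
    gdu gdv dFc
  have sub\<Gamma>: "continuous_on \<Gamma> h" if "continuous_on N0 h" for h :: "real^2 \<Rightarrow> 'b::topological_space"
    by (rule continuous_on_subset[OF that N0(4)])
  have subK: "continuous_on (closure \<Omega>) h" if "continuous_on N0 h" for h :: "real^2 \<Rightarrow> 'b::topological_space"
    by (rule continuous_on_subset[OF that N0(2)])
  have int: "h integrable_on \<Omega>" if "continuous_on N0 h" for h :: "real^2 \<Rightarrow> real"
    by (rule C1_domain_integrable[OF dom subK[OF that]])
  have Vc: "continuous_on S V" for S using Ck_on_continuous[OF V] continuous_on_subset by blast
  have \<Gamma>borel: "\<Gamma> - \<Gamma>W \<in> sets borel" "\<Gamma> \<in> sets borel" using wall(2) by (auto simp: \<Gamma>_def)

  define A B P where "A x = (\<chi> k. dF x $ k \<bullet> v0 x)" and "B x = (\<chi> k. F0 x $ k \<bullet> dv x)"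
    and "P x = (\<chi> l. du x \<bullet> G_T_grad g u0 v0 x $ l)" for x :: "real^2"
  define dW where "dW = divergence (\<lambda>y. \<chi> k. F0 y $ k \<bullet> v0 y)"
  have WW: "W (0, x) = (\<chi> k. F0 x $ k \<bullet> v0 x)" for x by (simp add: W_def F0F v0_def)
  have W0: "Ck_on (Suc 0) (\<lambda>y. \<chi> k. F0 y $ k \<bullet> v0 y) N0"
    by (intro Ck_on_vec_lambda Ck_on_inner Ck_on_vec_nth N0 F0 v1)
  have dWc: "continuous_on N0 dW"
    unfolding dW_def divergence_def[abs_def] pd_def
    by (intro continuous_on_sum Ck_on_continuous[OF Ck_on_frechet_derivative[OF Ck_on_vec_nth[OF N0(1) W0]]])
  have Ac: "continuous_on N0 A" and Bc: "continuous_on N0 B"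
    unfolding A_def B_def by (intro continuous_on_vec_lambda continuous_intros cont)+
  have phys0: "u0 ` N0 \<subseteq> physical_states g" using phys inN by (auto simp: u0_def)
  have GT: "Ck_on (Suc 0) (G_T_grad g u0 v0) N0" by (rule G_T_grad_C1[OF g N0(1) u1 phys0 v2])
  have PC: "Ck_on (Suc 0) P N0" unfolding P_def by (intro Ck_on_vec_lambda Ck_on_inner Ck_on_vec_nth N0 du GT)

  have dFk: "dF x $ k = (Fc_u g (u0 x) k - Fv_u g (u0 x) (grad u0 x) k) *v du x -
      (\<Sum>l\<in>UNIV. G g (u0 x) (grad u0 x) k l *v (grad du x $ l))" if "x \<in> N0" for x k
    using flux_local_derivative[OF g N(1) U phys inN[OF that]] by (simp add: dF_def du_def u0_def[abs_def])
  have volume: "dF x \<bullet> grad v0 x = du x \<bullet> flux_u_T_grad g u0 v0 x - grad du x \<bullet> G_T_grad g u0 v0 x" if "x \<in> N0" for x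
    unfolding inner_cart2 flux_u_T_grad_def G_T_grad_def
    by (simp add: dFk[OF that] inner_transpose inner_add_right inner_diff_left inner_add_left grad_nth UNIV_2)
  have boundary: "n x \<bullet> A x = du x \<bullet> n_flux_u_T g u0 v0 (n x) x - grad du x \<bullet> n_G_T g u0 v0 (n x) x" if "x \<in> N0" for x
    unfolding inner_cart2 n_flux_u_T_def n_G_T_def A_def
    by (simp add: dFk[OF that] inner2 inner_transpose inner_add_right inner_diff_left inner_add_left UNIV_2 algebra_simps)
  have nP: "n x \<bullet> P x = du x \<bullet> ndot (n x) (G_T_grad g u0 v0 x)" for x
    by (simp add: P_def inner2 ndot_def UNIV_2 inner_add_right)
  have divP: "divergence P x = du x \<bullet> divergence (G_T_grad g u0 v0) x + grad du x \<bullet> G_T_grad g u0 v0 x" if "x \<in> N0" for x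
  proof -
    have "pd k (\<lambda>y. P y $ k) x = du x \<bullet> pd k (\<lambda>y. G_T_grad g u0 v0 y $ k) x + grad du x $ k \<bullet> G_T_grad g u0 v0 x $ k" for k
      unfolding pd_def P_def grad_def vec_lambda_beta
      by (simp add: frechet_derivative_eqI[OF has_derivative_inner[OF Ck_on_has_derivative[OF du that]
          Ck_on_has_derivative[OF Ck_on_vec_nth[OF N0(1) GT] that]]])
    then show ?thesis by (simp add: divergence_def inner_cart2 inner_add_right UNIV_2)
  qed

  have f: "Ck_on (Suc 0) (\<lambda>p. F p \<bullet> R p) N" by (intro Ck_on_inner N F R)
  have Df: "frechet_derivative (\<lambda>p. F p \<bullet> R p) (at (0, x)) (1, 0) = dF x \<bullet> grad v0 x + F0 x \<bullet> grad dv x" if "x \<in> N0" for x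
    using frechet_derivative_eqI[OF has_derivative_inner[OF Ck_on_has_derivative[OF F inN[OF that]] Ck_on_has_derivative[OF R inN[OF that]]]]
    by (simp add: dFF[OF that] dRR[OF that] F0F RR)
  have DW: "frechet_derivative W (at (0, x)) (1, 0) = A x + B x" if x: "x \<in> N0" for x
  proof -
    have "frechet_derivative W (at (0, x)) (1, 0) $ k = A x $ k + B x $ k" for k
    proof -
      have "((\<lambda>p. W p $ k) has_derivative (\<lambda>h. frechet_derivative W (at (0, x)) h $ k)) (at (0, x))"
        by (intro bounded_linear.has_derivative[OF bounded_linear_vec_nth] Ck_on_has_derivative[OF W inN[OF x]])
      moreover have "((\<lambda>p. W p $ k) has_derivative (\<lambda>h. F (0, x) $ k \<bullet> frechet_derivative T (at (0, x)) h +
          frechet_derivative F (at (0, x)) h $ k \<bullet> T (0, x))) (at (0, x))"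
        unfolding W_def vec_lambda_beta
        by (intro has_derivative_inner bounded_linear.has_derivative[OF bounded_linear_vec_nth] Ck_on_has_derivative[OF F inN[OF x]]
            Ck_on_has_derivative[OF T1 inN[OF x]])
      ultimately have "(\<lambda>h. frechet_derivative W (at (0, x)) h $ k) = (\<lambda>h. F (0, x) $ k \<bullet> frechet_derivative T (at (0, x)) h +
          frechet_derivative F (at (0, x)) h $ k \<bullet> T (0, x))" by (rule has_derivative_unique)
      from fun_cong[OF this, of "(1, 0)"] show ?thesis
        by (simp add: A_def B_def dFF[OF x] dTT[OF x] F0F v0_def)
    qed
    then show ?thesis by (simp add: vec_eq_iff)
  qed
  have vf: "variational_form g (move V t ` \<Omega>) (moved_curves V t \<C>) (\<lambda>x. U (t, x)) (\<lambda>x. T (t, x)) =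
      - integral (move V t ` \<Omega>) (\<lambda>x. F (t, x) \<bullet> R (t, x)) +
      bd_integral (moved_curves V t \<C>) (frontier (move V t ` \<Omega>)) (\<lambda>x. outer_normal (move V t ` \<Omega>) x \<bullet> W (t, x))" for t
  proof -
    have "ndot m (flux_field g (\<lambda>x. U (t, x)) x) \<bullet> T (t, x) = m \<bullet> W (t, x)" for m x
      by (simp add: ndot_def W_def F_def inner2 UNIV_2 inner_add_left)
    then show ?thesis by (simp add: variational_form_def F_def R_def)
  qed
  note vol = derivative_of_volume_integral[OF dom V KV N f]
  note bdy = derivative_of_boundary_flux[OF dom V KV N W]
  have der: "((\<lambda>t. variational_form g (move V t ` \<Omega>) (moved_curves V t \<C>) (\<lambda>x. U (t, x)) (\<lambda>x. T (t, x))) has_real_derivative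
     - (integral \<Omega> (\<lambda>x. frechet_derivative (\<lambda>p. F p \<bullet> R p) (at (0, x)) (1, 0)) +
        bd_integral \<C> \<Gamma> (\<lambda>x. n x \<bullet> ((F (0, x) \<bullet> R (0, x)) *\<^sub>R V x))) +
     bd_integral \<C> \<Gamma> (\<lambda>x. n x \<bullet> (frechet_derivative W (at (0, x)) (1, 0) + divergence (\<lambda>y. W (0, y)) x *\<^sub>R V x))) (at 0)"
    unfolding vf using DERIV_add[OF DERIV_minus[OF vol] bdy] by (simp add: n_def \<Gamma>_def)

  define b where "b S Y = bd_integral \<C> S (\<lambda>x. n x \<bullet> Y x)" for S and Y :: "real^2 \<Rightarrow> real^2"
  have split: "b \<Gamma> Y = b \<Gamma>W Y + b (\<Gamma> - \<Gamma>W) Y" if "continuous_on \<Gamma> Y" for Y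
    unfolding b_def n_def \<Gamma>_def by (rule bd_integral_normal_split[OF dom wall(2)]) (use that in \<open>simp add: \<Gamma>_def\<close>)
  have vanish: "b (\<Gamma> - \<Gamma>W) (\<lambda>x. c x *\<^sub>R V x) = 0" for c
  proof -
    have "b (\<Gamma> - \<Gamma>W) (\<lambda>x. c x *\<^sub>R V x) = bd_integral \<C> (\<Gamma> - \<Gamma>W) (\<lambda>x. 0)"
      unfolding b_def by (rule bd_integral_cong) (use far in \<open>simp add: \<Gamma>_def\<close>)
    then show ?thesis by (simp add: bd_integral_def)
  qed

  have I1: "integral \<Omega> (\<lambda>x. frechet_derivative (\<lambda>p. F p \<bullet> R p) (at (0, x)) (1, 0)) =
      integral \<Omega> (\<lambda>x. dF x \<bullet> grad v0 x) + integral \<Omega> (\<lambda>x. F0 x \<bullet> grad dv x)"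
  proof -
    have "integral \<Omega> (\<lambda>x. frechet_derivative (\<lambda>p. F p \<bullet> R p) (at (0, x)) (1, 0)) =
        integral \<Omega> (\<lambda>x. dF x \<bullet> grad v0 x + F0 x \<bullet> grad dv x)"
      by (rule integral_cong) (use Df N0(3) in blast)
    also have "\<dots> = integral \<Omega> (\<lambda>x. dF x \<bullet> grad v0 x) + integral \<Omega> (\<lambda>x. F0 x \<bullet> grad dv x)"
      by (intro integral_add int continuous_intros cont)
    finally show ?thesis .
  qed
  have I2: "bd_integral \<C> \<Gamma> (\<lambda>x. n x \<bullet> ((F (0, x) \<bullet> R (0, x)) *\<^sub>R V x)) =
      bd_integral \<C> \<Gamma>W (\<lambda>x. ((V x \<bullet> n x) *\<^sub>R F0 x) \<bullet> grad v0 x)"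
  proof -
    have "b \<Gamma> (\<lambda>x. (F0 x \<bullet> grad v0 x) *\<^sub>R V x) = b \<Gamma>W (\<lambda>x. (F0 x \<bullet> grad v0 x) *\<^sub>R V x)"
      using split[of "\<lambda>x. (F0 x \<bullet> grad v0 x) *\<^sub>R V x"] vanish
      by (simp add: continuous_intros sub\<Gamma> cont Vc)
    then show ?thesis by (simp add: b_def F0F[symmetric] RR inner_commute mult.commute)
  qed
  have I3: "bd_integral \<C> \<Gamma> (\<lambda>x. n x \<bullet> (frechet_derivative W (at (0, x)) (1, 0) + divergence (\<lambda>y. W (0, y)) x *\<^sub>R V x)) =
      b \<Gamma> A + b \<Gamma> B + bd_integral \<C> \<Gamma>W (\<lambda>x. (V x \<bullet> n x) * dW x)"
  proof -
    have dW': "divergence (\<lambda>y. W (0, y)) = dW" by (simp add: dW_def WW[abs_def])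
    have "bd_integral \<C> \<Gamma> (\<lambda>x. n x \<bullet> (frechet_derivative W (at (0, x)) (1, 0) + divergence (\<lambda>y. W (0, y)) x *\<^sub>R V x)) =
        b \<Gamma> (\<lambda>x. (A x + B x) + dW x *\<^sub>R V x)"
      unfolding b_def dW' by (rule bd_integral_cong) (use DW N0(4) in auto)
    also have "\<dots> = b \<Gamma> (\<lambda>x. A x + B x) + b \<Gamma> (\<lambda>x. dW x *\<^sub>R V x)"
      unfolding b_def n_def
      by (intro bd_integral_normal_add[OF dom \<Gamma>borel(2)] continuous_intros sub\<Gamma>[unfolded \<Gamma>_def] Ac Bc dWc Vc)
    also have "b \<Gamma> (\<lambda>x. A x + B x) = b \<Gamma> A + b \<Gamma> B"
      unfolding b_def n_def by (intro bd_integral_normal_add[OF dom \<Gamma>borel(2)] sub\<Gamma>[unfolded \<Gamma>_def] Ac Bc)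
    also have "b \<Gamma> (\<lambda>x. dW x *\<^sub>R V x) = b \<Gamma>W (\<lambda>x. dW x *\<^sub>R V x)"
      using split[of "\<lambda>x. dW x *\<^sub>R V x"] vanish by (simp add: continuous_intros sub\<Gamma> dWc Vc)
    finally show ?thesis by (simp add: b_def inner_commute mult.commute)
  qed
  \<comment> \<open>the terms with \<open>v'\<close> are the variational equation tested with \<open>v'\<close>\<close>
  have I4: "- integral \<Omega> (\<lambda>x. F0 x \<bullet> grad dv x) + b \<Gamma> B = 0"
  proof -
    have "ndot m (F0 x) \<bullet> dv x = m \<bullet> B x" for m x
      by (simp add: ndot_def B_def inner2 UNIV_2 inner_add_left)
    then show ?thesis using weak
      by (simp add: variational_form_def b_def n_def \<Gamma>_def F0_def dv_def u0_def[abs_def])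
  qed
  have I5: "b \<Gamma> A = bd_integral \<C> \<Gamma>W (\<lambda>x. ndot (n x) (dF x) \<bullet> v0 x) +
      bd_integral \<C> (\<Gamma> - \<Gamma>W) (\<lambda>x. du x \<bullet> n_flux_u_T g u0 v0 (n x) x) -
      bd_integral \<C> (\<Gamma> - \<Gamma>W) (\<lambda>x. grad du x \<bullet> n_G_T g u0 v0 (n x) x)"
  proof -
    \<comment> \<open>\<open>n \<bullet> Z\<close> is the term with \<open>\<nabla>u'\<close>; by linearity of \<open>Fv\<close> it is evidently continuous\<close>
    define Z where "Z x = (\<chi> k. Fv g (u0 x) (grad du x) $ k \<bullet> v0 x)" for x :: "real^2"
    have nZ: "n x \<bullet> Z x = grad du x \<bullet> n_G_T g u0 v0 (n x) x" if x: "x \<in> N0" for x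
    proof -
      have "u0 x \<in> positive_density" using phys0 physical_states_subset x by blast
      note sum_G_mult[OF this, where g = g and q = "grad u0 x" and r = "grad du x", symmetric]
      then show ?thesis unfolding inner_cart2 n_G_T_def Z_def
        by (simp add: inner2 inner_transpose inner_add_right inner_add_left UNIV_2 algebra_simps)
    qed
    have "continuous_on N0 (\<lambda>x. Fv g (u0 x) (grad du x))"
    proof -
      have "continuous_on N0 (\<lambda>x. (u0 x, grad du x))" by (intro continuous_intros gdu Ck_on_continuous[OF u1])
      from continuous_on_compose2[OF Ck_on_continuous[OF Ck_on_Fv[OF g]] this] show ?thesis using phys0 by auto
    qed
    then have Zc: "continuous_on N0 Z"
      unfolding Z_def by (intro continuous_on_vec_lambda continuous_intros cont)
    have "b (\<Gamma> - \<Gamma>W) (\<lambda>x. A x + Z x) = b (\<Gamma> - \<Gamma>W) A + b (\<Gamma> - \<Gamma>W) Z"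
      unfolding b_def n_def by (intro bd_integral_normal_add[OF dom \<Gamma>borel(1)] sub\<Gamma>[unfolded \<Gamma>_def] Ac Zc)
    moreover have "b (\<Gamma> - \<Gamma>W) (\<lambda>x. A x + Z x) = bd_integral \<C> (\<Gamma> - \<Gamma>W) (\<lambda>x. du x \<bullet> n_flux_u_T g u0 v0 (n x) x)"
      unfolding b_def by (rule bd_integral_cong) (use boundary nZ N0(4) in \<open>auto simp: inner_add_right\<close>)
    moreover have "b (\<Gamma> - \<Gamma>W) Z = bd_integral \<C> (\<Gamma> - \<Gamma>W) (\<lambda>x. grad du x \<bullet> n_G_T g u0 v0 (n x) x)"
      unfolding b_def by (rule bd_integral_cong) (use nZ N0(4) in auto)
    moreover have "ndot m (dF x) \<bullet> v0 x = m \<bullet> A x" for m x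
      by (simp add: ndot_def A_def inner2 UNIV_2 inner_add_left)
    then have "b \<Gamma>W A = bd_integral \<C> \<Gamma>W (\<lambda>x. ndot (n x) (dF x) \<bullet> v0 x)" by (simp add: b_def)
    ultimately show ?thesis using split[OF sub\<Gamma>[OF Ac]] by simp
  qed
  \<comment> \<open>integration by parts of the term with \<open>\<nabla>u'\<close>\<close>
  have I6: "integral \<Omega> (\<lambda>x. dF x \<bullet> grad v0 x) =
      integral \<Omega> (\<lambda>x. du x \<bullet> flux_u_T_grad g u0 v0 x) + integral \<Omega> (\<lambda>x. du x \<bullet> divergence (G_T_grad g u0 v0) x) -
      bd_integral \<C> \<Gamma> (\<lambda>x. du x \<bullet> ndot (n x) (G_T_grad g u0 v0 x))"
  proof -
    have i1: "(\<lambda>x. dF x \<bullet> grad v0 x) integrable_on \<Omega>" and i2: "(\<lambda>x. grad du x \<bullet> G_T_grad g u0 v0 x) integrable_on \<Omega>"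
      by (intro int continuous_intros cont Ck_on_continuous[OF GT])+
    have divc: "continuous_on N0 (divergence (G_T_grad g u0 v0))"
      unfolding divergence_def[abs_def] pd_def
      by (intro continuous_on_sum Ck_on_continuous[OF Ck_on_frechet_derivative[OF Ck_on_vec_nth[OF N0(1) GT]]])
    have i3: "(\<lambda>x. du x \<bullet> divergence (G_T_grad g u0 v0) x) integrable_on \<Omega>"
      by (intro int continuous_intros cont divc)
    have "integral \<Omega> (\<lambda>x. dF x \<bullet> grad v0 x) + integral \<Omega> (\<lambda>x. grad du x \<bullet> G_T_grad g u0 v0 x) =
        integral \<Omega> (\<lambda>x. dF x \<bullet> grad v0 x + grad du x \<bullet> G_T_grad g u0 v0 x)"
      by (rule integral_add[OF i1 i2, symmetric])
    also have "\<dots> = integral \<Omega> (\<lambda>x. du x \<bullet> flux_u_T_grad g u0 v0 x)"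
      by (rule integral_cong) (use volume N0(3) in auto)
    finally have 1: "integral \<Omega> (\<lambda>x. dF x \<bullet> grad v0 x) + integral \<Omega> (\<lambda>x. grad du x \<bullet> G_T_grad g u0 v0 x) =
        integral \<Omega> (\<lambda>x. du x \<bullet> flux_u_T_grad g u0 v0 x)" .
    have "integral \<Omega> (\<lambda>x. du x \<bullet> divergence (G_T_grad g u0 v0) x) + integral \<Omega> (\<lambda>x. grad du x \<bullet> G_T_grad g u0 v0 x) =
        integral \<Omega> (\<lambda>x. du x \<bullet> divergence (G_T_grad g u0 v0) x + grad du x \<bullet> G_T_grad g u0 v0 x)"
      by (rule integral_add[OF i3 i2, symmetric])
    also have "\<dots> = integral \<Omega> (divergence P)"
      by (rule integral_cong) (use divP N0(3) in auto)
    also have "\<dots> = bd_integral \<C> \<Gamma> (\<lambda>x. n x \<bullet> P x)"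
      unfolding \<Gamma>_def n_def by (rule divergence_theorem[OF dom N0(1,2) PC])
    also have "\<dots> = bd_integral \<C> \<Gamma> (\<lambda>x. du x \<bullet> ndot (n x) (G_T_grad g u0 v0 x))"
      by (simp add: nP)
    finally show ?thesis using 1 by simp
  qed
  have "- (integral \<Omega> (\<lambda>x. frechet_derivative (\<lambda>p. F p \<bullet> R p) (at (0, x)) (1, 0)) +
        bd_integral \<C> \<Gamma> (\<lambda>x. n x \<bullet> ((F (0, x) \<bullet> R (0, x)) *\<^sub>R V x))) +
     bd_integral \<C> \<Gamma> (\<lambda>x. n x \<bullet> (frechet_derivative W (at (0, x)) (1, 0) + divergence (\<lambda>y. W (0, y)) x *\<^sub>R V x)) =
     shape_form g \<Omega> \<C> \<Gamma>W V u0 du dF v0"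
    unfolding I1 I2 I3 I5 I6 shape_form_def Let_def using I4
    by (simp add: n_def \<Gamma>_def F0_def dW_def)
  with der show ?thesis
    by (simp add: u0_def[abs_def] v0_def[abs_def] du_def dF_def)
qed

text \<open>Inside \<open>\<Omega>\<close> the derivatives agree because \<open>\<Omega>\<close> is open; up to the boundary they agree by continuity.\<close>

lemma frechet_derivative_agree_on_closure:
  fixes f g :: "real^2 \<Rightarrow> 'b::real_normed_vector"
  assumes N: "open N" "closure \<Omega> \<subseteq> N" and f: "Ck_on (Suc 0) f N" and g: "Ck_on (Suc 0) g N"
    and \<Omega>: "open \<Omega>" "\<And>x. x \<in> \<Omega> \<Longrightarrow> f x = g x" and x: "x \<in> closure \<Omega>"
  shows "f x = g x" "frechet_derivative f (at x) h = frechet_derivative g (at x) h"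
proof -
  have c: "continuous_on (closure \<Omega>) (\<lambda>x. f x - g x)"
    "continuous_on (closure \<Omega>) (\<lambda>x. frechet_derivative f (at x) h - frechet_derivative g (at x) h)"
    by (intro continuous_intros continuous_on_subset[OF _ N(2)] Ck_on_continuous[OF f] Ck_on_continuous[OF g]
      Ck_on_continuous[OF Ck_on_frechet_derivative[OF f]] Ck_on_continuous[OF Ck_on_frechet_derivative[OF g]])+
  show "f x = g x" using continuous_constant_on_closure[OF c(1) _ x, of 0] \<Omega>(2) by simp
  have "frechet_derivative f (at y) h - frechet_derivative g (at y) h = 0" if "y \<in> \<Omega>" for y
    using frechet_derivative_cong_open[OF \<Omega>(1) that \<Omega>(2)] by simp
  then show "frechet_derivative f (at x) h = frechet_derivative g (at x) h"
    using continuous_constant_on_closure[OF c(2) _ x, of 0] by simp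
qed

text \<open>On the boundary, the test function enters the form with its value and its first derivatives only; the
  second derivatives that occur in the volume term are taken inside \<open>\<Omega>\<close>.\<close>

lemma shape_form_cong_test:
  assumes dom: "C1_domain \<Omega> \<C>" and wall: "\<Gamma>W \<subseteq> frontier \<Omega>"
    and N: "open N" "closure \<Omega> \<subseteq> N" and v: "Ck_on (Suc 0) v N" and w: "Ck_on (Suc 0) w N"
    and F: "Ck_on (Suc 0) (flux_field g u) N" and vw: "\<And>x. x \<in> \<Omega> \<Longrightarrow> v x = w x"
  shows "shape_form g \<Omega> \<C> \<Gamma>W V u du dF v = shape_form g \<Omega> \<C> \<Gamma>W V u du dF w"
proof -
  note agree = frechet_derivative_agree_on_closure[OF N v w C1_domainD(1)[OF dom] vw]
  have val: "v x = w x" if "x \<in> closure \<Omega>" for x using agree(1)[OF _ that] by simp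
  have pd: "pd k v x = pd k w x" if "x \<in> closure \<Omega>" for x k unfolding pd_def using agree(2)[OF _ that] by simp
  have gr: "grad v x = grad w x" if "x \<in> closure \<Omega>" for x using pd[OF that] by (simp add: grad_def)
  have GT: "G_T_grad g u v x = G_T_grad g u w x" if "x \<in> closure \<Omega>" for x using pd[OF that] by (simp add: G_T_grad_def)
  have fu: "flux_u_T_grad g u v x = flux_u_T_grad g u w x" if "x \<in> closure \<Omega>" for x using pd[OF that] by (simp add: flux_u_T_grad_def)
  have in_cl: "x \<in> closure \<Omega>" if "x \<in> \<Omega>" for x using that closure_subset by blast
  have dGT: "divergence (G_T_grad g u v) x = divergence (G_T_grad g u w) x" if "x \<in> \<Omega>" for x
    unfolding divergence_def pd_def
    by (intro sum.cong refl fun_cong[OF frechet_derivative_cong_open[OF C1_domainD(1)[OF dom] that]]) (simp add: GT in_cl)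
  have fr: "x \<in> closure \<Omega>" if "x \<in> frontier \<Omega>" for x using C1_domainD(8)[OF dom that] .
  have W: "Ck_on (Suc 0) (\<lambda>y. flux_field g u y $ k \<bullet> z y) N" if "Ck_on (Suc 0) z N" for k z
    by (intro Ck_on_inner Ck_on_vec_nth N F that)
  have dW: "divergence (\<lambda>y. \<chi> k. flux_field g u y $ k \<bullet> v y) x = divergence (\<lambda>y. \<chi> k. flux_field g u y $ k \<bullet> w y) x"
    if "x \<in> closure \<Omega>" for x
    unfolding divergence_def pd_def vec_lambda_beta
    by (intro sum.cong refl frechet_derivative_agree_on_closure(2)[OF N W[OF v] W[OF w] C1_domainD(1)[OF dom] _ that]) (simp add: vw)
  have W\<Gamma>: "x \<in> closure \<Omega>" if "x \<in> \<Gamma>W" for x using fr wall that by blast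
  have D\<Gamma>: "x \<in> closure \<Omega>" if "x \<in> frontier \<Omega> - \<Gamma>W" for x using fr that by blast
  show ?thesis
    unfolding shape_form_def Let_def n_flux_u_T_def n_G_T_def
    by (intro arg_cong2[of _ _ _ _ "(+)"] arg_cong2[of _ _ _ _ "(-)"] arg_cong[of _ _ uminus] integral_cong bd_integral_cong)
      (simp_all add: fu dGT in_cl gr val GT fr W\<Gamma> D\<Gamma> dW)
qed

section \<open>The shape derivative of the compressible Navier--Stokes equations\<close>

lemma regular_familyE:
  assumes "regular_family m \<Omega> w" "2 \<le> m"
  obtains N where "open N" "{0} \<times> closure \<Omega> \<subseteq> N" "Ck_on 2 (\<lambda>p. w (fst p) (snd p)) N"
proof -
  obtain N where "open N" "{0} \<times> closure \<Omega> \<subseteq> N" "Ck_on m (\<lambda>(t, x). w t x) N"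
    using assms(1) unfolding regular_family_def by blast
  then show ?thesis using that[of N] Ck_on_le[OF _ assms(2), of "\<lambda>(t, x). w t x" N] by (simp add: case_prod_unfold)
qed

lemma family_Ck_closure_moved:
  assumes dom: "C1_domain \<Omega> \<C>" and V: "Ck_on (Suc 0) V UNIV" and KV: "compact KV" "\<And>x. x \<notin> KV \<Longrightarrow> V x = 0"
    and N: "open N" "{0} \<times> closure \<Omega> \<subseteq> N" and w: "Ck_on 2 (\<lambda>p. w (fst p) (snd p)) N"
  shows "\<forall>\<^sub>F t in nhds 0. Ck_closure 1 (w t) (move V t ` \<Omega>)"
proof -
  obtain L a1 where a1: "a1 > 0" "\<And>t. \<bar>t\<bar> \<le> a1 \<Longrightarrow> displacement V L t"
    using small_displacements[OF V KV] by metis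
  obtain a2 where a2: "a2 > 0" "\<And>t x. \<bar>t\<bar> \<le> a2 \<Longrightarrow> x \<in> closure \<Omega> \<Longrightarrow> (t, move V t x) \<in> N"
    using joint_tube[OF Ck_on_continuous[OF V] N C1_domainD(5)[OF dom]] by metis
  have w1: "Ck_on 1 (\<lambda>p. w (fst p) (snd p)) N" by (rule Ck_on_le[OF w]) simp
  have "\<forall>\<^sub>F t in nhds 0. t \<in> {- min a1 a2 <..< min a1 a2}"
    by (rule eventually_nhds_in_open) (use a1(1) a2(1) in auto)
  then show ?thesis
  proof eventually_elim
    case (elim t)
    then have t: "\<bar>t\<bar> \<le> a1" "\<bar>t\<bar> \<le> a2" by auto
    interpret displacement V L t by (rule a1(2)[OF t(1)])
    have "closure (move V t ` \<Omega>) \<subseteq> {x. (t, x) \<in> N}"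
      using closure_move[OF C1_domainD(5)[OF dom]] a2(2)[OF t(2)] by blast
    moreover have "Ck_on 1 (w t) {x. (t, x) \<in> N}" using time_slice(2)[OF N(1) w1, of t] by (simp del: Ck_on.simps)
    ultimately show ?case unfolding Ck_closure_def using time_slice(1)[OF N(1) w1, of t] by blast
  qed
qed

theorem theorem3p2:
  fixes g :: gas
    and D \<Omega> \<Gamma>W \<Gamma>iso \<Gamma>adia :: "(real^2) set"
    and \<C> :: "(real \<Rightarrow> real^2) set"
    and V :: "real^2 \<Rightarrow> real^2"
    and Twall :: "real^2 \<Rightarrow> real"
    and X :: "real \<Rightarrow> 4 \<Rightarrow> (real^2 \<Rightarrow> real) set"
    and ip :: "real \<Rightarrow> 4 \<Rightarrow> (real^2 \<Rightarrow> real) \<Rightarrow> (real^2 \<Rightarrow> real) \<Rightarrow> real"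
    and H :: "real \<Rightarrow> (real^2 \<Rightarrow> real^4) set"
    and u :: "real \<Rightarrow> real^2 \<Rightarrow> real^4"
    and k m :: nat
  assumes gas: "gas_ok g"
    and hold_all: "open D" "\<Omega> \<subseteq> D"
    and domain: "C1_domain \<Omega> \<C>"
    and wall: "\<Gamma>W \<subseteq> frontier \<Omega>" "\<Gamma>W \<in> sets borel" "\<Gamma>W = \<Gamma>iso \<union> \<Gamma>adia" "\<Gamma>iso \<inter> \<Gamma>adia = {}"
    and V: "k \<ge> 1" "Ck_compact_support k V D"
    and V_far: "\<exists>N. open N \<and> frontier \<Omega> - \<Gamma>W \<subseteq> N \<and> (\<forall>x\<in>N. V x = 0)"
    and V_normal: "\<forall>x\<in>\<Gamma>W. V x = (V x \<bullet> outer_normal \<Omega> x) *\<^sub>R outer_normal \<Omega> x"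
    and m: "m \<ge> 2"
    and H_def: "\<And>t. H t = product_space (X t)"
    and hilbert: "\<forall>\<^sub>F t in nhds 0. \<forall>i. hilbert_function_space (move V t ` \<Omega>) (X t i) (ip t i)"
    and extend: "\<And>v. v \<in> H 0 \<Longrightarrow> Ck_closure m v \<Omega> \<Longrightarrow> \<exists>w. family_in m \<Omega> H w \<and> (\<forall>x\<in>\<Omega>. w 0 x = v x)"
    and local_derivative_admissible: "\<And>w. family_in m \<Omega> H w \<Longrightarrow> local_derivative w \<in> H 0"
    and u_regular: "regular_family m \<Omega> u"
    and u_solution: "\<forall>\<^sub>F t in nhds 0. ns_solution g (move V t ` \<Omega>) (moved_curves V t \<C>)
          (move V t ` \<Gamma>iso) (move V t ` \<Gamma>adia) Twall (H t) (u t)"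
  shows "(\<forall>v. family_in m \<Omega> H v \<longrightarrow>
            ((\<lambda>t. variational_form g (move V t ` \<Omega>) (moved_curves V t \<C>) (u t) (v t)) has_real_derivative
              shape_form g \<Omega> \<C> \<Gamma>W V (u 0) (local_derivative u)
                (local_derivative (\<lambda>t. flux_field g (u t))) (v 0)) (at 0)) \<and>
         local_derivative u \<in> H 0 \<and>
         (\<forall>v\<in>H 0. Ck_closure m v \<Omega> \<longrightarrow>
            0 = shape_form g \<Omega> \<C> \<Gamma>W V (u 0) (local_derivative u)
                  (local_derivative (\<lambda>t. flux_field g (u t))) v)"
proof -
  have V1: "Ck_on (Suc 0) V UNIV"
    using V Ck_on_le[of k V UNIV "Suc 0"] by (simp add: Ck_compact_support_def del: Ck_on.simps)
  obtain KV where KV: "compact KV" "\<And>x. x \<notin> KV \<Longrightarrow> V x = 0"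
    using V(2) unfolding Ck_compact_support_def by blast
  have far: "V x = 0" if "x \<in> frontier \<Omega> - \<Gamma>W" for x using V_far that by blast
  have move0: "move V 0 = (\<lambda>x. x)" by (simp add: move_def fun_eq_iff)
  have sol0: "ns_solution g \<Omega> \<C> \<Gamma>iso \<Gamma>adia Twall (H 0) (u 0)"
    using eventually_nhds_x_imp_x[OF u_solution] by (simp add: move0 o_def)
  obtain Nu where Nu: "open Nu" "{0} \<times> closure \<Omega> \<subseteq> Nu" "Ck_on 2 (\<lambda>p. u (fst p) (snd p)) Nu"
    using regular_familyE[OF u_regular m] .
  \<comment> \<open>positivity of density and temperature at \<open>t = 0\<close> persists on a neighbourhood in \<open>(t, x)\<close>\<close>
  define M where "M = Nu \<inter> (\<lambda>p. u (fst p) (snd p)) -` physical_states g"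
  have M: "open M" "{0} \<times> closure \<Omega> \<subseteq> M" "Ck_on 2 (\<lambda>p. u (fst p) (snd p)) M"
    "(\<lambda>p. u (fst p) (snd p)) ` M \<subseteq> physical_states g"
  proof -
    show "open M" unfolding M_def
      by (rule continuous_open_preimage[OF Ck_on_continuous[OF Nu(3)] Nu(1) open_physical_states])
    show "{0} \<times> closure \<Omega> \<subseteq> M"
      using Nu(2) sol0 by (auto simp: M_def ns_solution_def physical_states_def)
    show "Ck_on 2 (\<lambda>p. u (fst p) (snd p)) M" by (rule Ck_on_subset[OF Nu(3)]) (simp add: M_def)
  qed (auto simp: M_def)
  have derivative: "((\<lambda>t. variational_form g (move V t ` \<Omega>) (moved_curves V t \<C>) (u t) (v t)) has_real_derivative
              shape_form g \<Omega> \<C> \<Gamma>W V (u 0) (local_derivative u)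
                (local_derivative (\<lambda>t. flux_field g (u t))) (v 0)) (at 0)"
    if v: "family_in m \<Omega> H v" for v
  proof -
    obtain Nv where Nv: "open Nv" "{0} \<times> closure \<Omega> \<subseteq> Nv" "Ck_on 2 (\<lambda>p. v (fst p) (snd p)) Nv"
      using regular_familyE[OF conjunct1[OF v[unfolded family_in_def]] m] .
    define N where "N = M \<inter> Nv"
    have N: "open N" "{0} \<times> closure \<Omega> \<subseteq> N" using M Nv by (auto simp: N_def)
    have C2: "Ck_on 2 (\<lambda>p. u (fst p) (snd p)) N" "Ck_on 2 (\<lambda>p. v (fst p) (snd p)) N"
      by (rule Ck_on_subset[OF M(3)] Ck_on_subset[OF Nv(3)]; simp add: N_def)+
    have "(\<lambda>p. u (fst p) (snd p)) ` N \<subseteq> physical_states g" using M(4) by (auto simp: N_def)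
    moreover have "variational_form g \<Omega> \<C> (u 0) (local_derivative v) = 0"
    proof -
      have "Ck_on (Suc 0) (local_derivative v) {x. (0, x) \<in> N}"
        using family_local_derivative_C1[OF N(1) C2(2)] by (simp del: Ck_on.simps)
      then have "Ck_closure 1 (local_derivative v) \<Omega>"
        unfolding Ck_closure_def One_nat_def using time_slice(1)[OF N(1) C2(2), of 0] N(2) by blast
      then show ?thesis using sol0 local_derivative_admissible[OF v] by (simp add: ns_solution_def)
    qed
    ultimately show ?thesis
      using shape_derivative[OF gas domain wall(1,2) V1 KV far N C2] by simp
  qed
  have u_family: "family_in m \<Omega> H u"
    unfolding family_in_def
    using u_regular u_solution by (auto elim: eventually_mono simp: ns_solution_def)
  have "0 = shape_form g \<Omega> \<C> \<Gamma>W V (u 0) (local_derivative u) (local_derivative (\<lambda>t. flux_field g (u t))) v"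
    if v: "v \<in> H 0" "Ck_closure m v \<Omega>" for v
  proof -
    obtain w where w: "family_in m \<Omega> H w" "\<And>x. x \<in> \<Omega> \<Longrightarrow> w 0 x = v x"
      using extend[OF v] by blast
    obtain Nw where Nw: "open Nw" "{0} \<times> closure \<Omega> \<subseteq> Nw" "Ck_on 2 (\<lambda>p. w (fst p) (snd p)) Nw"
      using regular_familyE[OF conjunct1[OF w(1)[unfolded family_in_def]] m] .
    have "\<forall>\<^sub>F t in nhds 0. w t \<in> H t" using w(1) by (simp add: family_in_def)
    moreover have "\<forall>\<^sub>F t in nhds 0. Ck_closure 1 (w t) (move V t ` \<Omega>)"
      by (rule family_Ck_closure_moved[OF domain V1 KV(1) _ Nw]) (rule KV(2))
    ultimately have "\<forall>\<^sub>F t in nhds 0. variational_form g (move V t ` \<Omega>) (moved_curves V t \<C>) (u t) (w t) = 0"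
      using u_solution by eventually_elim (simp add: ns_solution_def)
    then have "((\<lambda>t. variational_form g (move V t ` \<Omega>) (moved_curves V t \<C>) (u t) (w t)) has_real_derivative 0) (at 0)"
      by (subst DERIV_cong_ev[OF refl _ refl]) auto
    from DERIV_unique[OF this derivative[OF w(1)]]
    \<comment> \<open>the variational form vanishes identically near \<open>t = 0\<close>\<close>
    have zero: "0 = shape_form g \<Omega> \<C> \<Gamma>W V (u 0) (local_derivative u) (local_derivative (\<lambda>t. flux_field g (u t))) (w 0)" .
    obtain Nv where Nv: "open Nv" "closure \<Omega> \<subseteq> Nv" "Ck_on m v Nv"
      using v(2) unfolding Ck_closure_def by blast
    define N where "N = Nv \<inter> ({x. (0, x) \<in> Nw} \<inter> {x. (0, x) \<in> M})"
    have N: "open N" "closure \<Omega> \<subseteq> N"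
      using Nv Nw(2) M(2) time_slice(1)[OF Nw(1,3), of 0] time_slice(1)[OF M(1,3), of 0] by (auto simp: N_def)
    have "Ck_on (Suc 0) v Nv" using Ck_on_le[OF Nv(3)] m by (simp del: Ck_on.simps)
    then have v1: "Ck_on (Suc 0) v N" by (rule Ck_on_subset) (simp add: N_def)
    have "Ck_on 2 (w 0) {x. (0, x) \<in> Nw}" using time_slice(2)[OF Nw(1,3), of 0] by (simp del: Ck_on.simps)
    then have "Ck_on (Suc 0) (w 0) {x. (0, x) \<in> Nw}" by (rule Ck_on_le) simp
    then have w1: "Ck_on (Suc 0) (w 0) N" by (rule Ck_on_subset) (auto simp: N_def)
    have "Ck_on (Suc 0) (flux_field g (u 0)) {x. (0, x) \<in> M}"
      using time_slice(2)[OF M(1) flux_family_C1[OF gas M(1,3,4)], of 0] by (simp del: Ck_on.simps)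
    then have F1: "Ck_on (Suc 0) (flux_field g (u 0)) N" by (rule Ck_on_subset) (auto simp: N_def)
    show ?thesis
      using zero shape_form_cong_test[OF domain wall(1) N w1 v1 F1 w(2)] by simp
  qed
  then show ?thesis
    using derivative local_derivative_admissible[OF u_family] by blast
qed

end
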